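(* Let $r,s\in\mathbb N$, $\boldsymbol m=(m_1,\dots,m_r)\in\mathscr V_r$ and $\boldsymbol n=(n_1,\dots,n_s)\in\mathscr V_s$. Then there is a polynomial $\widetilde\Phi^{(\beta)}_{\boldsymbol m,\boldsymbol n}(y)\in\mathbb Z[\beta,y]$, monic in $y$ of degree $$d=|\boldsymbol m|+|\boldsymbol n|-\binom r2-\binom s2,$$ such that, identically in $\beta$ and $x$, $$\Psi^{(\beta)}_{\boldsymbol m,\boldsymbol n}(x)=\kappa^{(\beta)}_{\boldsymbol m,\boldsymbol n}\,e^{-\frac12(r+s)x^2}\,x^{\frac12(r-s)^2+\beta(r-s)}\,\widetilde\Phi^{(\beta)}_{\boldsymbol m,\boldsymbol n}(x^2).$$ Writing $\widetilde\Phi^{(\beta)}_{\boldsymbol m,\boldsymbol n}(y)=\sum_{k=0}^d\widetilde\phi^{[k]}_{\boldsymbol m,\boldsymbol n}(\beta)\,y^k$, each $\widetilde\phi^{[k]}_{\boldsymbol m,\boldsymbol n}(\beta)\in\mathbb Z[\beta]$ has degree $\le d-k$ in $\beta$. Moreover, as rational functions of $\beta$, $$\widetilde\phi^{[0]}_{\boldsymbol m,\boldsymbol n}(\beta)=(-1)^d\prod_{i=1}^r(\beta+i)_{m_i+1-i}\prod_{j=1}^s(-\beta+j)_{n_j+1-j}\prod_{i=1}^r\prod_{j=1}^s\frac{j-i-\beta}{n_j-m_i-\beta},$$ $\widetilde\phi^{[d]}_{\boldsymbol m,\boldsymbol n}(\beta)=1$, $$\widetilde\phi^{[d-1]}_{\boldsymbol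 m,\boldsymbol n}(\beta)=-\rho_2^++(N-1)\rho_1^+-\binom N3-\beta\bigl(\rho_1^--R+S\bigr),$$ and $$\begin{aligned}\widetilde\phi^{[d-2]}_{\boldsymbol m,\boldsymbol n}(\beta)&=\frac{(\rho_2^+)^2}{2}-\rho_3^+-(N-1)\rho_2^+\rho_1^++\frac{(N-1)(N^2-2N+9)}{6}\rho_2^++\frac{N^2-2N+2}{2}(\rho_1^+)^2\\&\quad-\frac{(N-1)^2(N^2-2N+6)}{6}\rho_1^++\frac{N(N-1)^2(N-2)(N^2-2N+9)}{72}\\&\quad+\beta\Bigl(\rho_2^+\rho_1^--\tfrac32\rho_2^--(N-1)\bigl(\rho_1^+\rho_1^-+\tfrac{r-s}{2}\rho_2^+\bigr)+\tfrac{(N^2-2N+2)(r-s)}{2}\rho_1^+\\&\qquad+\tfrac{(N-1)(N^2-2N+9)}{6}\rho_1^--\tfrac{(N^2-2N+6)(N-1)^2(r-s)}{12}\Bigr)\\&\quad+\beta^2\Bigl(\tfrac{(\rho_1^-)^2}{2}-\tfrac{\rho_1^+}{2}-(R-S)\rho_1^-+\tfrac{R(R+1)+S(S+1)}{2}-RS\Bigr),\end{aligned}$$ where $N=r+s$, $\rho_k^\pm=\sum_{i=1}^rm_i^k\pm\sum_{j=1}^sn_j^k$, $R=\binom r2$, $S=\binom s2$.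
   Context: $\mathbb N=\{0,1,2,\dots\}$; $(z)_m=\prod_{j=0}^{m-1}(z+j)$ is the rising Pochhammer symbol. For $n\in\mathbb N$, $\beta\in\mathbb C$, the monic generalized Laguerre polynomial is $\widehat L_n^{(\beta)}(y)=\sum_{i=0}^n(-1)^{n+i}\binom ni(\beta+i+1)_{n-i}y^i$. Set $\psi_\pm^{(\beta)}(n,x)=e^{-x^2/2}x^{\frac12\pm\beta}\widehat L_n^{(\pm\beta)}(x^2)$. $\mathscr V_r=\{(m_1,\dots,m_r)\in\mathbb N^r: m_1>m_2>\dots>m_r\}$, and $|\boldsymbol v|=\sum_iv_i$. $\Psi^{(\beta)}_{\boldsymbol m,\boldsymbol n}(x)$ denotes the Wronskian determinant $\det(\partial_x^{a-1}f_b)_{a,b=1}^{r+s}$ of the functions $f_1,\dots,f_{r+s}$ equal to $\psi_+^{(\beta)}(m_1,x),\dots,\psi_+^{(\beta)}(m_r,x),\psi_-^{(\beta)}(n_1,x),\dots,\psi_-^{(\beta)}(n_s,x)$. For a vector $\boldsymbol v=(v_1,\dots,v_k)$, $\Delta(\boldsymbol v)=\prod_{1\le i<j\le k}(v_j-v_i)$, and $\kappa^{(\beta)}_{\boldsymbol m,\boldsymbol n}=\Delta(2m_1+\beta,\dots,2m_r+\beta,2n_1-\beta,\dots,2n_s-\beta)$. *)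

theory Defs
  imports "HOL-Analysis.Complex_Transcendental" "HOL-Computational_Algebra.Polynomial"
    "Jordan_Normal_Form.Determinant"
begin

definition nderiv :: "nat \<Rightarrow> (real \<Rightarrow> complex) \<Rightarrow> real \<Rightarrow> complex" where
  "nderiv k f = ((\<lambda>g t. vector_derivative g (at t)) ^^ k) f"

definition laguerre_hat :: "nat \<Rightarrow> complex \<Rightarrow> complex \<Rightarrow> complex" where
  "laguerre_hat n \<beta> y = (\<Sum>i=0..n. (-1)^(n+i) * of_nat (n choose i)
      * pochhammer (\<beta> + of_nat i + 1) (n - i) * y ^ i)"

definition psi_plus :: "complex \<Rightarrow> nat \<Rightarrow> real \<Rightarrow> complex" where
  "psi_plus \<beta> n x = exp (- complex_of_real (x^2) / 2)
      * complex_of_real x powr (1/2 + \<beta>) * laguerre_hat n \<beta> (complex_of_real (x^2))"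

definition psi_minus :: "complex \<Rightarrow> nat \<Rightarrow> real \<Rightarrow> complex" where
  "psi_minus \<beta> n x = exp (- complex_of_real (x^2) / 2)
      * complex_of_real x powr (1/2 - \<beta>) * laguerre_hat n (-\<beta>) (complex_of_real (x^2))"

text \<open>The Wronskian \<Psi>: functions f_1..f_{r+s} indexed here from 0.\<close>
definition wr_fun :: "complex \<Rightarrow> nat list \<Rightarrow> nat list \<Rightarrow> nat \<Rightarrow> real \<Rightarrow> complex" where
  "wr_fun \<beta> ms ns b = (if b < length ms then psi_plus \<beta> (ms ! b)
                        else psi_minus \<beta> (ns ! (b - length ms)))"

definition Psi :: "complex \<Rightarrow> nat list \<Rightarrow> nat list \<Rightarrow> real \<Rightarrow> complex" where
  "Psi \<beta> ms ns x = (let N = length ms + length ns in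
     Determinant.det (mat N N (\<lambda>(a, b). nderiv a (wr_fun \<beta> ms ns b) x)))"

definition Delta :: "complex list \<Rightarrow> complex" where
  "Delta v = (\<Prod>j<length v. \<Prod>i<j. v ! j - v ! i)"

definition kappa :: "complex \<Rightarrow> nat list \<Rightarrow> nat list \<Rightarrow> complex" where
  "kappa \<beta> ms ns = Delta (map (\<lambda>m. 2 * of_nat m + \<beta>) ms @ map (\<lambda>n. 2 * of_nat n - \<beta>) ns)"

definition eval2 :: "int poly poly \<Rightarrow> complex \<Rightarrow> complex \<Rightarrow> complex" where
  "eval2 P \<beta> y = poly (map_poly (\<lambda>c. poly (map_poly of_int c) \<beta>) P) y"

text \<open>Pochhammer symbol with integer index: (z)_k = Gamma(z+k)/Gamma(z) as rational function,
  i.e. (z)_{-k} = 1 / ((z-1)(z-2)...(z-k)).\<close>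
definition gpoch :: "complex \<Rightarrow> int \<Rightarrow> complex" where
  "gpoch z k = (if k \<ge> 0 then pochhammer z (nat k)
                else 1 / (\<Prod>j=1..nat (-k). (z - of_nat j)))"

definition rho_plus :: "nat list \<Rightarrow> nat list \<Rightarrow> nat \<Rightarrow> complex" where
  "rho_plus ms ns k = of_nat (sum_list (map (\<lambda>m. m ^ k) ms) + sum_list (map (\<lambda>n. n ^ k) ns))"

definition rho_minus :: "nat list \<Rightarrow> nat list \<Rightarrow> nat \<Rightarrow> complex" where
  "rho_minus ms ns k = of_nat (sum_list (map (\<lambda>m. m ^ k) ms)) - of_nat (sum_list (map (\<lambda>n. n ^ k) ns))"

definition deg_d :: "nat list \<Rightarrow> nat list \<Rightarrow> nat" where
  "deg_d ms ns = sum_list ms + sum_list ns - (length ms choose 2) - (length ns choose 2)"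

definition phi0_formula :: "nat list \<Rightarrow> nat list \<Rightarrow> complex \<Rightarrow> complex" where
  "phi0_formula ms ns \<beta> = (let r = length ms; s = length ns in
     (-1) ^ deg_d ms ns
     * (\<Prod>i=1..r. gpoch (\<beta> + of_nat i) (int (ms ! (i-1)) + 1 - int i))
     * (\<Prod>j=1..s. gpoch (-\<beta> + of_nat j) (int (ns ! (j-1)) + 1 - int j))
     * (\<Prod>i=1..r. \<Prod>j=1..s. (of_nat j - of_nat i - \<beta>)
                             / (of_nat (ns ! (j-1)) - of_nat (ms ! (i-1)) - \<beta>)))"

definition phi_dm1_formula :: "nat list \<Rightarrow> nat list \<Rightarrow> complex \<Rightarrow> complex" where
  "phi_dm1_formula ms ns \<beta> = (let r = length ms; s = length ns; N = of_nat (r + s) :: complex;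
       R = of_nat (r choose 2) :: complex; S = of_nat (s choose 2) :: complex;
       p1 = rho_plus ms ns 1; p2 = rho_plus ms ns 2; q1 = rho_minus ms ns 1 in
     - p2 + (N - 1) * p1 - of_nat ((r + s) choose 3) - \<beta> * (q1 - R + S))"

definition phi_dm2_formula :: "nat list \<Rightarrow> nat list \<Rightarrow> complex \<Rightarrow> complex" where
  "phi_dm2_formula ms ns \<beta> = (let r = length ms; s = length ns; N = of_nat (r + s) :: complex;
       R = of_nat (r choose 2) :: complex; S = of_nat (s choose 2) :: complex;
       rs = of_int (int r - int s) :: complex;
       p1 = rho_plus ms ns 1; p2 = rho_plus ms ns 2; p3 = rho_plus ms ns 3;
       q1 = rho_minus ms ns 1; q2 = rho_minus ms ns 2 in
     p2^2 / 2 - p3 - (N - 1) * p2 * p1 + (N - 1) * (N^2 - 2*N + 9) / 6 * p2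
       + (N^2 - 2*N + 2) / 2 * p1^2
       - (N - 1)^2 * (N^2 - 2*N + 6) / 6 * p1
       + N * (N - 1)^2 * (N - 2) * (N^2 - 2*N + 9) / 72
     + \<beta> * (p2 * q1 - 3/2 * q2 - (N - 1) * (p1 * q1 + rs / 2 * p2)
            + (N^2 - 2*N + 2) * rs / 2 * p1
            + (N - 1) * (N^2 - 2*N + 9) / 6 * q1
            - (N^2 - 2*N + 6) * (N - 1)^2 * rs / 12)
     + \<beta>^2 * (q1^2 / 2 - p1 / 2 - (R - S) * q1 + (R * (R + 1) + S * (S + 1)) / 2 - R * S))"

end

theory Submission
  imports Defs "HOL-Computational_Algebra.Formal_Power_Series"
begin

text \<open>
  Put \<open>y = x\<^sup>2\<close>, \<open>u = 1/y\<close> and \<open>z\<^sub>b = m\<^sub>b\<close> or \<open>z\<^sub>b = n\<^sub>b - \<beta>\<close>. Up to the common prefactor every function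
  is \<open>x\<^bsup>2z\<^esup>\<close> times \<open>\<Sum>\<^sub>k c\<^sub>k(z) u\<^sup>k\<close>, where \<open>c\<^sub>k(z) = (-1)\<^sup>k/k! \<Prod>\<^sub>j\<^sub><\<^sub>k (z - j)(z + \<beta> - j)\<close> is a polynomial
  in \<open>z\<close> that is the same for both families. Hence unitriangular row operations turn the
  Wronskian into \<open>D(u) = det (\<Sum>\<^sub>k c\<^sub>k(z\<^sub>b) (z\<^sub>b - k)\<^sup>a u\<^sup>k)\<close>, which the Vandermonde product
  \<open>\<Delta>(z)\<close> divides in \<open>\<rat>[\<beta>,u]\<close> by Newton interpolation, and \<open>D(u) = \<Delta>(z) q(u)\<close> with
  \<open>\<Phi>(y) = y\<^sup>d q(1/y)\<close>. Expanding \<open>D\<close> multilinearly into Vandermonde products \<open>\<Delta>(z - k)\<close> gives the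
  degree bounds and the lowest coefficient.

  Integrality of \<open>q\<close> is the subtle point, since \<open>\<Delta>(z)\<close> contains the integers \<open>m\<^sub>i - m\<^sub>j\<close>. The rows of
  \<open>D\<close> are combinations of \<open>m! [t\<^sup>m\<^sup>-\<^sup>j] H(t)\<close> with \<open>H' = P H\<close> and \<open>P\<close> integral. Fix a prime \<open>l\<close>.
  Multiplying \<open>H\<close> by integral factors \<open>1 - a t\<^sup>k\<close> with \<open>l\<close> not dividing \<open>k\<close> makes it a series in \<open>t\<^sup>l\<close>;
  then the determinant decouples along the residues modulo \<open>l\<close>, and the exponents \<open>m\<close> are replaced
  by \<open>\<lfloor>m/l\<rfloor>\<close>, so that \<open>l\<close>-integrality follows by descent.

  For the top coefficients, \<open>\<partial>\<^sub>u D = - \<Sum>\<^sub>b (z\<^sub>b\<^sup>2 + \<beta> z\<^sub>b) D(z - e\<^sub>b)\<close> reduces them to the sums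
  \<open>\<Sum>\<^sub>b z\<^sub>b\<^sup>k \<Prod>\<^sub>a\<^sub>\<noteq>\<^sub>b (1 - 1/(z\<^sub>b - z\<^sub>a))\<close>, which partial fractions evaluate recursively.
\<close>

subsection \<open>Determinants and Vandermonde products\<close>

text \<open>The factor \<open>1/k!\<close> in \<open>c_k\<close> is the obstacle: interpolation
  alone yields \<open>q\<close> over the rationals only. Differences across the two families equal
  an integer minus \<beta> and can be cancelled integrally; the integer differences inside a family
  are what the prime-by-prime descent is for. It runs on series with integral logarithmic derivative
  because \<open>H\<close> itself has factorial denominators. This class is stable under removing
  the integral factors and, once \<open>H\<close> is a series in \<open>t^l\<close>, under taking
  \<open>l t^l\<close> as the new variable up to scale, which absorbs the \<open>l\<close> produced
  by differentiating \<open>t^l\<close>. The powers of \<open>l\<close> then balance. Columns in a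
  common residue class of size \<open>t\<close> lose one \<open>l\<close> per pair when exponents
  are replaced by their quotients. A row with shift \<open>j\<close> supplies \<open>l\<close> to
  the power \<open>j div l\<close>, and in a nonvanishing determinant the \<open>t\<close> rows of
  that class have distinct quotients, whose sum is at least \<open>0 + ... + (t - 1)\<close>, again
  one per pair.\<close>

definition dt :: "nat \<Rightarrow> (nat \<Rightarrow> nat \<Rightarrow> 'a::comm_ring_1) \<Rightarrow> 'a" where
  "dt n f = Determinant.det (mat n n (\<lambda>(i, j). f i j))"

lemma dt_leibniz: "dt n f = (\<Sum>p | p permutes {0..<n}. signof p * (\<Prod>i=0..<n. f i (p i)))"
proof -
  have "p i < n" if "p permutes {0..<n}" "i < n" for p i
    using that permutes_in_image[of p "{0..<n}" i] by simp
  then show ?thesis unfolding dt_def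
    by (subst det_def'[of _ n]) (auto intro!: sum.cong prod.cong)
qed

lemma dt_cong: "(\<And>i j. i < n \<Longrightarrow> j < n \<Longrightarrow> f i j = g i j) \<Longrightarrow> dt n f = dt n g"
  unfolding dt_def by (rule arg_cong[of _ _ Determinant.det]) (auto intro: eq_matI)

lemma dt_transpose: "dt n (\<lambda>i j. f j i) = dt n f"
proof -
  have "transpose_mat (mat n n (\<lambda>(i, j). f i j)) = mat n n (\<lambda>(i, j). f j i)" by (auto intro: eq_matI)
  then show ?thesis unfolding dt_def using det_transpose[of "mat n n (\<lambda>(i, j). f i j)" n] by simp
qed

lemma dt_mult_rows: "dt n (\<lambda>i j. a i * f i j) = (\<Prod>i<n. a i) * dt n f"
  unfolding dt_leibniz
  by (simp add: prod.distrib sum_distrib_left atLeast0LessThan mult_ac)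

lemma dt_mult_cols: "dt n (\<lambda>i j. a j * f i j) = (\<Prod>i<n. a i) * dt n f"
  using dt_mult_rows[of n a "\<lambda>i j. f j i"] dt_transpose[of n f] 
     dt_transpose[of n "\<lambda>i j. a j * f i j"] by simp

lemma dt_sum_rows:
  assumes "\<And>i. i < n \<Longrightarrow> finite (S i)"
  shows "dt n (\<lambda>i j. \<Sum>k\<in>S i. f i k j) = (\<Sum>k\<in>PiE {..<n} S. dt n (\<lambda>i j. f i (k i) j))"
proof -
  have "dt n (\<lambda>i j. \<Sum>k\<in>S i. f i k j) =
     (\<Sum>p | p permutes {0..<n}. \<Sum>k\<in>PiE {..<n} S. signof p * (\<Prod>i=0..<n. f i (k i) (p i)))"
    unfolding dt_leibniz atLeast0LessThan using assms
    by (intro sum.cong refl, subst prod_sum_PiE) (auto simp: sum_distrib_left)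
  also have "\<dots> = (\<Sum>k\<in>PiE {..<n} S. dt n (\<lambda>i j. f i (k i) j))"
    unfolding dt_leibniz by (rule sum.swap)
  finally show ?thesis .
qed

lemma dt_sum_cols:
  assumes "\<And>j. j < n \<Longrightarrow> finite (S j)"
  shows "dt n (\<lambda>i j. \<Sum>k\<in>S j. f j k i) = (\<Sum>k\<in>PiE {..<n} S. dt n (\<lambda>i j. f j (k j) i))"
proof -
  have "dt n (\<lambda>i j. \<Sum>k\<in>S j. f j k i) = dt n (\<lambda>i j. \<Sum>k\<in>S i. f i k j)"
    by (rule dt_transpose[of n "\<lambda>i j. \<Sum>k\<in>S i. f i k j"])
  also have "\<dots> = (\<Sum>k\<in>PiE {..<n} S. dt n (\<lambda>i j. f i (k i) j))"
    by (rule dt_sum_rows) (rule assms)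
  also have "\<dots> = (\<Sum>k\<in>PiE {..<n} S. dt n (\<lambda>i j. f j (k j) i))"
    by (intro sum.cong refl dt_transpose[symmetric])
  finally show ?thesis .
qed

lemma dt_mat_mult: "dt n (\<lambda>i j. \<Sum>k<n. f i k * g k j) = dt n f * dt n g"
proof -
  have "mat n n (\<lambda>(i, j). \<Sum>k<n. f i k * g k j)
      = mat n n (\<lambda>(i, j). f i j) * mat n n (\<lambda>(i, j). g i j)"
    by (rule eq_matI) (auto simp: scalar_prod_def atLeast0LessThan)
  then show ?thesis unfolding dt_def by (simp add: det_mult[of _ n])
qed

lemma dt_upper_triangular:
  assumes "\<And>i j. j < i \<Longrightarrow> i < n \<Longrightarrow> f i j = 0"
  shows "dt n f = (\<Prod>i<n. f i i)"
proof -
  have "diag_mat (mat n n (\<lambda>(i, j). f i j)) = map (\<lambda>i. f i i) [0..<n]"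
    by (auto simp: diag_mat_def)
  then show ?thesis unfolding dt_def
    by (subst det_upper_triangular[of _ n])
       (auto simp: assms prod.list_conv_set_nth atLeast0LessThan upper_triangular_def)
qed

lemma dt_lower_triangular:
  assumes "\<And>i j. i < j \<Longrightarrow> j < n \<Longrightarrow> f i j = 0"
  shows "dt n f = (\<Prod>i<n. f i i)"
  using dt_upper_triangular[of n "\<lambda>i j. f j i"] assms dt_transpose[of n f] by simp

lemma dt_nonzero_permutation:
  assumes "dt n f \<noteq> 0"
  obtains p where "p permutes {..<n}" "\<And>i. i < n \<Longrightarrow> f i (p i) \<noteq> 0"
proof -
  have "\<exists>p\<in>{p. p permutes {0..<n}}. signof p * (\<Prod>i=0..<n. f i (p i)) \<noteq> 0"
    using assms unfolding dt_leibniz by (rule contrapos_np) (intro sum.neutral, simp)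
  then obtain p where p: "p permutes {0..<n}" "signof p * (\<Prod>i=0..<n. f i (p i)) \<noteq> 0"
    by blast
  have "f i (p i) \<noteq> 0" if "i < n" for i
  proof
    assume "f i (p i) = 0"
    then have "(\<Prod>i=0..<n. f i (p i)) = 0" using that
      by (subst prod.remove[of _ i]) auto
    then show False using p(2) by simp
  qed
  then show ?thesis using p(1) that by (simp add: atLeast0LessThan)
qed

lemma dt_equal_rows:
  assumes "i < n" "i' < n" "i \<noteq> i'" "\<And>j. j < n \<Longrightarrow> f i j = f i' j"
  shows "dt n f = 0"
  unfolding dt_def
  by (rule det_identical_rows[of _ n i i']) (use assms in \<open>auto intro!: eq_vecI\<close>)

lemma dt_hom: assumes "comm_ring_hom h" shows "h (dt n f) = dt n (\<lambda>i j. h (f i j))"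
proof -
  interpret comm_ring_hom h by fact
  have "map_mat h (mat n n (\<lambda>(i, j). f i j)) = mat n n (\<lambda>(i, j). h (f i j))"
    by (rule eq_matI) auto
  then show ?thesis unfolding dt_def by (metis hom_det)
qed

definition vand :: "nat \<Rightarrow> (nat \<Rightarrow> 'a::comm_ring_1) \<Rightarrow> 'a" where
  "vand n z = (\<Prod>j<n. \<Prod>i<j. z j - z i)"

text \<open>Repeated synthetic division by \<open>x - z 0\<close>, \<open>x - z 1\<close>, and so
  on. The value of the \<open>t\<close>-th quotient at \<open>z t\<close> is the divided difference
  of \<open>F\<close> at \<open>z 0, ..., z t\<close>, obtained without any division in the
  ring.\<close>

fun newton_quot :: "(nat \<Rightarrow> 'a::comm_ring_1) \<Rightarrow> 'a poly \<Rightarrow> nat \<Rightarrow> 'a poly" where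
  "newton_quot z F 0 = F"
| "newton_quot z F (Suc t) = synthetic_div (newton_quot z F t) (z t)"

lemma newton_interpolation:
  "poly F x = (\<Sum>t<n. poly (newton_quot z F t) (z t) * (\<Prod>s<t. x - z s))
     + (\<Prod>s<n. x - z s) * poly (newton_quot z F n) x"
proof (induction n)
  case (Suc n)
  let ?G = "newton_quot z F n"
  have "poly ?G x = poly ([:- z n, 1:] * synthetic_div ?G (z n) + [:poly ?G (z n):]) x"
    by (simp only: synthetic_div_correct')
  then have "poly ?G x = (x - z n) * poly (synthetic_div ?G (z n)) x + poly ?G (z n)"
    by (simp add: algebra_simps)
  with Suc show ?case by (simp add: ring_distribs mult_ac)
qed simp

text \<open>Expansion in the Newton basis factors the matrix into divided differences times values
  of the basis. The second matrix is upper triangular, because \<open>z j - z j\<close> is a factor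
  as soon as \<open>t > j\<close>, and its diagonal gives the Vandermonde product. The cofactor
  stays in the ring, which is what makes this a divisibility statement.\<close>

lemma dt_poly_eq_vand_mult:
  "dt n (\<lambda>i j. poly (F i) (z j)) = dt n (\<lambda>i t. poly (newton_quot z (F i) t) (z t)) * vand n z"
proof -
  let ?N = "\<lambda>t j. \<Prod>s<t. z j - z s"
  have "poly (F i) (z j) = (\<Sum>t<n. poly (newton_quot z (F i) t) (z t) * ?N t j)" if "j < n" for i j
  proof -
    have "(\<Prod>s<n. z j - z s) = 0" using that by (subst prod.remove[of _ j]) auto
    then show ?thesis using newton_interpolation[of "F i" "z j" z n] by simp
  qed
  then have "dt n (\<lambda>i j. poly (F i) (z j))
      = dt n (\<lambda>i j. \<Sum>t<n. poly (newton_quot z (F i) t) (z t) * ?N t j)"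
    by (intro dt_cong)
  also have "\<dots> = dt n (\<lambda>i t. poly (newton_quot z (F i) t) (z t)) * dt n ?N"
    by (rule dt_mat_mult)
  also have "dt n ?N = vand n z"
  proof -
    have "?N i j = 0" if "j < i" for i j using that by (subst prod.remove[of _ j]) auto
    then show ?thesis unfolding vand_def by (subst dt_upper_triangular) auto
  qed
  finally show ?thesis .
qed

lemma degree_newton_quot: "degree (newton_quot z F t) = degree F - t"
  by (induction t) (auto simp: degree_synthetic_div)

lemma newton_quot_eq_0: "degree F < t \<Longrightarrow> newton_quot z F t = 0"
proof (induction t)
  case (Suc t)
  then have "degree (newton_quot z F t) = 0" by (simp add: degree_newton_quot)
  then show ?case by (simp add: synthetic_div_eq_0_iff)
qed simp

lemma lead_coeff_synthetic_div:
  fixes F :: "'a::comm_ring_1 poly"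
  assumes "degree F > 0" shows "lead_coeff (synthetic_div F c) = lead_coeff F"
proof -
  obtain n where n: "degree F = Suc n" using assms by (cases "degree F") auto
  have "coeff ([:- c, 1:] * synthetic_div F c + [:poly F c:]) (Suc n) = coeff F (Suc n)"
    by (simp only: synthetic_div_correct')
  moreover have "coeff (synthetic_div F c) (Suc n) = 0"
    by (rule coeff_eq_0) (simp add: degree_synthetic_div n)
  ultimately show ?thesis using n by (simp add: degree_synthetic_div)
qed

lemma newton_quot_monic:
  "lead_coeff F = 1 \<Longrightarrow> t \<le> degree F \<Longrightarrow> lead_coeff (newton_quot z F t) = 1"
proof (induction t)
  case (Suc t)
  then show ?case
    by (simp only: newton_quot.simps, subst lead_coeff_synthetic_div)
       (simp_all add: degree_newton_quot)
qed simp

text \<open>For a monic polynomial of degree \<open>i\<close> the \<open>i\<close>-th divided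
  difference is 1 and all later ones vanish, so the cofactor of the Vandermonde product is a
  unitriangular determinant.\<close>

lemma dt_monic_eq_vand:
  assumes "\<And>i. degree (F i) = i" "\<And>i. lead_coeff (F i) = 1"
  shows "dt n (\<lambda>i j. poly (F i) (z j)) = vand n z"
proof -
  let ?Q = "\<lambda>i t. poly (newton_quot z (F i) t) (z t)"
  have "?Q i i = 1" for i
  proof -
    have "lead_coeff (newton_quot z (F i) i) = 1"
      by (rule newton_quot_monic) (use assms in auto)
    moreover have d: "degree (newton_quot z (F i) i) = 0"
      using assms by (simp add: degree_newton_quot)
    moreover obtain c where "newton_quot z (F i) i = [:c:]" using d by (rule degree_eq_zeroE)
    ultimately show ?thesis by simp
  qed
  moreover have "?Q i j = 0" if "i < j" for i j
    using that newton_quot_eq_0[of "F i" j z] assms by simp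
  ultimately have "dt n ?Q = 1" by (subst dt_lower_triangular) auto
  then show ?thesis using dt_poly_eq_vand_mult[of n F z] by simp
qed

lemma vandermonde: "dt n (\<lambda>i j. z j ^ i) = vand n z"
  using dt_monic_eq_vand[of "\<lambda>i. monom 1 i" n z] by (simp add: degree_monom_eq poly_monom)

text \<open>Multilinearity in the columns selects one node \<open>x b (k b)\<close> per column, and
  each selection leaves a pure Vandermonde determinant. Both the generating determinant and the
  Wronskian are expanded through this formula.\<close>

lemma dt_sum_powers:
  assumes "\<And>b. b < n \<Longrightarrow> finite (S b)"
  shows "dt n (\<lambda>a b. \<Sum>k\<in>S b. w b k * x b k ^ a)
     = (\<Sum>k\<in>PiE {..<n} S. (\<Prod>b<n. w b (k b)) * vand n (\<lambda>b. x b (k b)))"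
proof -
  have "dt n (\<lambda>a b. \<Sum>k\<in>S b. w b k * x b k ^ a)
      = (\<Sum>k\<in>PiE {..<n} S. dt n (\<lambda>i j. w j (k j) * x j (k j) ^ i))"
    using dt_sum_cols[of n S "\<lambda>b k a. w b k * x b k ^ a"] assms by simp
  also have "\<dots> = (\<Sum>k\<in>PiE {..<n} S. (\<Prod>b<n. w b (k b)) * vand n (\<lambda>b. x b (k b)))"
  proof (intro sum.cong refl)
    fix k
    show "dt n (\<lambda>i j. w j (k j) * x j (k j) ^ i) = (\<Prod>b<n. w b (k b)) * vand n (\<lambda>b. x b (k b))"
      unfolding vandermonde[symmetric] by (rule dt_mult_cols[of n "\<lambda>j. w j (k j)"])
  qed
  finally show ?thesis .
qed

subsection \<open>A divisibility theorem for determinants of factorial type\<close>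

text \<open>Abstracts polynomials with coefficients in the integers localised at \<open>l\<close>:
  naturals prime to \<open>l\<close> are invertible inside \<open>R\<close>, while the ambient
  domain only has to have characteristic zero.\<close>

locale local_subring =
  fixes R :: "'a::{idom,ring_char_0} set" and l :: nat
  assumes prime_l: "prime l"
    and R_1: "1 \<in> R"
    and R_diff: "x \<in> R \<Longrightarrow> y \<in> R \<Longrightarrow> x - y \<in> R"
    and R_mult: "x \<in> R \<Longrightarrow> y \<in> R \<Longrightarrow> x * y \<in> R"
    and R_inverse: "\<not> l dvd k \<Longrightarrow> \<exists>c\<in>R. of_nat k * c = 1"
begin

lemma R_0: "0 \<in> R" using R_diff[OF R_1 R_1] by simp

lemma R_uminus: "x \<in> R \<Longrightarrow> - x \<in> R" using R_diff[OF R_0] by simp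

lemma R_add: "x \<in> R \<Longrightarrow> y \<in> R \<Longrightarrow> x + y \<in> R"
  using R_diff[of x "- y"] R_uminus[of y] by simp

lemma R_sum: "(\<And>i. i \<in> A \<Longrightarrow> f i \<in> R) \<Longrightarrow> sum f A \<in> R"
  by (induction A rule: infinite_finite_induct) (auto intro: R_0 R_add)

lemma R_prod: "(\<And>i. i \<in> A \<Longrightarrow> f i \<in> R) \<Longrightarrow> prod f A \<in> R"
  by (induction A rule: infinite_finite_induct) (auto intro: R_1 R_mult)

lemma R_power: "x \<in> R \<Longrightarrow> x ^ n \<in> R"
  by (induction n) (auto intro: R_1 R_mult)

lemma R_of_nat: "of_nat n \<in> R"
  by (induction n) (auto intro: R_0 R_1 R_add)

lemma R_of_int: "of_int n \<in> R"
  by (cases n rule: int_cases2) (auto intro: R_of_nat R_uminus)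

lemma R_dt:
  assumes "\<And>i j. i < n \<Longrightarrow> j < n \<Longrightarrow> f i j \<in> R"
  shows "dt n f \<in> R"
proof -
  have "p i < n" if "p permutes {0..<n}" "i < n" for p i
    using that permutes_in_image[of p "{0..<n}" i] by simp
  then show ?thesis unfolding dt_leibniz by (auto intro!: R_sum R_mult R_prod R_of_int assms)
qed

lemma R_inverse_int:
  assumes "\<not> int l dvd k" shows "\<exists>c\<in>R. of_int k * c = 1"
proof -
  have "\<not> l dvd nat \<bar>k\<bar>" using assms by (simp add: nat_dvd_iff flip: int_dvd_int_iff)
  then obtain c where c: "c \<in> R" "of_nat (nat \<bar>k\<bar>) * c = 1" using R_inverse by blast
  show ?thesis
  proof (cases "k \<ge> 0")
    case True
    then show ?thesis using c by (intro bexI[of _ c]) (simp_all add: of_nat_nat)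
  next
    case False
    then show ?thesis using c by (intro bexI[of _ "- c"]) (simp_all add: of_nat_nat R_uminus)
  qed
qed

section \<open>Power series with integral logarithmic derivative\<close>

definition R_fps :: "'a fps set" where "R_fps = {f. \<forall>n. fps_nth f n \<in> R}"

lemma R_fps_mult: "f \<in> R_fps \<Longrightarrow> g \<in> R_fps \<Longrightarrow> f * g \<in> R_fps"
  by (auto simp: R_fps_def fps_mult_nth intro!: R_sum R_mult)

lemma R_fps_diff: "f \<in> R_fps \<Longrightarrow> g \<in> R_fps \<Longrightarrow> f - g \<in> R_fps"
  by (auto simp: R_fps_def intro!: R_diff)

lemma R_fps_1: "1 \<in> R_fps"
  by (auto simp: R_fps_def R_0 R_1)

lemma R_fps_0: "0 \<in> R_fps"
  by (auto simp: R_fps_def R_0)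

lemma R_fps_add: "f \<in> R_fps \<Longrightarrow> g \<in> R_fps \<Longrightarrow> f + g \<in> R_fps"
  by (auto simp: R_fps_def intro!: R_add)

lemma R_fps_sum: "(\<And>i. i \<in> A \<Longrightarrow> f i \<in> R_fps) \<Longrightarrow> sum f A \<in> R_fps"
  by (induction A rule: infinite_finite_induct) (auto intro: R_fps_0 R_fps_add)

lemma R_fps_const: "c \<in> R \<Longrightarrow> fps_const c \<in> R_fps"
  by (auto simp: R_fps_def R_0)

lemma R_fps_X: "fps_X \<in> R_fps"
  by (auto simp: R_fps_def fps_X_nth R_0 R_1)

lemma R_fps_power: "f \<in> R_fps \<Longrightarrow> f ^ n \<in> R_fps"
  by (induction n) (auto intro: R_fps_1 R_fps_mult)

text \<open>\<open>P\<close> plays the role of \<open>H' / H\<close>. It is integral although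
  \<open>H\<close> need not be. The equation is demanded only below order \<open>B\<close>, since
  finitely many factors clear finitely many coefficients of \<open>P\<close> and no exponent in the
  determinant exceeds \<open>B\<close>.\<close>

definition log_integral :: "nat \<Rightarrow> 'a fps \<Rightarrow> 'a fps \<Rightarrow> bool" where
  "log_integral B P H \<longleftrightarrow> P \<in> R_fps \<and> fps_nth H 0 = 1 \<and>
     (\<forall>n<B. fps_nth (fps_deriv H) n = fps_nth (P * H) n)"

lemma log_integralD:
  "log_integral B P H \<Longrightarrow> n < B \<Longrightarrow> fps_nth (fps_deriv H) n = fps_nth (P * H) n"
  unfolding log_integral_def by blast

definition geo :: "'a \<Rightarrow> nat \<Rightarrow> 'a fps" where
  "geo a k = Abs_fps (\<lambda>n. if k dvd n then a ^ (n div k) else 0)"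

lemma geo_mult:
  assumes "k > 0"
  shows "(1 - fps_const a * fps_X ^ k) * geo a k = 1"
proof (rule fps_ext)
  fix n
  have "fps_nth (fps_X ^ k * geo a k) n = (if n < k then 0 else fps_nth (geo a k) (n - k))"
    by (rule fps_X_power_mult_nth)
  then have e: "fps_nth ((1 - fps_const a * fps_X ^ k) * geo a k) n
     = fps_nth (geo a k) n - (if n < k then 0 else a * fps_nth (geo a k) (n - k))"
    by (simp add: left_diff_distrib mult.assoc)
  show "fps_nth ((1 - fps_const a * fps_X ^ k) * geo a k) n = fps_nth 1 n"
  proof (cases "n < k")
    case True
    then show ?thesis unfolding e using assms by (auto simp: geo_def dest: dvd_imp_le)
  next
    case False
    then have "n \<noteq> 0" using assms by auto
    moreover have "k dvd n \<longleftrightarrow> k dvd (n - k)" using False by (simp add: dvd_minus_self)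
    moreover have "n div k = Suc ((n - k) div k)" using False assms by (simp add: le_div_geq)
    ultimately show ?thesis unfolding e using False by (simp add: geo_def)
  qed
qed

lemma geo_integral: "a \<in> R \<Longrightarrow> geo a k \<in> R_fps"
  by (auto simp: geo_def R_fps_def R_0 R_power)

text \<open>The factor \<open>1 - a t^k\<close> has logarithmic derivative
  \<open>- k a t^(k-1) / (1 - a t^k)\<close>, which starts at order \<open>k - 1\<close>. Taking
  \<open>k a\<close> equal to the coefficient of \<open>P\<close> at that order removes it and
  leaves all lower ones untouched, so coefficients can be cleared in increasing order.\<close>

lemma kill_coefficient:
  assumes H: "log_integral B P H" and k: "k > 0" and a: "a \<in> R" "of_nat k * a = fps_nth P (k - 1)"
  defines "H' \<equiv> H * (1 - fps_const a * fps_X ^ k)"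
    and "P' \<equiv> P - fps_const (of_nat k * a) * fps_X ^ (k - 1) * geo a k"
  shows "H = geo a k * H'" "log_integral B P' H'" "fps_nth P' (k - 1) = 0"
    "\<And>i. i < k - 1 \<Longrightarrow> fps_nth P' i = fps_nth P i"
proof -
  let ?M = "1 - fps_const a * fps_X ^ k"
  have g: "?M * geo a k = 1" by (rule geo_mult[OF k])
  then show "H = geo a k * H'" unfolding H'_def by (metis mult.assoc mult.commute mult.right_neutral)
  have dM: "fps_deriv ?M = - (fps_const (of_nat k * a) * fps_X ^ (k - 1))"
    by (simp add: fps_deriv_power mult_ac fps_of_nat[symmetric] flip: fps_const_mult)
  have P': "P' * H' = P * H * ?M - fps_const (of_nat k * a) * fps_X ^ (k - 1) * H"
  proof -
    have "P' * H' = P * H * ?M - fps_const (of_nat k * a) * fps_X ^ (k - 1) * H * (?M * geo a k)"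
      unfolding P'_def H'_def by (simp add: algebra_simps)
    then show ?thesis unfolding g by simp
  qed
  have dH': "fps_deriv H' = fps_deriv H * ?M - fps_const (of_nat k * a) * fps_X ^ (k - 1) * H"
    unfolding H'_def fps_deriv_mult dM by (simp add: algebra_simps)
  have "fps_nth (fps_deriv H * ?M) n = fps_nth (P * H * ?M) n" if "n < B" for n
    unfolding fps_mult_nth[of _ ?M] using H that
    by (intro sum.cong refl) (auto simp: log_integral_def)
  then have "fps_nth (fps_deriv H') n = fps_nth (P' * H') n" if "n < B" for n
    unfolding dH' P' using that by (simp only: fps_sub_nth)
  moreover have "P' \<in> R_fps" unfolding P'_def using H a(1)
    by (intro R_fps_diff R_fps_mult R_fps_const R_fps_power R_fps_X geo_integral R_mult R_of_nat)
       (auto simp: log_integral_def)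
  moreover have "fps_nth H' 0 = 1" using H k by (simp add: H'_def log_integral_def)
  ultimately show "log_integral B P' H'" by (simp add: log_integral_def)
  have "fps_nth (fps_const (of_nat k * a) * fps_X ^ (k - 1) * geo a k) i
     = (if i < k - 1 then 0 else of_nat k * a * fps_nth (geo a k) (i - (k - 1)))" for i
    by (simp add: mult.assoc fps_X_power_mult_nth)
  then have n: "fps_nth P' i = fps_nth P i - (if i < k - 1 then 0 else of_nat k * a * fps_nth (geo a k) (i - (k - 1)))" for i
    by (simp only: P'_def fps_sub_nth)
  show "fps_nth P' (k - 1) = 0" unfolding n using a by (simp add: geo_def)
  show "fps_nth P' i = fps_nth P i" if "i < k - 1" for i unfolding n using that by simp
qed

lemma split_off_integral_factor:
  assumes "log_integral B P H"
  shows "\<exists>G H2 P2. G \<in> R_fps \<and> H = G * H2 \<and> log_integral B P2 H2 \<and>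
     (\<forall>i<C. \<not> l dvd Suc i \<longrightarrow> fps_nth P2 i = 0)"
proof (induction C)
  case 0
  show ?case by (rule exI[of _ 1], rule exI[of _ H], rule exI[of _ P]) (simp add: assms R_fps_1)
next
  case (Suc C)
  then obtain G H2 P2 where IH: "G \<in> R_fps" "H = G * H2" "log_integral B P2 H2"
    "\<And>i. i < C \<Longrightarrow> \<not> l dvd Suc i \<Longrightarrow> fps_nth P2 i = 0" by blast
  show ?case
  proof (cases "l dvd Suc C")
    case True
    then show ?thesis using IH less_Suc_eq by metis
  next
    case False
    then obtain c where c: "c \<in> R" "of_nat (Suc C) * c = 1" using R_inverse by blast
    \<comment> \<open>The inverse \<open>c\<close> of \<open>Suc C\<close> exists in
      \<open>R\<close> because \<open>l\<close> does not divide \<open>Suc C\<close>; for the other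
      indices this division would leave \<open>R\<close>, so those coefficients are kept.\<close>
    define a where "a = c * fps_nth P2 C"
    have a: "a \<in> R" using c IH(3) by (auto simp: a_def log_integral_def R_fps_def intro!: R_mult)
    have a2: "of_nat (Suc C) * a = fps_nth P2 (Suc C - 1)"
      using c(2) by (metis a_def diff_Suc_1 mult.assoc mult.left_neutral)
    note k = kill_coefficient[OF IH(3) zero_less_Suc a a2]
    obtain H3 P3 where 3: "H2 = geo a (Suc C) * H3" "log_integral B P3 H3" "fps_nth P3 C = 0"
      "\<And>i. i < C \<Longrightarrow> fps_nth P3 i = fps_nth P2 i" using k by (metis diff_Suc_1)
    have "H = (G * geo a (Suc C)) * H3" using 3(1) IH(2) by (simp only: mult.assoc)
    moreover have "G * geo a (Suc C) \<in> R_fps" by (intro R_fps_mult IH(1) geo_integral[OF a])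
    moreover have "\<forall>i<Suc C. \<not> l dvd Suc i \<longrightarrow> fps_nth P3 i = 0"
      using 3(3,4) IH(4) by (auto simp: less_Suc_eq)
    ultimately show ?thesis using 3(2) by blast
  qed
qed

text \<open>By \<open>H' = P H\<close>, the product \<open>n H_n\<close> is a sum of terms
  \<open>P_i H_(n-1-i)\<close>. If \<open>l\<close> does not divide \<open>n\<close>, it fails to
  divide \<open>i + 1\<close> or \<open>n - 1 - i\<close>; the first makes \<open>P_i\<close>
  vanish, the second \<open>H_(n-1-i)\<close> by induction.\<close>

lemma support_multiples:
  assumes H: "log_integral B P H" and P: "\<And>i. i < B \<Longrightarrow> \<not> l dvd Suc i \<Longrightarrow> fps_nth P i = 0"
    and "n \<le> B" "\<not> l dvd n"
  shows "fps_nth H n = 0"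
  using assms(3,4)
proof (induction n rule: less_induct)
  case (less n)
  then obtain k where k: "n = Suc k" by (cases n) auto
  have "of_nat (Suc k) * fps_nth H (Suc k) = (\<Sum>i=0..k. fps_nth P i * fps_nth H (k - i))"
    using H less.prems k by (simp add: log_integral_def fps_mult_nth)
  also have "\<dots> = 0"
  proof (rule sum.neutral, rule ballI)
    fix i assume i: "i \<in> {0..k}"
    show "fps_nth P i * fps_nth H (k - i) = 0"
    proof (cases "l dvd Suc i")
      case True
      have "n = Suc i + (k - i)" using i k by simp
      then have "\<not> l dvd (k - i)" using True less.prems(2) by (metis dvd_add)
      then have "fps_nth H (k - i) = 0" using less k i by (intro less.IH) auto
      then show ?thesis by simp
    next
      case False
      then show ?thesis using P[of i] i k less.prems by simp
    qed
  qed
  finally show ?case using k by (metis mult_eq_0_iff of_nat_eq_0_iff nat.distinct(1))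
qed

text \<open>Write \<open>H(t) = K(t^l)\<close>. The chain rule gives
  \<open>l K'(s) = Q(s) K(s)\<close>, where \<open>Q\<close> collects the coefficients of
  \<open>P\<close> at the exponents \<open>l (i + 1) - 1\<close>. Replacing \<open>s\<close> by
  \<open>l s\<close> absorbs the factor \<open>l\<close>: the series \<open>K(l s)\<close> has
  logarithmic derivative \<open>Q(l s)\<close>, which is integral again.\<close>

lemma rescaled_log_integral:
  assumes H: "log_integral B P H" and P: "\<And>i. i < B \<Longrightarrow> \<not> l dvd Suc i \<Longrightarrow> fps_nth P i = 0"
  shows "log_integral (B div l) (Abs_fps (\<lambda>i. of_nat l ^ i * fps_nth P (l * Suc i - 1)))
      (Abs_fps (\<lambda>k. of_nat l ^ k * fps_nth H (l * k)))" (is "log_integral _ ?P ?H")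
proof -
  have l: "l > 0" using prime_l prime_gt_0_nat by blast
  have "fps_nth (fps_deriv ?H) n = fps_nth (?P * ?H) n" if n: "n < B div l" for n
  proof -
    let ?N = "l * Suc n"
    have N: "?N \<le> B" using n l by (metis Suc_leI div_times_less_eq_dividend le_trans mult.commute mult_le_mono2)
    have N0: "?N > 0" using l by simp
    have "of_nat ?N * fps_nth H ?N = fps_nth (fps_deriv H) (?N - 1)" using N0 by simp
    also have "\<dots> = (\<Sum>i=0..?N - 1. fps_nth P i * fps_nth H (?N - 1 - i))"
    proof -
      have "?N - 1 < B" using N N0 by linarith
      from log_integralD[OF H this] show ?thesis by (simp only: fps_mult_nth)
    qed
    also have "\<dots> = (\<Sum>i\<in>(\<lambda>s. l * Suc s - 1) ` {0..n}. fps_nth P i * fps_nth H (?N - 1 - i))"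
    proof (rule sum.mono_neutral_right)
      show "(\<lambda>s. l * Suc s - 1) ` {0..n} \<subseteq> {0..?N - 1}"
        by (auto intro!: diff_le_mono)
      show "\<forall>i\<in>{0..?N - 1} - (\<lambda>s. l * Suc s - 1) ` {0..n}. fps_nth P i * fps_nth H (?N - 1 - i) = 0"
      proof
        fix i assume i: "i \<in> {0..?N - 1} - (\<lambda>s. l * Suc s - 1) ` {0..n}"
        have "\<not> l dvd Suc i"
        proof
          assume "l dvd Suc i"
          then obtain t where t: "Suc i = l * t" by blast
          then obtain s where s: "t = Suc s" by (cases t) auto
          have "l * t \<le> l * Suc n" using i t N0 by auto
          then have "s \<le> n" using s l by simp
          moreover have "i = l * Suc s - 1" using t s by simp
          ultimately show False using i by auto
        qed
        then show "fps_nth P i * fps_nth H (?N - 1 - i) = 0" using P[of i] i N N0 by auto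
      qed
    qed simp
    also have "\<dots> = (\<Sum>s=0..n. fps_nth P (l * Suc s - 1) * fps_nth H (?N - 1 - (l * Suc s - 1)))"
    proof (rule sum.reindex_cong[OF _ refl refl])
      show "inj_on (\<lambda>s. l * Suc s - 1) {0..n}"
      proof (rule inj_onI)
        fix x y assume "l * Suc x - 1 = l * Suc y - 1"
        then have "l * Suc x = l * Suc y" using l by (metis Suc_diff_1 nat_0_less_mult_iff zero_less_Suc)
        then show "x = y" using l by simp
      qed
    qed
    also have "\<dots> = (\<Sum>s=0..n. fps_nth P (l * Suc s - 1) * fps_nth H (l * (n - s)))"
    proof (intro sum.cong refl)
      fix s assume "s \<in> {0..n}"
      then have "l * (n - s) + l * Suc s = l * Suc n" "l * Suc s > 0"
        using l by (auto simp flip: distrib_left)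
      then have "?N - 1 - (l * Suc s - 1) = l * (n - s)" by linarith
      then show "fps_nth P (l * Suc s - 1) * fps_nth H (?N - 1 - (l * Suc s - 1)) =
        fps_nth P (l * Suc s - 1) * fps_nth H (l * (n - s))"
        by (simp only:)
    qed
    finally have e: "of_nat ?N * fps_nth H ?N = (\<Sum>s=0..n. fps_nth P (l * Suc s - 1) * fps_nth H (l * (n - s)))" .
    have "fps_nth (fps_deriv ?H) n = of_nat l ^ n * (of_nat ?N * fps_nth H ?N)"
      by (simp add: algebra_simps)
    also have "\<dots> = (\<Sum>s=0..n. (of_nat l ^ s * fps_nth P (l * Suc s - 1)) * (of_nat l ^ (n - s) * fps_nth H (l * (n - s))))"
      unfolding e sum_distrib_left
    proof (intro sum.cong refl)
      fix s assume "s \<in> {0..n}"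
      then have "(of_nat l :: 'a) ^ n = of_nat l ^ s * of_nat l ^ (n - s)" by (simp flip: power_add)
      then show "of_nat l ^ n * (fps_nth P (l * Suc s - 1) * fps_nth H (l * (n - s))) =
         (of_nat l ^ s * fps_nth P (l * Suc s - 1)) * (of_nat l ^ (n - s) * fps_nth H (l * (n - s)))"
        by (simp only: mult_ac)
    qed
    finally show ?thesis by (simp add: fps_mult_nth)
  qed
  moreover have "?P \<in> R_fps" using H
    by (auto simp: R_fps_def log_integral_def intro!: R_mult R_power R_of_nat)
  moreover have "fps_nth ?H 0 = 1" using H by (simp add: log_integral_def)
  ultimately show ?thesis by (simp add: log_integral_def)
qed


end

section \<open>Pairs of columns with equal class label\<close>

definition same_diff :: "nat \<Rightarrow> (nat \<Rightarrow> 'c) \<Rightarrow> (nat \<Rightarrow> nat) \<Rightarrow> 'a::comm_ring_1" where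
  "same_diff N c m = (\<Prod>b<N. \<Prod>a<b. if c a = c b then of_int (int (m b) - int (m a)) else 1)"

text \<open>Ordered pairs, twice the number of unordered ones: in this form the count is visibly
  invariant under permuting the indices.\<close>

definition same_pairs :: "nat \<Rightarrow> (nat \<Rightarrow> 'c) \<Rightarrow> (nat \<times> nat) set" where
  "same_pairs N c = {(a, b). a < N \<and> b < N \<and> a \<noteq> b \<and> c a = c b}"

lemma finite_same_pairs: "finite (same_pairs N c)"
  by (rule finite_subset[of _ "{..<N} \<times> {..<N}"]) (auto simp: same_pairs_def)

lemma card_same_pairs_oriented:
  assumes "\<And>a b. (a, b) \<in> same_pairs N c \<Longrightarrow> Q a b \<longleftrightarrow> \<not> Q b a"
  shows "card (same_pairs N c) = 2 * card {(a, b) \<in> same_pairs N c. Q a b}"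
proof -
  let ?A = "{(a, b) \<in> same_pairs N c. Q a b}"
  have u: "same_pairs N c = ?A \<union> prod.swap ` ?A"
  proof (intro equalityI subsetI)
    fix x assume x: "x \<in> same_pairs N c"
    obtain a b where ab: "x = (a, b)" by (cases x)
    have "(b, a) \<in> same_pairs N c" using x ab by (auto simp: same_pairs_def)
    moreover have "Q a b \<or> Q b a" using assms x ab by blast
    ultimately show "x \<in> ?A \<union> prod.swap ` ?A" using x ab by force
  qed (auto simp: same_pairs_def)
  have d: "?A \<inter> prod.swap ` ?A = {}" 
  proof (rule equals0I)
    fix x assume "x \<in> ?A \<inter> prod.swap ` ?A"
    then obtain a b where "(a, b) \<in> same_pairs N c" "Q a b" "Q b a" by force
    then show False using assms by blast
  qed
  have f: "finite ?A" by (rule finite_subset[OF _ finite_same_pairs[of N c]]) auto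
  have "card (same_pairs N c) = card ?A + card (prod.swap ` ?A)"
    by (subst u, rule card_Un_disjoint) (use f d in auto)
  also have "card (prod.swap ` ?A) = card ?A" by (rule card_image) simp
  finally show ?thesis by simp
qed

lemma card_same_pairs_permutes:
  assumes p: "p permutes {..<N}" and "\<And>i. i < N \<Longrightarrow> c (p i) = d i"
  shows "card (same_pairs N c) = card (same_pairs N d)"
proof -
  have "bij_betw (map_prod p p) (same_pairs N d) (same_pairs N c)"
    unfolding bij_betw_def
  proof
    show "inj_on (map_prod p p) (same_pairs N d)"
      by (rule inj_on_subset[OF prod.inj_map[OF permutes_inj[OF p] permutes_inj[OF p]]]) simp
    show "map_prod p p ` same_pairs N d = same_pairs N c"
    proof (intro equalityI subsetI)
      fix x assume "x \<in> map_prod p p ` same_pairs N d"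
      then obtain a b where ab: "a < N" "b < N" "a \<noteq> b" "d a = d b" "x = (p a, p b)"
        by (auto simp: same_pairs_def)
      have "p a < N" "p b < N" using ab permutes_in_image[OF p] by auto
      moreover have "p a \<noteq> p b" using ab permutes_inj[OF p] by (simp add: inj_eq)
      ultimately show "x \<in> same_pairs N c" using ab assms(2) by (simp add: same_pairs_def)
    next
      fix x assume x: "x \<in> same_pairs N c"
      obtain a b where ab: "x = (a, b)" by (cases x)
      have lt: "a < N" "b < N" "a \<noteq> b" "c a = c b" using x ab by (auto simp: same_pairs_def)
      obtain a' b' where ab': "a = p a'" "b = p b'" using permutes_surj[OF p] by (meson surjD)
      have "a' < N" "b' < N" using lt ab' permutes_in_image[OF p] by auto
      then have "(a', b') \<in> same_pairs N d" using lt ab' assms(2) by (auto simp: same_pairs_def)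
      then show "x \<in> map_prod p p ` same_pairs N d" using ab ab' by force
    qed
  qed
  then show ?thesis using bij_betw_same_card by metis
qed

text \<open>In a class of size \<open>t\<close> the values of \<open>j\<close> are distinct
  naturals, so they sum to at least \<open>0 + ... + (t - 1)\<close>. The count assigns to each
  \<open>b\<close> the members of its class with smaller value, of which there are at most
  \<open>j b\<close>.\<close>

lemma card_same_pairs_le:
  assumes inj: "\<And>i i'. i < N \<Longrightarrow> i' < N \<Longrightarrow> i \<noteq> i' \<Longrightarrow> d i = d i' \<Longrightarrow> j i \<noteq> j i'"
  shows "card (same_pairs N d) \<le> 2 * (\<Sum>i<N. j i :: nat)"
proof -
  let ?A = "{(a, b) \<in> same_pairs N d. j a < j b}"
  let ?S = "\<lambda>b. {a. a < N \<and> d a = d b \<and> j a < j b}"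
  have "card (same_pairs N d) = 2 * card ?A"
    by (rule card_same_pairs_oriented) (use inj in \<open>force simp: same_pairs_def\<close>)
  also have "card ?A = card (SIGMA b:{..<N}. ?S b)"
    by (rule bij_betw_same_card[of prod.swap])
      (auto simp: bij_betw_def same_pairs_def image_iff)
  also have "\<dots> = (\<Sum>b<N. card (?S b))" by (rule card_SigmaI) auto
  also have "\<dots> \<le> (\<Sum>b<N. j b)"
  proof (rule sum_mono)
    fix b assume b: "b \<in> {..<N}"
    have "card (?S b) = card (j ` ?S b)"
      by (rule card_image[symmetric]) (use inj in \<open>auto intro!: inj_onI, metis\<close>)
    also have "\<dots> \<le> card {..<j b}" by (rule card_mono) auto
    finally show "card (?S b) \<le> j b" by simp
  qed
  finally show ?thesis by simp
qed

lemma prod_same_pairs_const: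
  "(\<Prod>b<N. \<Prod>a<b. if c a = c b then x else (1::'a::comm_monoid_mult)) = x ^ (card (same_pairs N c) div 2)"
proof -
  have "(\<Prod>b<N. \<Prod>a<b. if c a = c b then x else 1) = (\<Prod>b<N. x ^ card {a. a < b \<and> c a = c b})"
  proof (intro prod.cong refl)
    fix b
    have "(\<Prod>a<b. if c a = c b then x else 1) = (\<Prod>a\<in>{a\<in>{..<b}. c a = c b}. x)"
      by (rule prod.inter_filter[symmetric]) simp
    also have "\<dots> = x ^ card {a. a < b \<and> c a = c b}" by (simp add: conj_commute)
    finally show "(\<Prod>a<b. if c a = c b then x else 1) = x ^ card {a. a < b \<and> c a = c b}" .
  qed
  also have "\<dots> = x ^ (\<Sum>b<N. card {a. a < b \<and> c a = c b})" by (simp add: power_sum)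
  also have "(\<Sum>b<N. card {a. a < b \<and> c a = c b}) = card (SIGMA b:{..<N}. {a. a < b \<and> c a = c b})"
    by (rule card_SigmaI[symmetric]) auto
  also have "\<dots> = card {(a, b) \<in> same_pairs N c. a < b}"
    by (rule bij_betw_same_card[of prod.swap])
      (auto simp: bij_betw_def same_pairs_def image_iff)
  also have "\<dots> = card (same_pairs N c) div 2"
    by (subst card_same_pairs_oriented[of N c "(<)"]) (auto simp: same_pairs_def)
  finally show ?thesis .
qed

text \<open>The multiples of \<open>l\<close> among \<open>1, ..., n\<close> contribute
  \<open>l ^ (n div l) * fact (n div l)\<close>; all other factors are prime to
  \<open>l\<close>.\<close>

lemma fact_prime_decomposition:
  assumes "prime (l::nat)"
  shows "\<exists>v. \<not> l dvd v \<and> fact n = l ^ (n div l) * fact (n div l) * v"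
proof (induction n)
  case 0
  show ?case by (rule exI[of _ 1]) (use assms in \<open>auto dest: prime_gt_1_nat\<close>)
next
  case (Suc n)
  then obtain v where v: "\<not> l dvd v" "fact n = l ^ (n div l) * fact (n div l) * v" by blast
  show ?case
  proof (cases "l dvd Suc n")
    case True
    then have q: "Suc n div l = Suc (n div l)" by (simp add: div_Suc dvd_eq_mod_eq_0)
    have q2: "Suc n = l * Suc (n div l)" using True unfolding q[symmetric] by simp
    have "fact (Suc n) = l * Suc (n div l) * (l ^ (n div l) * fact (n div l) * v)"
      using v(2) q2 by (metis fact_Suc of_nat_id)
    then have "fact (Suc n) = l ^ (Suc n div l) * fact (Suc n div l) * v"
      unfolding q by (simp add: algebra_simps)
    then show ?thesis using v(1) by blast
  next
    case False
    then have q: "Suc n div l = n div l" by (auto simp: div_Suc dvd_eq_mod_eq_0)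
    have "\<not> l dvd v * Suc n" using v(1) False assms by (simp add: prime_dvd_mult_iff del: mult_Suc_right)
    moreover have "fact (Suc n) = l ^ (Suc n div l) * fact (Suc n div l) * (v * Suc n)"
      unfolding q using v(2) by (simp add: algebra_simps)
    ultimately show ?thesis by blast
  qed
qed

section \<open>Refinement of classes modulo a prime and the descent\<close>

context local_subring begin

lemma R_inverse_prod:
  assumes "\<And>i. i \<in> A \<Longrightarrow> \<exists>c\<in>R. f i * c = 1"
  shows "\<exists>c\<in>R. prod f A * c = 1"
  using assms
proof (induction A rule: infinite_finite_induct)
  case (insert x A)
  obtain c' where c': "c' \<in> R" "f x * c' = 1" using insert.prems[of x] by auto
  obtain c where c: "c \<in> R" "prod f A * c = 1" using insert.IH insert.prems by auto
  have "prod f (insert x A) * (c * c') = (prod f A * c) * (f x * c')"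
    using insert.hyps by (simp add: mult_ac)
  then show ?case unfolding c(2) c'(2) using c(1) c'(1) by (intro bexI[of _ "c * c'"]) (simp_all add: R_mult)
qed (auto intro: R_1)

text \<open>A pair congruent modulo \<open>l\<close> contributes \<open>l\<close> times the
  difference of the quotients, an incongruent pair a unit of \<open>R\<close>; the units are
  collected in \<open>W\<close>. Prepending the residue to the label makes the congruent pairs of a
  class exactly the pairs with equal refined label.\<close>

lemma same_diff_refine:
  defines "c' \<equiv> (\<lambda>c m b. (m b mod l) # c b)"
  shows "\<exists>W W'. W' \<in> R \<and> W * W' = 1 \<and>
    (same_diff N c m :: 'a) = of_nat l ^ (card (same_pairs N (c' c m)) div 2)
       * same_diff N (c' c m) (\<lambda>b. m b div l) * W"
proof -
  let ?W = "\<Prod>b<N. \<Prod>a<b. if c a = c b \<and> m a mod l \<noteq> m b mod l then of_int (int (m b) - int (m a)) else (1::'a)"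
  have "\<exists>W'\<in>R. ?W * W' = 1"
  proof (intro R_inverse_prod)
    fix a b
    show "\<exists>W'\<in>R. (if c a = c b \<and> m a mod l \<noteq> m b mod l then of_int (int (m b) - int (m a)) else 1) * W' = 1"
    proof (cases "c a = c b \<and> m a mod l \<noteq> m b mod l")
      case True
      then have "\<not> int l dvd (int (m b) - int (m a))"
        by (metis mod_eq_dvd_iff of_nat_eq_iff zmod_int)
      from R_inverse_int[OF this] show ?thesis using True by (simp only: if_True simp_thms)
    next
      case False
      then show ?thesis using R_1 by (intro bexI[of _ 1]) auto
    qed
  qed
  then obtain W' where W': "W' \<in> R" "?W * W' = 1" by blast
  have "(same_diff N c m :: 'a) = (\<Prod>b<N. \<Prod>a<b. (if c' c m a = c' c m b then of_nat l else 1) *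
     (if c' c m a = c' c m b then of_int (int (m b div l) - int (m a div l)) else 1) *
     (if c a = c b \<and> m a mod l \<noteq> m b mod l then of_int (int (m b) - int (m a)) else 1))"
    unfolding same_diff_def
  proof (intro prod.cong refl)
    fix a b
    have "int (m b) - int (m a) = int l * (int (m b div l) - int (m a div l))" if "m a mod l = m b mod l"
    proof -
      have "int (m b) = int l * int (m b div l) + int (m b mod l)" "int (m a) = int l * int (m a div l) + int (m a mod l)"
        by (metis mult_div_mod_eq of_nat_add of_nat_mult)+
      then show ?thesis using that by (simp add: algebra_simps)
    qed
    then have "(of_int (int (m b) - int (m a)) :: 'a) = of_nat l * of_int (int (m b div l) - int (m a div l))" if "m a mod l = m b mod l"
      using that by (metis of_int_mult of_int_of_nat_eq)
    then show "(if c a = c b then of_int (int (m b) - int (m a)) else (1::'a)) = (if c' c m a = c' c m b then of_nat l else 1) *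
     (if c' c m a = c' c m b then of_int (int (m b div l) - int (m a div l)) else 1) *
     (if c a = c b \<and> m a mod l \<noteq> m b mod l then of_int (int (m b) - int (m a)) else 1)"
      by (auto simp: c'_def)
  qed
  also have "\<dots> = of_nat l ^ (card (same_pairs N (c' c m)) div 2)
       * same_diff N (c' c m) (\<lambda>b. m b div l) * ?W"
    unfolding prod.distrib prod_same_pairs_const same_diff_def ..
  finally show ?thesis using W' by blast
qed

text \<open>Column \<open>b\<close> has exponent \<open>m b\<close> and label \<open>c b\<close>,
  row \<open>i\<close> has shift \<open>j i\<close> and label \<open>d i\<close>; where the labels
  agree the entry is \<open>m! [t^(m - j)] H\<close>. The row data are unconstrained because
  expanding rows produces arbitrary shifts, repetitions included.\<close>

definition fact_entry :: "(nat \<Rightarrow> nat list) \<Rightarrow> (nat \<Rightarrow> nat) \<Rightarrow> (nat list \<Rightarrow> 'a fps) \<Rightarrow>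
    (nat \<Rightarrow> nat list) \<Rightarrow> (nat \<Rightarrow> nat) \<Rightarrow> nat \<Rightarrow> nat \<Rightarrow> 'a" where
  "fact_entry c m H d j i b = (if c b = d i \<and> j i \<le> m b
     then fact (m b) * fps_nth (H (c b)) (m b - j i) else 0)"

text \<open>A factor \<open>G\<close> of the series acts on rows only: its coefficients become
  weights of rows with increased shift. An integral factor can therefore be removed by expanding the
  rows.\<close>

lemma fact_entry_expand:
  assumes "m b \<le> B" "\<And>\<kappa>. H \<kappa> = G \<kappa> * H2 \<kappa>"
  shows "fact_entry c m H d j i b = (\<Sum>t\<le>B. fps_nth (G (d i)) t * fact_entry c m H2 d (\<lambda>i. j i + t) i b)"
proof (cases "c b = d i \<and> j i \<le> m b")
  case True
  have "fact_entry c m H d j i b = (\<Sum>t=0..m b - j i. fps_nth (G (d i)) t * (fact (m b) * fps_nth (H2 (d i)) (m b - j i - t)))"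
    using True assms(2) by (simp add: fact_entry_def fps_mult_nth sum_distrib_left mult_ac)
  also have "\<dots> = (\<Sum>t=0..m b - j i. fps_nth (G (d i)) t * fact_entry c m H2 d (\<lambda>i. j i + t) i b)"
    using True by (intro sum.cong refl) (auto simp: fact_entry_def)
  also have "\<dots> = (\<Sum>t\<le>B. fps_nth (G (d i)) t * fact_entry c m H2 d (\<lambda>i. j i + t) i b)"
    using assms(1) by (intro sum.mono_neutral_left) (auto simp: fact_entry_def)
  finally show ?thesis .
next
  case False
  then show ?thesis by (auto simp: fact_entry_def)
qed

text \<open>For a series supported on multiples of \<open>l\<close>, an entry survives only if
  \<open>m b\<close> and \<open>j i\<close> are congruent, which the refined labels encode. The
  power \<open>l ^ (m b div l)\<close> contained in \<open>m!\<close> splits into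
  \<open>l ^ (j i div l)\<close>, a row factor, and a remainder that the rescaled series absorbs.
  The old label is recovered by \<open>tl\<close>.\<close>

lemma fact_entry_refine:
  assumes sup: "\<And>n \<kappa>. n \<le> B \<Longrightarrow> \<not> l dvd n \<Longrightarrow> fps_nth (H \<kappa>) n = 0" and m: "m b \<le> B"
    and v: "fact (m b) = l ^ (m b div l) * fact (m b div l) * v"
  shows "fact_entry c m H d j i b = of_nat v * (of_nat l ^ (j i div l) *
     fact_entry (\<lambda>b. (m b mod l) # c b) (\<lambda>b. m b div l) (\<lambda>\<kappa>. Abs_fps (\<lambda>k. of_nat l ^ k * fps_nth (H (tl \<kappa>)) (l * k)))
        (\<lambda>i. (j i mod l) # d i) (\<lambda>i. j i div l) i b)"
proof -
  have l: "l > 0" using prime_l prime_gt_0_nat by blast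
  show ?thesis
  proof (cases "c b = d i \<and> j i \<le> m b \<and> m b mod l = j i mod l")
    case True
    have le: "j i div l \<le> m b div l" using True by (simp add: div_le_mono)
    have e: "m b - j i = l * (m b div l - j i div l)"
    proof -
      have "m b = l * (m b div l) + m b mod l" "j i = l * (j i div l) + j i mod l" by simp_all
      then show ?thesis using True by (metis add_diff_cancel_right diff_mult_distrib2)
    qed
    have "(fact (m b) :: 'a) = of_nat (fact (m b))" by simp
    also have "\<dots> = of_nat v * (of_nat l ^ (m b div l) * fact (m b div l))" unfolding v by simp
    also have "(of_nat l :: 'a) ^ (m b div l) = of_nat l ^ (j i div l) * of_nat l ^ (m b div l - j i div l)"
      using le by (simp flip: power_add)
    finally show ?thesis using True le e by (simp add: fact_entry_def mult_ac)
  next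
    case False
    have "fact_entry c m H d j i b = 0"
    proof (cases "c b = d i \<and> j i \<le> m b")
      case True
      then have "\<not> l dvd (m b - j i)" using False mod_eq_dvd_iff_nat by blast
      then show ?thesis using sup[of "m b - j i"] m by (auto simp: fact_entry_def)
    qed (auto simp: fact_entry_def)
    moreover have "\<not> (m b mod l = j i mod l \<and> c b = d i \<and> j i div l \<le> m b div l)"
    proof
      assume h: "m b mod l = j i mod l \<and> c b = d i \<and> j i div l \<le> m b div l"
      have "m b = l * (m b div l) + m b mod l" "j i = l * (j i div l) + j i mod l" by simp_all
      then have "j i \<le> m b" using h by (metis add_le_mono1 mult_le_mono2)
      then show False using h False by blast
    qed
    ultimately show ?thesis by (auto simp: fact_entry_def)
  qed
qed

text \<open>The descent: splitting off an integral factor leaves a series in \<open>z\<^sup>l\<close>, so the determinant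
  decouples along the residues modulo \<open>l\<close>, which are recorded as a refined class label.\<close>

theorem same_diff_dvd_fact_det:
  assumes "\<And>\<kappa>. log_integral B (P \<kappa>) (H \<kappa>)" "\<And>b. b < N \<Longrightarrow> m b \<le> B"
    and "\<And>a b. a < N \<Longrightarrow> b < N \<Longrightarrow> a \<noteq> b \<Longrightarrow> c a = c b \<Longrightarrow> m a \<noteq> m b"
  shows "\<exists>e\<in>R. dt N (fact_entry c m H d j) = same_diff N c m * e"
  using assms
proof (induction B arbitrary: P H m c d j rule: less_induct)
  case (less B)
  have l: "l > 1" using prime_l prime_gt_1_nat by blast
  show ?case
  proof (cases "B = 0")
    case True
    then have m0: "m b = 0" if "b < N" for b using less.prems(2) that by simp
    \<comment> \<open>All exponents vanish here, so no two columns share a label and every factor of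
      the divisor is 1.\<close>
    then have "(same_diff N c m :: 'a) = 1" unfolding same_diff_def
      using less.prems(3) by (intro prod.neutral ballI) (auto, metis less_trans less_irrefl)
    moreover have "dt N (fact_entry c m H d j) \<in> R"
      by (rule R_dt) (use m0 less.prems(1) in \<open>auto simp: fact_entry_def log_integral_def R_0 R_1\<close>)
    ultimately show ?thesis by auto
  next
    case False
    have "\<forall>\<kappa>. \<exists>G H2 P2. G \<in> R_fps \<and> H \<kappa> = G * H2 \<and> log_integral B P2 H2 \<and>
     (\<forall>i<B. \<not> l dvd Suc i \<longrightarrow> fps_nth P2 i = 0)"
      using split_off_integral_factor[OF less.prems(1)] by blast
    then obtain G H2 P2 where G: "\<And>\<kappa>. G \<kappa> \<in> R_fps" and HG: "\<And>\<kappa>. H \<kappa> = G \<kappa> * H2 \<kappa>"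
      and L2: "\<And>\<kappa>. log_integral B (P2 \<kappa>) (H2 \<kappa>)"
      and P2: "\<And>\<kappa> i. i < B \<Longrightarrow> \<not> l dvd Suc i \<Longrightarrow> fps_nth (P2 \<kappa>) i = 0" by metis
    have sup: "fps_nth (H2 \<kappa>) n = 0" if "n \<le> B" "\<not> l dvd n" for n \<kappa>
      using support_multiples[OF L2 P2 that] .
    \<comment> \<open>Needed for every choice of shifts, because reinstating \<open>G\<close>
      produces a sum over shifted rows.\<close>
    have key: "\<exists>e\<in>R. dt N (fact_entry c m H2 d j') = same_diff N c m * e" for j'
    proof -
      let ?c = "\<lambda>b. (m b mod l) # c b" and ?m = "\<lambda>b. m b div l"
      let ?d = "\<lambda>i. (j' i mod l) # d i" and ?j = "\<lambda>i. j' i div l"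
      let ?H = "\<lambda>\<kappa>. Abs_fps (\<lambda>k. of_nat l ^ k * fps_nth (H2 (tl \<kappa>)) (l * k))"
      let ?D = "dt N (fact_entry ?c ?m ?H ?d ?j)"
      have "\<forall>b. \<exists>v. fact (m b) = l ^ (m b div l) * fact (m b div l) * v"
        using fact_prime_decomposition[OF prime_l] by blast
      then obtain v where v: "\<And>b. fact (m b) = l ^ (m b div l) * fact (m b div l) * v b" by metis
      have "dt N (fact_entry c m H2 d j') =
          dt N (\<lambda>i b. of_nat (v b) * (of_nat l ^ (j' i div l) * fact_entry ?c ?m ?H ?d ?j i b))"
        by (rule dt_cong, rule fact_entry_refine[where B = B]) (use sup less.prems(2) v in auto)
      also have "\<dots> = (\<Prod>b<N. of_nat (v b)) * dt N (\<lambda>i b. of_nat l ^ (j' i div l) * fact_entry ?c ?m ?H ?d ?j i b)"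
        by (rule dt_mult_cols)
      also have "dt N (\<lambda>i b. of_nat l ^ (j' i div l) * fact_entry ?c ?m ?H ?d ?j i b) = (\<Prod>i<N. of_nat l ^ (j' i div l)) * ?D"
        by (rule dt_mult_rows)
      also have "(\<Prod>i<N. of_nat l ^ (j' i div l)) = (of_nat l :: 'a) ^ (\<Sum>i<N. ?j i)"
        by (simp add: power_sum)
      finally have E: "dt N (fact_entry c m H2 d j') = (\<Prod>b<N. of_nat (v b)) * (of_nat l ^ (\<Sum>i<N. ?j i) * ?D)" .
      show ?thesis
      proof (cases "?D = 0")
        case True
        then show ?thesis unfolding E using R_0 by (intro bexI[of _ 0]) auto
      next
        case nz: False
        have "\<exists>e\<in>R. ?D = same_diff N ?c ?m * e"
        proof (rule less.IH)
          show "B div l < B" using False l by simp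
          show "log_integral (B div l) (Abs_fps (\<lambda>i. of_nat l ^ i * fps_nth (P2 (tl \<kappa>)) (l * Suc i - 1))) (?H \<kappa>)" for \<kappa>
            by (rule rescaled_log_integral[OF L2 P2])
          show "m b div l \<le> B div l" if "b < N" for b using less.prems(2)[OF that] by (rule div_le_mono)
          show "m a div l \<noteq> m b div l" if "a < N" "b < N" "a \<noteq> b" "m a mod l # c a = m b mod l # c b" for a b
            using less.prems(3)[OF that(1-3)] that(4) by (metis div_mult_mod_eq list.inject)
        qed
        then obtain e where e: "e \<in> R" "?D = same_diff N ?c ?m * e" by blast
        obtain W W' where W: "W' \<in> R" "W * W' = 1" and
          sd: "(same_diff N c m :: 'a) = of_nat l ^ (card (same_pairs N ?c) div 2) * same_diff N ?c ?m * W"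
          using same_diff_refine[of N c m] by blast
        \<comment> \<open>The powers of \<open>l\<close> in the divisor are paid for by the row
          factors. A nonzero Leibniz term matches row labels with column labels bijectively, and two
          rows agreeing in label and in \<open>?j\<close> would be identical.\<close>
        have "card (same_pairs N ?c) \<le> 2 * (\<Sum>i<N. ?j i)"
        proof -
          obtain p where p: "p permutes {..<N}" "\<And>i. i < N \<Longrightarrow> fact_entry ?c ?m ?H ?d ?j i (p i) \<noteq> 0"
            using nz by (rule dt_nonzero_permutation) blast
          have "?c (p i) = ?d i" if "i < N" for i using p(2)[OF that] by (auto simp: fact_entry_def split: if_splits)
          then have "card (same_pairs N ?c) = card (same_pairs N ?d)"
            by (intro card_same_pairs_permutes[OF p(1)])
          also have "\<dots> \<le> 2 * (\<Sum>i<N. ?j i)"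
          proof (rule card_same_pairs_le, rule notI)
            fix i i' assume ii: "i < N" "i' < N" "i \<noteq> i'" "?d i = ?d i'" "?j i = ?j i'"
            have "?D = 0" by (rule dt_equal_rows[OF ii(1-3)]) (use ii in \<open>simp add: fact_entry_def\<close>)
            then show False using nz by simp
          qed
          finally show ?thesis .
        qed
        then have le: "card (same_pairs N ?c) div 2 \<le> (\<Sum>i<N. ?j i)" by simp
        let ?k = "card (same_pairs N ?c) div 2"
        let ?e = "(\<Prod>b<N. of_nat (v b)) * of_nat l ^ ((\<Sum>i<N. ?j i) - ?k) * W' * e"
        have "of_nat l ^ (\<Sum>i<N. ?j i) = (of_nat l :: 'a) ^ ?k * of_nat l ^ ((\<Sum>i<N. ?j i) - ?k)"
          using le by (simp flip: power_add)
        then have "dt N (fact_entry c m H2 d j') = (\<Prod>b<N. of_nat (v b)) *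
            (of_nat l ^ ?k * of_nat l ^ ((\<Sum>i<N. ?j i) - ?k) * (same_diff N ?c ?m * e)) * (W * W')"
          unfolding E e(2) W(2) by simp
        also have "\<dots> = same_diff N c m * ?e" unfolding sd by (simp only: mult_ac)
        finally show ?thesis using e(1) W(1)
          by (intro bexI[of _ ?e]) (auto intro!: R_mult R_prod R_power R_of_nat)
      qed
    qed
    obtain e where e: "\<And>j'. e j' \<in> R" "\<And>j'. dt N (fact_entry c m H2 d j') = same_diff N c m * e j'"
      using key by metis
    have "dt N (fact_entry c m H d j) =
       dt N (\<lambda>i b. \<Sum>t\<le>B. fps_nth (G (d i)) t * fact_entry c m H2 d (\<lambda>i. j i + t) i b)"
      by (rule dt_cong, rule fact_entry_expand) (use less.prems(2) HG in auto)
    also have "\<dots> = (\<Sum>t\<in>{..<N} \<rightarrow>\<^sub>E {..B}. dt N (\<lambda>i b. fps_nth (G (d i)) (t i) * fact_entry c m H2 d (\<lambda>i'. j i' + t i) i b))"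
      by (rule dt_sum_rows) simp
    also have "\<dots> = (\<Sum>t\<in>{..<N} \<rightarrow>\<^sub>E {..B}. (\<Prod>i<N. fps_nth (G (d i)) (t i)) * (same_diff N c m * e (\<lambda>i. j i + t i)))"
    proof (intro sum.cong refl)
      fix t
      have "dt N (\<lambda>i b. fps_nth (G (d i)) (t i) * fact_entry c m H2 d (\<lambda>i'. j i' + t i) i b)
        = (\<Prod>i<N. fps_nth (G (d i)) (t i)) * dt N (\<lambda>i b. fact_entry c m H2 d (\<lambda>i'. j i' + t i) i b)"
        by (rule dt_mult_rows)
      also have "dt N (\<lambda>i b. fact_entry c m H2 d (\<lambda>i'. j i' + t i) i b) = dt N (fact_entry c m H2 d (\<lambda>i. j i + t i))"
        by (rule dt_cong) (simp add: fact_entry_def)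
      finally show "dt N (\<lambda>i b. fps_nth (G (d i)) (t i) * fact_entry c m H2 d (\<lambda>i'. j i' + t i) i b)
        = (\<Prod>i<N. fps_nth (G (d i)) (t i)) * (same_diff N c m * e (\<lambda>i. j i + t i))" unfolding e(2) .
    qed
    also have "\<dots> = same_diff N c m * (\<Sum>t\<in>{..<N} \<rightarrow>\<^sub>E {..B}. (\<Prod>i<N. fps_nth (G (d i)) (t i)) * e (\<lambda>i. j i + t i))"
      by (simp add: sum_distrib_left mult_ac)
    finally show ?thesis using G e(1)
      by (intro bexI) (auto simp: R_fps_def intro!: R_sum R_mult R_prod)
  qed
qed

end

subsection \<open>Laguerre coefficients\<close>

text \<open>The coefficient of \<open>y^(m - k)\<close> in the monic Laguerre polynomial of degree
  \<open>m\<close>. The subtraction inside the Pochhammer symbol is that of the ring; the binomial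
  coefficient takes care of \<open>k > m\<close>.\<close>

definition lcoef :: "'a::comm_ring_1 \<Rightarrow> nat \<Rightarrow> nat \<Rightarrow> 'a" where
  "lcoef \<alpha> m k = (-1) ^ k * of_nat (m choose k) * pochhammer (\<alpha> + of_nat m - of_nat k + 1) k"

lemma lcoef_0 [simp]: "lcoef \<alpha> m 0 = 1" by (simp add: lcoef_def)

lemma lcoef_eq_0: "m < k \<Longrightarrow> lcoef \<alpha> m k = 0" by (simp add: lcoef_def binomial_eq_0)

lemma lcoef_Suc_Suc_shift:
  "lcoef \<alpha> (Suc m) (Suc k) = lcoef (\<alpha> + 1) (Suc m) (Suc k) + of_nat (Suc m) * lcoef (\<alpha> + 1) m k"
proof -
  define x where "x = \<alpha> + of_nat m - of_nat k + 1"
  let ?C = "of_nat (Suc m choose Suc k) :: 'a" and ?q = "pochhammer (x + 1) k"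
  have b: "of_nat (Suc m) * of_nat (m choose k) = of_nat (Suc k) * ?C"
    by (metis Suc_times_binomial_eq of_nat_mult mult.commute)
  have x: "\<alpha> + of_nat (Suc m) - of_nat (Suc k) + 1 = x" "\<alpha> + 1 + of_nat (Suc m) - of_nat (Suc k) + 1 = x + 1"
    "\<alpha> + 1 + of_nat m - of_nat k + 1 = x + 1"
    by (simp_all add: x_def algebra_simps)
  have 1: "lcoef \<alpha> (Suc m) (Suc k) = (-1) ^ Suc k * ?C * (x * ?q)"
    unfolding lcoef_def x pochhammer_rec ..
  have 2: "lcoef (\<alpha> + 1) (Suc m) (Suc k) = (-1) ^ Suc k * ?C * (?q * (x + 1 + of_nat k))"
    unfolding lcoef_def x pochhammer_Suc ..
  have "of_nat (Suc m) * lcoef (\<alpha> + 1) m k = (-1) ^ k * (of_nat (Suc m) * of_nat (m choose k)) * ?q"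
    unfolding lcoef_def x by (simp only: mult_ac)
  then have 3: "of_nat (Suc m) * lcoef (\<alpha> + 1) m k = (-1) ^ k * (of_nat (Suc k) * ?C) * ?q"
    unfolding b .
  show ?thesis unfolding 1 2 3 by (simp add: algebra_simps)
qed

lemma lcoef_Suc_Suc_rec:
  "lcoef \<alpha> (Suc m) (Suc k) = lcoef (\<alpha> + 2) m (Suc k) - (\<alpha> + 1) * lcoef (\<alpha> + 1) m k"
proof -
  define x where "x = \<alpha> + of_nat m - of_nat k + 1"
  let ?C1 = "of_nat (m choose k) :: 'a" and ?C2 = "of_nat (m choose Suc k) :: 'a"
  let ?q = "pochhammer (x + 1) k"
  have x: "\<alpha> + of_nat (Suc m) - of_nat (Suc k) + 1 = x" "\<alpha> + 2 + of_nat m - of_nat (Suc k) + 1 = x + 1"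
    "\<alpha> + 1 + of_nat m - of_nat k + 1 = x + 1"
    by (simp_all add: x_def algebra_simps)
  have "Suc k * (m choose Suc k) = (m - k) * (m choose k)"
    using binomial_absorb_comp[of m k] binomial_absorption[of k m] by simp
  then have "of_nat (Suc k) * ?C2 = of_nat (m - k) * ?C1"
    by (metis of_nat_mult)
  moreover have "of_nat (m - k) * ?C1 = (of_nat m - of_nat k) * ?C1"
    by (cases "k \<le> m") (simp_all add: of_nat_diff binomial_eq_0)
  ultimately have "of_nat (Suc k) * ?C2 = (of_nat m - of_nat k) * ?C1" by (simp only:)
  moreover have "of_nat k * ?C2 = of_nat (Suc k) * ?C2 - ?C2" by (simp add: algebra_simps)
  ultimately have b: "of_nat k * ?C2 = (of_nat m - of_nat k) * ?C1 - ?C2" by (simp only:)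
  have 1: "lcoef \<alpha> (Suc m) (Suc k) = (-1) ^ Suc k * (?C1 + ?C2) * (x * ?q)"
    unfolding lcoef_def x pochhammer_rec binomial_Suc_Suc of_nat_add ..
  have 2: "lcoef (\<alpha> + 2) m (Suc k) = (-1) ^ Suc k * ?C2 * (?q * (x + 1 + of_nat k))"
    unfolding lcoef_def x pochhammer_Suc ..
  have 3: "lcoef (\<alpha> + 1) m k = (-1) ^ k * ?C1 * ?q"
    unfolding lcoef_def x ..
  have "(?C1 + ?C2) * x = ?C2 * (x + 1 + of_nat k) + (\<alpha> + 1) * ?C1"
    using b by (simp add: algebra_simps x_def)
  then have "(-1) ^ Suc k * ((?C1 + ?C2) * x) * ?q
     = (-1) ^ Suc k * (?C2 * (x + 1 + of_nat k) + (\<alpha> + 1) * ?C1) * ?q" by (simp only:)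
  then show ?thesis unfolding 1 2 3 by (simp add: algebra_simps)
qed

text \<open>Coefficient form of the rule that differentiating a monic Laguerre polynomial multiplies
  by the degree, lowers the degree by one and raises the parameter by one.\<close>

lemma lcoef_Suc_top:
  "lcoef \<alpha> (Suc m) k * (of_nat (Suc m) - of_nat k) = of_nat (Suc m) * lcoef (\<alpha> + 1) m k"
proof -
  have "(Suc m - k) * (Suc m choose k) = Suc m * (m choose k)"
    using binomial_absorb_comp[of "Suc m" k] by simp
  then have "of_nat (Suc m - k) * of_nat (Suc m choose k) = (of_nat (Suc m) * of_nat (m choose k) :: 'a)"
    by (metis of_nat_mult)
  moreover have "of_nat (Suc m - k) * of_nat (Suc m choose k) = (of_nat (Suc m) - of_nat k) * (of_nat (Suc m choose k) :: 'a)"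
    by (cases "k \<le> Suc m") (simp_all only: of_nat_diff, simp add: binomial_eq_0)
  ultimately have "(of_nat (Suc m) - of_nat k) * (of_nat (Suc m choose k) :: 'a) = of_nat (Suc m) * of_nat (m choose k)"
    by simp
  then have "(-1) ^ k * ((of_nat (Suc m) - of_nat k) * (of_nat (Suc m choose k) :: 'a)) * pochhammer (\<alpha> + of_nat m - of_nat k + 2) k
    = (-1) ^ k * (of_nat (Suc m) * of_nat (m choose k)) * pochhammer (\<alpha> + of_nat m - of_nat k + 2) k" by simp
  then show ?thesis by (simp add: lcoef_def algebra_simps)
qed

text \<open>With \<open>u = 1/y\<close> this is \<open>u\<^sup>m\<close> times the monic Laguerre polynomial at \<open>y\<close>.\<close>

definition lag :: "'a::comm_ring_1 \<Rightarrow> 'a \<Rightarrow> nat \<Rightarrow> 'a" where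
  "lag u \<alpha> m = (\<Sum>k\<le>m. lcoef \<alpha> m k * u ^ k)"

lemma lag_Suc_expand: "lag u \<alpha> (Suc m) = 1 + (\<Sum>k\<le>m. lcoef \<alpha> (Suc m) (Suc k) * u ^ Suc k)"
  unfolding lag_def by (subst sum.atMost_Suc_shift) simp

lemma lag_shift: "lag u \<alpha> (Suc m) = lag u (\<alpha> + 1) (Suc m) + of_nat (Suc m) * u * lag u (\<alpha> + 1) m"
proof -
  have "of_nat (Suc m) * u * lag u (\<alpha> + 1) m = (\<Sum>k\<le>m. of_nat (Suc m) * lcoef (\<alpha> + 1) m k * u ^ Suc k)"
    by (simp add: lag_def sum_distrib_left mult_ac)
  then show ?thesis unfolding lag_Suc_expand lcoef_Suc_Suc_shift[of \<alpha>]
    by (simp only: distrib_right sum.distrib add.assoc)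
qed

lemma lag_rec: "lag u \<alpha> (Suc m) = lag u (\<alpha> + 2) m - (\<alpha> + 1) * u * lag u (\<alpha> + 1) m"
proof -
  have 1: "(\<alpha> + 1) * u * lag u (\<alpha> + 1) m = (\<Sum>k\<le>m. (\<alpha> + 1) * lcoef (\<alpha> + 1) m k * u ^ Suc k)"
    by (simp add: lag_def sum_distrib_left mult_ac)
  have "lag u (\<alpha> + 2) m = (\<Sum>k\<le>Suc m. lcoef (\<alpha> + 2) m k * u ^ k)"
    unfolding lag_def by (simp add: lcoef_eq_0)
  also have "\<dots> = 1 + (\<Sum>k\<le>m. lcoef (\<alpha> + 2) m (Suc k) * u ^ Suc k)"
    by (subst sum.atMost_Suc_shift) simp
  finally have 2: "lag u (\<alpha> + 2) m = 1 + (\<Sum>k\<le>m. lcoef (\<alpha> + 2) m (Suc k) * u ^ Suc k)" .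
  show ?thesis unfolding lag_Suc_expand lcoef_Suc_Suc_rec[of \<alpha>] 1 2
    by (simp only: left_diff_distrib sum_subtractf add_diff_eq)
qed

section \<open>Derivatives and generating functions of Laguerre polynomials\<close>

definition ffall :: "'a::comm_ring_1 \<Rightarrow> nat \<Rightarrow> 'a" where
  "ffall x j = (\<Prod>t<j. x - of_nat t)"

lemma ffall_Suc_left: "ffall x (Suc j) = x * ffall (x - 1) j"
  unfolding ffall_def by (subst prod.lessThan_Suc_shift) (simp add: algebra_simps)

lemma ffall_Suc: "ffall x (Suc j) = ffall x j * (x - of_nat j)"
  by (simp add: ffall_def)

text \<open>This is \<open>u^m y^j\<close> times the \<open>j\<close>-th derivative of the monic
  Laguerre polynomial at \<open>y = 1/u\<close>. Falling factorials, rather than powers of the Euler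
  operator, lead to a single Laguerre polynomial with shifted parameter.\<close>

definition lag_ff :: "'a::comm_ring_1 \<Rightarrow> 'a \<Rightarrow> nat \<Rightarrow> nat \<Rightarrow> 'a" where
  "lag_ff u \<alpha> j m = (\<Sum>k\<le>m. lcoef \<alpha> m k * u ^ k * ffall (of_nat m - of_nat k) j)"

lemma lag_ff_0: "lag_ff u \<alpha> 0 m = lag u \<alpha> m" by (simp add: lag_ff_def lag_def ffall_def)

lemma lag_ff_Suc_0: "lag_ff u \<alpha> (Suc j) 0 = 0" by (simp add: lag_ff_def ffall_Suc_left)

lemma lag_ff_Suc_Suc: "lag_ff u \<alpha> (Suc j) (Suc m) = of_nat (Suc m) * lag_ff u (\<alpha> + 1) j m"
proof -
  have "lag_ff u \<alpha> (Suc j) (Suc m) = (\<Sum>k\<le>Suc m. (lcoef \<alpha> (Suc m) k * (of_nat (Suc m) - of_nat k)) * u ^ k * ffall (of_nat m - of_nat k) j)"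
    unfolding lag_ff_def ffall_Suc_left by (intro sum.cong refl) (simp add: mult_ac add_ac diff_add_eq)
  also have "\<dots> = (\<Sum>k\<le>Suc m. (of_nat (Suc m) * lcoef (\<alpha> + 1) m k) * u ^ k * ffall (of_nat m - of_nat k) j)"
    unfolding lcoef_Suc_top ..
  also have "\<dots> = of_nat (Suc m) * lag_ff u (\<alpha> + 1) j m"
    by (simp add: lag_ff_def lcoef_eq_0 sum_distrib_left mult_ac del: of_nat_Suc)
  finally show ?thesis .
qed

text \<open>The ambient ring contains the rationals, as exponential generating functions require,
  whereas integrality is still measured by \<open>R\<close>.\<close>

locale rat_local_subring = local_subring +
  assumes rat_inverse: "n > 0 \<Longrightarrow> \<exists>c::'a. of_nat n * c = 1"
begin

definition invf :: "nat \<Rightarrow> 'a" where "invf n = (SOME c. fact n * c = 1)"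

lemma fact_invf: "fact n * invf n = 1"
proof -
  have "\<exists>c::'a. of_nat (fact n) * c = 1" by (rule rat_inverse) simp
  then have "\<exists>c::'a. fact n * c = 1" by simp
  then show ?thesis unfolding invf_def by (rule someI_ex)
qed

lemma invf_Suc: "of_nat (Suc n) * invf (Suc n) = invf n"
proof -
  have "of_nat (Suc n) * invf (Suc n) * (fact n * invf n) = (fact (Suc n) * invf (Suc n)) * invf n"
    by (simp only: fact_Suc of_nat_mult mult_ac)
  then show ?thesis unfolding fact_invf by simp
qed

text \<open>Formally \<open>(1 + u t)^(-\<alpha>-1) exp (t / (1 + u t))\<close>. As \<alpha> is a
  ring element, this closed form is replaced by its two consequences, the shift of \<alpha> and the
  differential equation.\<close>

definition lag_fps :: "'a \<Rightarrow> 'a \<Rightarrow> 'a fps" where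
  "lag_fps u \<alpha> = Abs_fps (\<lambda>m. invf m * lag u \<alpha> m)"

lemma lag_fps_shift: "lag_fps u (\<alpha> + 1) = geo (- u) 1 * lag_fps u \<alpha>"
proof -
  have "lag_fps u \<alpha> = (1 - fps_const (- u) * fps_X ^ 1) * lag_fps u (\<alpha> + 1)"
  proof (rule fps_ext)
    fix m
    show "fps_nth (lag_fps u \<alpha>) m = fps_nth ((1 - fps_const (- u) * fps_X ^ 1) * lag_fps u (\<alpha> + 1)) m"
    proof (cases m)
      case 0
      then show ?thesis by (simp add: lag_fps_def lag_def)
    next
      case (Suc n)
      have "fps_nth (lag_fps u \<alpha>) (Suc n) = invf (Suc n) * lag u (\<alpha> + 1) (Suc n) +
          (of_nat (Suc n) * invf (Suc n)) * (u * lag u (\<alpha> + 1) n)"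
        by (simp add: lag_fps_def lag_shift[of u \<alpha>] algebra_simps)
      also have "\<dots> = invf (Suc n) * lag u (\<alpha> + 1) (Suc n) + u * (invf n * lag u (\<alpha> + 1) n)"
        unfolding invf_Suc by (simp only: mult_ac)
      finally show ?thesis unfolding Suc by (simp add: lag_fps_def left_diff_distrib mult.assoc)
    qed
  qed
  then have "geo (- u) 1 * lag_fps u \<alpha> = ((1 - fps_const (- u) * fps_X ^ 1) * geo (- u) 1) * lag_fps u (\<alpha> + 1)"
    by (simp only: mult_ac)
  moreover have "(1 - fps_const (- u) * fps_X ^ 1) * geo (- u) 1 = 1" by (rule geo_mult) simp
  ultimately show ?thesis by (simp only: mult_1_left)
qed

lemma lag_fps_shift_nat: "lag_fps u (\<alpha> + of_nat j) = geo (- u) 1 ^ j * lag_fps u \<alpha>"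
proof (induction j)
  case (Suc j)
  have "lag_fps u (\<alpha> + of_nat (Suc j)) = lag_fps u (\<alpha> + of_nat j + 1)" by (simp add: add_ac)
  then show ?case unfolding lag_fps_shift Suc by (simp add: mult.assoc)
qed simp

text \<open>The logarithmic derivative is
  \<open>1 / (1 + u t)^2 - (\<alpha> + 1) u / (1 + u t)\<close>. The recursion
  \<open>lag_rec\<close> expresses the derivative by the series with parameters
  \<open>\<alpha> + 2\<close> and \<open>\<alpha> + 1\<close>, and the shift rule brings both back
  to \<alpha>.\<close>

lemma lag_fps_log_integral:
  assumes "u \<in> R" "\<alpha> \<in> R"
  shows "log_integral B (geo (- u) 1 ^ 2 - fps_const ((\<alpha> + 1) * u) * geo (- u) 1) (lag_fps u \<alpha>)"
proof -
  have "fps_deriv (lag_fps u \<alpha>) = lag_fps u (\<alpha> + 2) - fps_const ((\<alpha> + 1) * u) * lag_fps u (\<alpha> + 1)"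
  proof (rule fps_ext)
    fix m
    have "fps_nth (fps_deriv (lag_fps u \<alpha>)) m = (of_nat (Suc m) * invf (Suc m)) * lag u \<alpha> (Suc m)"
      by (simp add: lag_fps_def mult_ac)
    then show "fps_nth (fps_deriv (lag_fps u \<alpha>)) m
       = fps_nth (lag_fps u (\<alpha> + 2) - fps_const ((\<alpha> + 1) * u) * lag_fps u (\<alpha> + 1)) m"
      unfolding invf_Suc lag_rec by (simp add: lag_fps_def right_diff_distrib mult_ac)
  qed
  also have "lag_fps u (\<alpha> + 2) = geo (- u) 1 ^ 2 * lag_fps u \<alpha>"
    using lag_fps_shift_nat[of u \<alpha> 2] by simp
  finally have "fps_deriv (lag_fps u \<alpha>) = (geo (- u) 1 ^ 2 - fps_const ((\<alpha> + 1) * u) * geo (- u) 1) * lag_fps u \<alpha>"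
    unfolding lag_fps_shift by (simp add: left_diff_distrib mult.assoc)
  moreover have "geo (- u) 1 ^ 2 - fps_const ((\<alpha> + 1) * u) * geo (- u) 1 \<in> R_fps"
    using assms by (intro R_fps_diff R_fps_mult R_fps_power geo_integral R_fps_const R_mult R_add R_uminus R_1)
  moreover have "fps_nth (lag_fps u \<alpha>) 0 = 1"
    using fact_invf[of 0] by (simp add: lag_fps_def lag_def)
  ultimately show ?thesis unfolding log_integral_def by simp
qed

lemma lag_ff_fps: "lag_ff u \<alpha> j m = fact m * fps_nth (fps_X ^ j * lag_fps u (\<alpha> + of_nat j)) m"
proof (induction j arbitrary: \<alpha> m)
  case 0
  show ?case using fact_invf[of m] by (simp add: lag_ff_0 lag_fps_def flip: mult.assoc)
next
  case (Suc j)
  show ?case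
  proof (cases m)
    case 0
    then show ?thesis by (simp add: lag_ff_Suc_0)
  next
    case (Suc n)
    have "lag_ff u \<alpha> (Suc j) (Suc n) = of_nat (Suc n) * (fact n * fps_nth (fps_X ^ j * lag_fps u (\<alpha> + 1 + of_nat j)) n)"
      unfolding lag_ff_Suc_Suc Suc.IH ..
    also have "\<dots> = fact (Suc n) * fps_nth (fps_X ^ Suc j * lag_fps u (\<alpha> + of_nat (Suc j))) (Suc n)"
      by (simp add: mult.assoc add_ac)
    finally show ?thesis using Suc by simp
  qed
qed

text \<open>The relation \<open>ffall x j * (x + \<gamma>) = ffall x (Suc j) + (j + \<gamma>) *
  ffall x j\<close> gives a Stirling-type recursion for the coefficients that never divides.\<close>

lemma power_ffall_expansion:
  assumes "\<gamma> \<in> R"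
  shows "\<exists>s. (\<forall>j. s j \<in> R) \<and> (\<forall>x. (x + \<gamma>) ^ a = (\<Sum>j\<le>a. s j * ffall x j))"
proof (induction a)
  case 0
  show ?case by (rule exI[of _ "\<lambda>_. 1"]) (simp add: ffall_def R_1)
next
  case (Suc a)
  then obtain s where s: "\<And>j. s j \<in> R" "\<And>x. (x + \<gamma>) ^ a = (\<Sum>j\<le>a. s j * ffall x j)" by blast
  define s' where "s' j = (if j = 0 then 0 else s (j - 1)) + (if j \<le> a then (of_nat j + \<gamma>) * s j else 0)" for j
  have "s' j \<in> R" for j unfolding s'_def using s(1) assms by (auto intro!: R_add R_mult R_of_nat R_0)
  moreover have "(x + \<gamma>) ^ Suc a = (\<Sum>j\<le>Suc a. s' j * ffall x j)" for x
  proof -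
    have "(x + \<gamma>) ^ Suc a = (\<Sum>j\<le>a. s j * (ffall x j * (x + \<gamma>)))"
      using s(2)[of x] by (simp add: sum_distrib_left sum_distrib_right mult_ac)
    also have "\<dots> = (\<Sum>j\<le>a. s j * ffall x (Suc j)) + (\<Sum>j\<le>a. (of_nat j + \<gamma>) * s j * ffall x j)"
      unfolding ffall_Suc by (simp add: algebra_simps flip: sum.distrib)
    also have "(\<Sum>j\<le>a. s j * ffall x (Suc j)) = (\<Sum>j\<le>Suc a. (if j = 0 then 0 else s (j - 1)) * ffall x j)"
      by (subst sum.atMost_Suc_shift) simp
    also have "(\<Sum>j\<le>a. (of_nat j + \<gamma>) * s j * ffall x j) = (\<Sum>j\<le>Suc a. (if j \<le> a then (of_nat j + \<gamma>) * s j else 0) * ffall x j)"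
      by simp
    finally show ?thesis unfolding s'_def by (simp only: distrib_right sum.distrib)
  qed
  ultimately show ?case by blast
qed

text \<open>Within one family a whole row of the determinant is \<open>m! [t^m]\<close> of one
  series: the multiplier \<open>g\<close> depends on the row exponent \<open>a\<close> but not on
  \<open>m\<close>. This is the shape on which the descent operates.\<close>

lemma lag_power_row:
  assumes "u \<in> R" "\<gamma> \<in> R"
  shows "\<exists>g\<in>R_fps. \<forall>m. (\<Sum>k\<le>m. lcoef \<alpha> m k * u ^ k * (of_nat m - of_nat k + \<gamma>) ^ a)
     = fact m * fps_nth (g * lag_fps u \<alpha>) m"
proof -
  obtain s where s: "\<And>j. s j \<in> R" "\<And>x. (x + \<gamma>) ^ a = (\<Sum>j\<le>a. s j * ffall x j)"
    using power_ffall_expansion[OF assms(2)] by blast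
  let ?g = "\<Sum>j\<le>a. fps_const (s j) * (fps_X ^ j * geo (- u) 1 ^ j)"
  have "?g \<in> R_fps" using s(1) assms
    by (intro R_fps_sum R_fps_mult R_fps_power R_fps_const R_fps_X geo_integral R_uminus)
  moreover have "(\<Sum>k\<le>m. lcoef \<alpha> m k * u ^ k * (of_nat m - of_nat k + \<gamma>) ^ a)
     = fact m * fps_nth (?g * lag_fps u \<alpha>) m" for m
  proof -
    have "(\<Sum>k\<le>m. lcoef \<alpha> m k * u ^ k * (of_nat m - of_nat k + \<gamma>) ^ a)
       = (\<Sum>k\<le>m. \<Sum>j\<le>a. s j * (lcoef \<alpha> m k * u ^ k * ffall (of_nat m - of_nat k) j))"
      unfolding s(2) by (simp add: sum_distrib_left mult_ac)
    also have "\<dots> = (\<Sum>j\<le>a. s j * lag_ff u \<alpha> j m)"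
      by (subst sum.swap) (simp add: lag_ff_def sum_distrib_left)
    also have "\<dots> = (\<Sum>j\<le>a. fact m * fps_nth (fps_const (s j) * (fps_X ^ j * geo (- u) 1 ^ j) * lag_fps u \<alpha>) m)"
      unfolding lag_ff_fps lag_fps_shift_nat by (intro sum.cong refl) (simp add: mult_ac)
    finally show ?thesis by (simp add: sum_distrib_left sum_distrib_right fps_sum_nth)
  qed
  ultimately show ?thesis by blast
qed

theorem same_diff_dvd_laguerre_det:
  fixes c :: "nat \<Rightarrow> nat list"
  assumes u: "u \<in> R" and al: "\<And>\<kappa>. al \<kappa> \<in> R" and ga: "\<And>\<kappa>. ga \<kappa> \<in> R"
    and dist: "\<And>a b. a < N \<Longrightarrow> b < N \<Longrightarrow> a \<noteq> b \<Longrightarrow> c a = c b \<Longrightarrow> m a \<noteq> m b"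
  shows "\<exists>e\<in>R. dt N (\<lambda>a b. \<Sum>k\<le>m b. lcoef (al (c b)) (m b) k * u ^ k * (of_nat (m b) - of_nat k + ga (c b)) ^ a)
     = same_diff N c m * e"
proof -
  define B where "B = (\<Sum>b<N. m b)"
  have mB: "m b \<le> B" if "b < N" for b unfolding B_def by (rule member_le_sum) (use that in auto)
  define S where "S = c ` {..<N}"
  let ?H = "\<lambda>\<kappa>. lag_fps u (al \<kappa>)"
  have "\<forall>a \<kappa>. \<exists>g\<in>R_fps. \<forall>m. (\<Sum>k\<le>m. lcoef (al \<kappa>) m k * u ^ k * (of_nat m - of_nat k + ga \<kappa>) ^ a)
     = fact m * fps_nth (g * ?H \<kappa>) m"
    using lag_power_row[OF u ga] by blast
  then obtain g where g: "\<And>a \<kappa>. g a \<kappa> \<in> R_fps"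
    "\<And>a \<kappa> m. (\<Sum>k\<le>m. lcoef (al \<kappa>) m k * u ^ k * (of_nat m - of_nat k + ga \<kappa>) ^ a)
     = fact m * fps_nth (g a \<kappa> * ?H \<kappa>) m" by metis
  \<comment> \<open>A row involves both families, while a row of \<open>fact_entry\<close> carries a
    single label. Summing over pairs of a label and a shift reconciles the two, and row expansion
    then picks one pair per row.\<close>
  have ent: "fact (m b) * fps_nth (g a (c b) * ?H (c b)) (m b)
     = (\<Sum>x\<in>S \<times> {..B}. fps_nth (g a (fst x)) (snd x) * fact_entry c m ?H (\<lambda>_. fst x) (\<lambda>_. snd x) a b)"
    if b: "b < N" for a b
  proof -
    have "fact (m b) * fps_nth (g a (c b) * ?H (c b)) (m b)
       = (\<Sum>i=0..m b. fps_nth (g a (c b)) i * (fact (m b) * fps_nth (?H (c b)) (m b - i)))"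
      by (simp add: fps_mult_nth sum_distrib_left mult_ac)
    also have "\<dots> = (\<Sum>i=0..m b. fps_nth (g a (c b)) i * fact_entry c m ?H (\<lambda>_. c b) (\<lambda>_. i) a b)"
      by (intro sum.cong refl) (simp add: fact_entry_def)
    also have "\<dots> = (\<Sum>i\<le>B. fps_nth (g a (c b)) i * fact_entry c m ?H (\<lambda>_. c b) (\<lambda>_. i) a b)"
      by (rule sum.mono_neutral_left) (use mB[OF b] in \<open>auto simp: fact_entry_def\<close>)
    also have "\<dots> = (\<Sum>\<kappa>\<in>S. if \<kappa> = c b then \<Sum>i\<le>B. fps_nth (g a \<kappa>) i * fact_entry c m ?H (\<lambda>_. \<kappa>) (\<lambda>_. i) a b else 0)"
      by (subst sum.delta) (use b in \<open>auto simp: S_def\<close>)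
    also have "\<dots> = (\<Sum>\<kappa>\<in>S. \<Sum>i\<le>B. fps_nth (g a \<kappa>) i * fact_entry c m ?H (\<lambda>_. \<kappa>) (\<lambda>_. i) a b)"
      by (intro sum.cong refl) (auto simp: fact_entry_def)
    finally show ?thesis by (simp add: sum.cartesian_product case_prod_unfold)
  qed
  have "\<exists>e\<in>R. dt N (fact_entry c m ?H d j) = same_diff N c m * e" for d j
    by (rule same_diff_dvd_fact_det[OF lag_fps_log_integral[OF u al] mB dist])
  then obtain e where e: "\<And>d j. e d j \<in> R" "\<And>d j. dt N (fact_entry c m ?H d j) = same_diff N c m * e d j"
    by metis
  let ?P = "{..<N} \<rightarrow>\<^sub>E (S \<times> {..B})"
  have "dt N (\<lambda>a b. \<Sum>k\<le>m b. lcoef (al (c b)) (m b) k * u ^ k * (of_nat (m b) - of_nat k + ga (c b)) ^ a)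
    = dt N (\<lambda>a b. \<Sum>x\<in>S \<times> {..B}. fps_nth (g a (fst x)) (snd x) * fact_entry c m ?H (\<lambda>_. fst x) (\<lambda>_. snd x) a b)"
    by (rule dt_cong) (simp only: g(2) ent)
  also have "\<dots> = (\<Sum>t\<in>?P. dt N (\<lambda>a b. fps_nth (g a (fst (t a))) (snd (t a)) * fact_entry c m ?H (\<lambda>_. fst (t a)) (\<lambda>_. snd (t a)) a b))"
    by (rule dt_sum_rows) (simp add: S_def)
  also have "\<dots> = (\<Sum>t\<in>?P. (\<Prod>a<N. fps_nth (g a (fst (t a))) (snd (t a))) *
       (same_diff N c m * e (\<lambda>a. fst (t a)) (\<lambda>a. snd (t a))))"
  proof (intro sum.cong refl)
    fix t
    have "dt N (\<lambda>a b. fact_entry c m ?H (\<lambda>_. fst (t a)) (\<lambda>_. snd (t a)) a b)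
      = dt N (fact_entry c m ?H (\<lambda>a. fst (t a)) (\<lambda>a. snd (t a)))"
      by (rule dt_cong) (simp add: fact_entry_def)
    then show "dt N (\<lambda>a b. fps_nth (g a (fst (t a))) (snd (t a)) * fact_entry c m ?H (\<lambda>_. fst (t a)) (\<lambda>_. snd (t a)) a b)
      = (\<Prod>a<N. fps_nth (g a (fst (t a))) (snd (t a))) *
       (same_diff N c m * e (\<lambda>a. fst (t a)) (\<lambda>a. snd (t a)))"
      unfolding e(2)[symmetric] by (simp add: dt_mult_rows)
  qed
  also have "\<dots> = same_diff N c m * (\<Sum>t\<in>?P. (\<Prod>a<N. fps_nth (g a (fst (t a))) (snd (t a))) *
       e (\<lambda>a. fst (t a)) (\<lambda>a. snd (t a)))"
    by (simp add: sum_distrib_left mult_ac)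
  finally show ?thesis using g(1) e(1)
    by (intro bexI) (auto simp: R_fps_def intro!: R_sum R_mult R_prod)
qed

end

subsection \<open>Localization at a prime\<close>

definition localized_int :: "nat \<Rightarrow> rat set" where
  "localized_int l = {x. \<exists>k. \<not> l dvd k \<and> of_nat k * x \<in> \<int>}"

definition localized_poly :: "nat \<Rightarrow> rat poly set" where
  "localized_poly l = {p. \<forall>i. coeff p i \<in> localized_int l}"

text \<open>The inner variable is \<beta>, the outer one is \<open>u\<close>.\<close>

definition localized_poly2 :: "nat \<Rightarrow> rat poly poly set" where
  "localized_poly2 l = {p. \<forall>i. coeff p i \<in> localized_poly l}"

lemma localized_int_of_int:
  assumes "prime l" shows "of_int n \<in> localized_int l"
proof -
  have "\<not> l dvd 1" using assms by (simp add: prime_nat_iff)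
  then show ?thesis unfolding localized_int_def by (auto intro!: exI[of _ 1])
qed

lemma localized_int_diff:
  assumes l: "prime l" and "x \<in> localized_int l" "y \<in> localized_int l"
  shows "x - y \<in> localized_int l"
proof -
  obtain j k where j: "\<not> l dvd j" "of_nat j * x \<in> \<int>" and k: "\<not> l dvd k" "of_nat k * y \<in> \<int>"
    using assms(2,3) by (auto simp: localized_int_def)
  have "of_nat (j * k) * (x - y) = of_nat k * (of_nat j * x) - of_nat j * (of_nat k * y)"
    by (simp add: algebra_simps)
  also have "\<dots> \<in> \<int>" using Ints_mult[OF Ints_of_nat j(2)] Ints_mult[OF Ints_of_nat k(2)] by (rule Ints_diff)
  finally show ?thesis using j(1) k(1) l by (auto simp: localized_int_def prime_dvd_mult_iff intro!: exI[of _ "j * k"])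
qed

lemma localized_int_mult:
  assumes l: "prime l" and "x \<in> localized_int l" "y \<in> localized_int l"
  shows "x * y \<in> localized_int l"
proof -
  obtain j k where j: "\<not> l dvd j" "of_nat j * x \<in> \<int>" and k: "\<not> l dvd k" "of_nat k * y \<in> \<int>"
    using assms(2,3) by (auto simp: localized_int_def)
  have "of_nat (j * k) * (x * y) = (of_nat j * x) * (of_nat k * y)"
    by (simp add: algebra_simps)
  also have "\<dots> \<in> \<int>" using j(2) k(2) by (rule Ints_mult)
  finally show ?thesis using j(1) k(1) l by (auto simp: localized_int_def prime_dvd_mult_iff intro!: exI[of _ "j * k"])
qed

text \<open>A prime divisor of the reduced denominator would contradict membership in the
  localisation at that prime.\<close>

lemma localized_int_all_primes:
  assumes "\<And>l. prime l \<Longrightarrow> x \<in> localized_int l"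
  shows "x \<in> \<int>"
proof (rule ccontr)
  assume x: "x \<notin> \<int>"
  obtain a b where ab: "quotient_of x = (a, b)" by (cases "quotient_of x")
  have b: "b > 0" "coprime a b" "x = of_int a / of_int b"
    using quotient_of_denom_pos[OF ab] quotient_of_coprime[OF ab] quotient_of_div[OF ab] by auto
  have "b \<noteq> 1" using x b(3) by auto
  then have "nat b \<noteq> 1" using b(1) by auto
  then obtain l where l: "prime l" "l dvd nat b" using prime_factor_nat by blast
  obtain k where k: "\<not> l dvd k" "of_nat k * x \<in> \<int>" using assms[OF l(1)] by (auto simp: localized_int_def)
  then obtain n where "of_nat k * x = of_int n" by (auto elim: Ints_cases)
  then have "(of_int (int k * a) :: rat) = of_int (n * b)" using b by (simp add: field_simps)
  then have "int k * a = n * b" by (simp only: of_int_eq_iff)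
  then have "b dvd int k * a" by simp
  then have "b dvd int k" using b(2) by (simp add: coprime_commute coprime_dvd_mult_left_iff)
  then have "nat b dvd k" using b(1) by (simp add: nat_dvd_iff)
  then show False using l(2) k(1) dvd_trans by blast
qed

lemma localized_int_sum:
  assumes l: "prime l" and "\<And>i. i \<in> A \<Longrightarrow> f i \<in> localized_int l"
  shows "sum f A \<in> localized_int l"
  using assms(2)
proof (induction A rule: infinite_finite_induct)
  case (insert x A)
  have "f x - (0 - sum f A) \<in> localized_int l"
    using insert localized_int_of_int[OF l, of 0] by (intro localized_int_diff[OF l]) auto
  then show ?case using insert by simp
qed (use localized_int_of_int[OF l, of 0] in auto)

lemma localized_poly_diff: "prime l \<Longrightarrow> p \<in> localized_poly l \<Longrightarrow> q \<in> localized_poly l \<Longrightarrow> p - q \<in> localized_poly l"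
  by (auto simp: localized_poly_def intro!: localized_int_diff)

lemma localized_poly_mult: "prime l \<Longrightarrow> p \<in> localized_poly l \<Longrightarrow> q \<in> localized_poly l \<Longrightarrow> p * q \<in> localized_poly l"
  by (auto simp: localized_poly_def coeff_mult intro!: localized_int_sum localized_int_mult)

lemma localized_poly_const: "prime l \<Longrightarrow> c \<in> localized_int l \<Longrightarrow> [:c:] \<in> localized_poly l"
  using localized_int_of_int[of l 0] by (auto simp: localized_poly_def coeff_pCons split: nat.splits)

lemma localized_poly_sum:
  assumes l: "prime l" and "\<And>i. i \<in> A \<Longrightarrow> f i \<in> localized_poly l"
  shows "sum f A \<in> localized_poly l"
  using assms by (auto simp: localized_poly_def coeff_sum intro!: localized_int_sum)

lemma localized_poly2_const: "prime l \<Longrightarrow> c \<in> localized_poly l \<Longrightarrow> [:c:] \<in> localized_poly2 l"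
  using localized_poly_const[of l 0] localized_int_of_int[of l 0]
  by (auto simp: localized_poly2_def coeff_pCons split: nat.splits)

lemma rat_local_subring_poly2:
  assumes l: "prime l"
  shows "rat_local_subring (localized_poly2 l) l"
proof
  have c: "[:[:c:]:] \<in> localized_poly2 l" if "c \<in> localized_int l" for c
    by (intro localized_poly2_const localized_poly_const l that)
  have of_nat: "(of_nat n :: rat poly poly) = [:[:of_nat n:]:]" for n
    by (simp add: of_nat_poly)
  show "prime l" by fact
  show "1 \<in> localized_poly2 l"
    using c[OF localized_int_of_int[OF l, of 1]] by (simp add: one_pCons)
  show "p - q \<in> localized_poly2 l" if "p \<in> localized_poly2 l" "q \<in> localized_poly2 l" for p q
    using that by (auto simp: localized_poly2_def intro!: localized_poly_diff l)
  show "p * q \<in> localized_poly2 l" if "p \<in> localized_poly2 l" "q \<in> localized_poly2 l" for p q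
    using that by (auto simp: localized_poly2_def coeff_mult intro!: localized_poly_sum localized_poly_mult l)
  show "\<exists>c\<in>localized_poly2 l. of_nat k * c = 1" if "\<not> l dvd k" for k
  proof -
    have k: "k \<noteq> 0" using that by (metis dvd_0_right)
    then have "(1 / of_nat k :: rat) \<in> localized_int l" using that
      by (auto simp: localized_int_def intro!: exI[of _ k])
    then show ?thesis unfolding of_nat using k
      by (intro bexI[OF _ c]) (auto simp: one_pCons)
  qed
  show "\<exists>c. of_nat n * c = (1 :: rat poly poly)" if "n > 0" for n
    unfolding of_nat using that by (intro exI[of _ "[:[:1 / of_nat n:]:]"]) (simp add: one_pCons)
qed

text \<open>The linear factor has leading coefficient \<open>-1\<close>, so the coefficients of
  \<open>p\<close> are recovered from those of the product from the top downwards without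
  dividing.\<close>

lemma localized_poly_linear_factor:
  assumes l: "prime l" and p: "[:of_int c, - 1:] * p \<in> localized_poly l"
  shows "p \<in> localized_poly l"
proof -
  have "coeff p i \<in> localized_int l" if "Suc (degree p) - i = n" for i n
    using that
  proof (induction n arbitrary: i)
    case 0
    then have "coeff p i = 0" by (intro coeff_eq_0) simp
    then show ?case using localized_int_of_int[OF l, of 0] by simp
  next
    case (Suc n)
    then have "coeff p (Suc i) \<in> localized_int l" by (intro Suc.IH) simp
    then have "of_int c * coeff p (Suc i) \<in> localized_int l"
      by (intro localized_int_mult[OF l] localized_int_of_int[OF l])
    moreover have "coeff ([:of_int c, - 1:] * p) (Suc i) \<in> localized_int l"
      using p unfolding localized_poly_def by blast
    ultimately have "of_int c * coeff p (Suc i) - coeff ([:of_int c, - 1:] * p) (Suc i) \<in> localized_int l"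
      by (intro localized_int_diff[OF l])
    then show ?case by (simp add: algebra_simps)
  qed
  then show ?thesis by (auto simp: localized_poly_def)
qed

lemma localized_poly_prod_factor:
  assumes "\<And>x p. x \<in> A \<Longrightarrow> g x * p \<in> localized_poly l \<Longrightarrow> p \<in> localized_poly l"
    and "prod g A * p \<in> localized_poly l"
  shows "p \<in> localized_poly l"
  using assms
proof (induction A arbitrary: p rule: infinite_finite_induct)
  case (insert x A)
  have "g x * (prod g A * p) \<in> localized_poly l"
    using insert.prems(2) insert.hyps by (simp add: mult.assoc)
  then have "prod g A * p \<in> localized_poly l" using insert.prems(1) by blast
  then show ?case using insert.IH insert.prems(1) by blast
qed auto

subsection \<open>The generating determinant\<close>

lemma hom_pochhammer: assumes "comm_ring_hom h" shows "h (pochhammer x k) = pochhammer (h x) k"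
proof -
  interpret comm_ring_hom h by fact
  show ?thesis by (induction k) (simp_all add: pochhammer_Suc hom_distribs)
qed

lemma hom_lcoef: assumes "comm_ring_hom h" shows "h (lcoef \<alpha> m k) = lcoef (h \<alpha>) m k"
proof -
  interpret comm_ring_hom h by fact
  show ?thesis unfolding lcoef_def by (simp add: hom_distribs hom_pochhammer[OF assms])
qed

lemma hom_vand: assumes "comm_ring_hom h" shows "h (vand n z) = vand n (\<lambda>i. h (z i))"
proof -
  interpret comm_ring_hom h by fact
  show ?thesis unfolding vand_def by (simp add: hom_distribs)
qed

lemma const_poly_hom: "comm_ring_hom (\<lambda>c. [:c:])"
  by unfold_locales (auto simp: one_pCons)

lemma ffall_of_nat: "ffall (of_nat m) k = of_nat (fact k * (m choose k))"
proof (induction k)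
  case (Suc k)
  have "fact (Suc k) * (m choose Suc k) = fact k * ((m - k) * (m choose k))"
    using binomial_absorb_comp[of m k] binomial_absorption[of k m]
    by (metis fact_Suc mult.assoc mult.commute of_nat_id)
  also have "\<dots> = fact k * (m choose k) * (m - k)" by (simp only: mult_ac)
  finally have e: "fact (Suc k) * (m choose Suc k) = fact k * (m choose k) * (m - k)" .
  show ?case unfolding ffall_Suc Suc e of_nat_mult
    by (cases "k \<le> m") (simp_all add: of_nat_diff binomial_eq_0)
qed (simp add: ffall_def)

lemma pochhammer_ffall: "pochhammer (x - of_nat k + 1) k = ffall x k"
proof (induction k arbitrary: x)
  case (Suc k)
  have "pochhammer (x - of_nat (Suc k) + 1) (Suc k) = (x - of_nat k) * pochhammer (x - of_nat k + 1) k"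
    by (simp add: pochhammer_rec algebra_simps)
  then show ?case unfolding Suc ffall_Suc by (simp add: mult.commute)
qed (simp add: ffall_def)

lemma fact_lcoef: "of_nat (fact k) * lcoef \<alpha> m k = (-1) ^ k * (ffall (of_nat m) k * ffall (of_nat m + \<alpha>) k)"
proof -
  have "pochhammer (\<alpha> + of_nat m - of_nat k + 1) k = ffall (of_nat m + \<alpha>) k"
    using pochhammer_ffall[of "of_nat m + \<alpha>" k] by (simp add: add_ac)
  then show ?thesis unfolding lcoef_def ffall_of_nat by (simp add: mult_ac)
qed

text \<open>\<open>zpt\<close> and \<open>apar\<close> give the points \<open>z\<^sub>b\<close> and the Laguerre parameters \<open>\<plusminus>\<beta>\<close>; \<open>gdet\<close> is \<open>D(u)\<close>.\<close>

definition zpt :: "nat \<Rightarrow> 'a::comm_ring_1 \<Rightarrow> (nat \<Rightarrow> nat) \<Rightarrow> nat \<Rightarrow> 'a" where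
  "zpt r \<beta> m b = of_nat (m b) - (if b < r then 0 else \<beta>)"

definition apar :: "nat \<Rightarrow> 'a::comm_ring_1 \<Rightarrow> nat \<Rightarrow> 'a" where
  "apar r \<beta> b = (if b < r then \<beta> else - \<beta>)"

definition gdet :: "nat \<Rightarrow> nat \<Rightarrow> 'a::comm_ring_1 \<Rightarrow> (nat \<Rightarrow> nat) \<Rightarrow> 'a poly" where
  "gdet r N \<beta> m = dt N (\<lambda>a b. \<Sum>k\<le>m b. monom (lcoef (apar r \<beta> b) (m b) k * (zpt r \<beta> m b - of_nat k) ^ a) k)"

text \<open>For the first family \<open>z\<close> and \<open>z + \<beta>\<close> are
  \<open>m\<close> and \<open>m + \<beta>\<close>; for the second they are
  \<open>n - \<beta>\<close> and \<open>n\<close>. The two falling factorials merely exchange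
  places, hence one formula for both.\<close>

lemma fact_lcoef_zpt:
  "of_nat (fact k) * lcoef (apar r \<beta> b) (m b) k
     = (-1) ^ k * (ffall (zpt r \<beta> m b) k * ffall (zpt r \<beta> m b + \<beta>) k)"
  unfolding fact_lcoef by (auto simp: zpt_def apar_def)

lemma prod_monom: "(\<Prod>b\<in>A. monom (f b) (k b)) = monom (\<Prod>b\<in>A. f b) (\<Sum>b\<in>A. k b)"
  by (induction A rule: infinite_finite_induct) (auto simp: mult_monom one_pCons monom_0)

lemma gdet_expand:
  "gdet r N \<beta> m = (\<Sum>k\<in>PiE {..<N} (\<lambda>b. {..m b}).
     monom ((\<Prod>b<N. lcoef (apar r \<beta> b) (m b) (k b)) * vand N (\<lambda>b. zpt r \<beta> m b - of_nat (k b))) (\<Sum>b<N. k b))"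
proof -
  let ?x = "\<lambda>b k. [:zpt r \<beta> m b - of_nat k:]"
  have "?x b k ^ a = [:(zpt r \<beta> m b - of_nat k) ^ a:]" for b k a
    by (simp add: poly_const_pow)
  then have "monom (lcoef (apar r \<beta> b) (m b) k * (zpt r \<beta> m b - of_nat k) ^ a) k
     = monom (lcoef (apar r \<beta> b) (m b) k) k * ?x b k ^ a" for a b k
    by (simp add: smult_monom mult.commute)
  then have "gdet r N \<beta> m = dt N (\<lambda>a b. \<Sum>k\<le>m b. monom (lcoef (apar r \<beta> b) (m b) k) k * ?x b k ^ a)"
    unfolding gdet_def by (simp only:)
  also have "\<dots> = (\<Sum>k\<in>PiE {..<N} (\<lambda>b. {..m b}). (\<Prod>b<N. monom (lcoef (apar r \<beta> b) (m b) (k b)) (k b)) * vand N (\<lambda>b. ?x b (k b)))"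
    by (rule dt_sum_powers) simp
  also have "\<dots> = (\<Sum>k\<in>PiE {..<N} (\<lambda>b. {..m b}).
     monom ((\<Prod>b<N. lcoef (apar r \<beta> b) (m b) (k b)) * vand N (\<lambda>b. zpt r \<beta> m b - of_nat (k b))) (\<Sum>b<N. k b))"
    unfolding prod_monom hom_vand[OF const_poly_hom, symmetric]
    by (intro sum.cong refl) (simp add: smult_monom mult.commute)
  finally show ?thesis .
qed

lemma coeff_gdet:
  "coeff (gdet r N \<beta> m) K = (\<Sum>k\<in>PiE {..<N} (\<lambda>b. {..m b}). if (\<Sum>b<N. k b) = K then
     (\<Prod>b<N. lcoef (apar r \<beta> b) (m b) (k b)) * vand N (\<lambda>b. zpt r \<beta> m b - of_nat (k b)) else 0)"
  unfolding gdet_expand by (simp add: coeff_sum)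

text \<open>Carries identities over the rational polynomials in \<beta> to each complex value of
  \<beta>.\<close>

lemma hom_gdet:
  assumes h: "comm_ring_hom h"
  shows "map_poly h (gdet r N \<beta> m) = gdet r N (h \<beta>) m"
proof (rule poly_eqI)
  fix K
  interpret comm_ring_hom h by fact
  show "coeff (map_poly h (gdet r N \<beta> m)) K = coeff (gdet r N (h \<beta>) m) K"
    unfolding coeff_gdet by (simp add: coeff_map_poly coeff_gdet hom_distribs hom_lcoef[OF h] hom_vand[OF h]
       if_distrib[of h] zpt_def apar_def cong: if_cong)
qed

definition beta_poly :: "rat poly" where "beta_poly = [:0, 1:]"

lemma vand_dvd_gdet: "\<exists>q. gdet r N beta_poly m = [:vand N (zpt r beta_poly m):] * q"
proof -
  let ?\<beta> = "beta_poly"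
  define M where "M = (\<Sum>b<N. m b)"
  have mM: "m b \<le> M" if "b < N" for b unfolding M_def by (rule member_le_sum) (use that in auto)
  \<comment> \<open>The variables, from outside to inside, are the node \<open>z\<close>, then
    \<open>u\<close>, then \<beta>. The bound \<open>M\<close> is the same for all columns, so that
    every column evaluates the same polynomial; the surplus terms vanish with
    \<open>lcoef\<close>.\<close>
  define F :: "nat \<Rightarrow> rat poly poly poly" where
    "F a = (\<Sum>k\<le>M. [:monom [:(-1) ^ k / fact k:] k:] * ((\<Prod>j<k. [:- of_nat j, 1:]) *
        (\<Prod>j<k. [:[:?\<beta>:] - of_nat j, 1:])) * [:- of_nat k, 1:] ^ a)" for a
  have ev: "poly (F a) [:zpt r ?\<beta> m b:]
     = (\<Sum>k\<le>m b. monom (lcoef (apar r ?\<beta> b) (m b) k * (zpt r ?\<beta> m b - of_nat k) ^ a) k)" if b: "b < N" for a b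
  proof -
    let ?z = "zpt r ?\<beta> m b"
    have c: "[:(-1) ^ k / fact k:] * (ffall ?z k * ffall (?z + ?\<beta>) k) = lcoef (apar r ?\<beta> b) (m b) k" for k
    proof -
      have "[:(-1) ^ k / fact k:] * (ffall ?z k * ffall (?z + ?\<beta>) k)
         = [:1 / fact k:] * ((-1) ^ k * (ffall ?z k * ffall (?z + ?\<beta>) k))"
      proof -
        have "[:(-1) ^ k / fact k :: rat:] = [:1 / fact k:] * (-1) ^ k"
          by (cases "even k") (simp_all)
        then show ?thesis by (simp only: mult.assoc)
      qed
      also have "\<dots> = [:1 / fact k:] * of_nat (fact k) * lcoef (apar r ?\<beta> b) (m b) k"
        unfolding fact_lcoef_zpt[symmetric] by (simp only: mult.assoc)
      also have "[:1 / fact k:] * of_nat (fact k) = (1 :: rat poly)"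
        unfolding of_nat_poly by (simp add: one_pCons)
      finally show ?thesis by simp
    qed
    have ff: "(\<Prod>j<k. [:x:] - of_nat j) = [:ffall x k:]" for x :: "rat poly" and k
      unfolding ffall_def by (induction k) (simp_all add: one_pCons of_nat_poly)
    have "poly (F a) [:?z:] = (\<Sum>k\<le>M. monom [:(-1) ^ k / fact k:] k *
       ((\<Prod>j<k. [:?z:] - of_nat j) * (\<Prod>j<k. [:?z + ?\<beta>:] - of_nat j)) * ([:?z:] - of_nat k) ^ a)"
      unfolding F_def by (simp add: poly_sum poly_prod algebra_simps)
    also have "\<dots> = (\<Sum>k\<le>M. monom ([:(-1) ^ k / fact k:] * (ffall ?z k * ffall (?z + ?\<beta>) k) * (?z - of_nat k) ^ a) k)"
      unfolding ff
      by (intro sum.cong refl) (simp add: of_nat_poly poly_const_pow smult_monom mult_ac)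
    also have "\<dots> = (\<Sum>k\<le>M. monom (lcoef (apar r ?\<beta> b) (m b) k * (?z - of_nat k) ^ a) k)"
      unfolding c ..
    also have "\<dots> = (\<Sum>k\<le>m b. monom (lcoef (apar r ?\<beta> b) (m b) k * (?z - of_nat k) ^ a) k)"
      by (rule sum.mono_neutral_right) (use mM[OF b] in \<open>auto simp: lcoef_eq_0\<close>)
    finally show ?thesis .
  qed
  have "gdet r N ?\<beta> m = dt N (\<lambda>a b. poly (F a) [:zpt r ?\<beta> m b:])"
    unfolding gdet_def by (rule dt_cong) (simp only: ev)
  also have "\<dots> = dt N (\<lambda>i t. poly (newton_quot (\<lambda>b. [:zpt r ?\<beta> m b:]) (F i) t) [:zpt r ?\<beta> m t:]) * vand N (\<lambda>b. [:zpt r ?\<beta> m b:])"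
    by (rule dt_poly_eq_vand_mult)
  also have "vand N (\<lambda>b. [:zpt r ?\<beta> m b:]) = [:vand N (zpt r ?\<beta> m):]"
    by (rule hom_vand[OF const_poly_hom, symmetric])
  finally have "gdet r N ?\<beta> m = [:vand N (zpt r ?\<beta> m):] * dt N (\<lambda>i t. poly (newton_quot (\<lambda>b. [:zpt r ?\<beta> m b:]) (F i) t) [:zpt r ?\<beta> m t:])"
    by (simp only: mult.commute)
  then show ?thesis by (rule exI)
qed

theorem gdet_quotient_integral:
  assumes dist: "\<And>a b. a < b \<Longrightarrow> b < N \<Longrightarrow> (a < r \<longleftrightarrow> b < r) \<Longrightarrow> m a \<noteq> m b"
    and q: "gdet r N beta_poly m = [:vand N (zpt r beta_poly m):] * q"
  shows "coeff (coeff q i) j \<in> \<int>"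
proof (rule localized_int_all_primes)
  fix l :: nat assume l: "prime l"
  interpret rat_local_subring "localized_poly2 l" l by (rule rat_local_subring_poly2[OF l])
  let ?\<beta> = "beta_poly"
  \<comment> \<open>The initial labels name the family. They are lists so that the descent can
    prepend residues to them.\<close>
  define c where "c b = (if b < r then [0::nat] else [1])" for b
  define al where "al \<kappa> = (if \<kappa> = [0::nat] then [:?\<beta>:] else - [:?\<beta>:])" for \<kappa>
  define ga where "ga \<kappa> = (if \<kappa> = [0::nat] then 0 else - [:?\<beta>:])" for \<kappa>
  have c_eq: "c a = c b \<longleftrightarrow> (a < r \<longleftrightarrow> b < r)" for a b by (simp add: c_def)
  have loc0: "0 \<in> localized_int l" "1 \<in> localized_int l"
    using localized_int_of_int[OF l, of 0] localized_int_of_int[OF l, of 1] by simp_all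
  have b: "[:?\<beta>:] \<in> localized_poly2 l"
    by (rule localized_poly2_const[OF l]) (use loc0 in \<open>auto simp: localized_poly_def beta_poly_def coeff_pCons split: nat.splits\<close>)
  have u: "[:0, 1:] \<in> localized_poly2 l"
    using localized_poly_const[OF l loc0(1)] localized_poly_const[OF l loc0(2)]
    by (auto simp: localized_poly2_def coeff_pCons one_pCons split: nat.splits)
  have ex: "\<exists>e\<in>localized_poly2 l. dt N (\<lambda>a b. \<Sum>k\<le>m b. lcoef (al (c b)) (m b) k * [:0, 1:] ^ k * (of_nat (m b) - of_nat k + ga (c b)) ^ a)
     = same_diff N c m * e"
  proof (rule same_diff_dvd_laguerre_det[OF u])
    show "al \<kappa> \<in> localized_poly2 l" for \<kappa> using b R_uminus[OF b] by (simp only: al_def simp_thms split: if_split)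
    show "ga \<kappa> \<in> localized_poly2 l" for \<kappa> using R_uminus[OF b] R_0 by (simp only: ga_def simp_thms split: if_split)
    show "m a \<noteq> m b" if "a < N" "b < N" "a \<noteq> b" "c a = c b" for a b
      using dist[of a b] dist[of b a] that c_eq by (metis nat_neq_iff)
  qed
  have "dt N (\<lambda>a b. \<Sum>k\<le>m b. lcoef (al (c b)) (m b) k * [:0, 1:] ^ k * (of_nat (m b) - of_nat k + ga (c b)) ^ a)
     = gdet r N ?\<beta> m"
    unfolding gdet_def
  proof (intro dt_cong sum.cong refl)
    fix a b k
    have "al (c b) = [:apar r ?\<beta> b:]" "of_nat (m b) - of_nat k + ga (c b) = [:zpt r ?\<beta> m b - of_nat k:]"
      by (auto simp: al_def c_def apar_def ga_def zpt_def of_nat_poly)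
    moreover have "[:0, 1:] ^ k = monom (1 :: rat poly) k" by (simp add: monom_altdef)
    ultimately show "lcoef (al (c b)) (m b) k * [:0, 1:] ^ k * (of_nat (m b) - of_nat k + ga (c b)) ^ a
      = monom (lcoef (apar r ?\<beta> b) (m b) k * (zpt r ?\<beta> m b - of_nat k) ^ a) k"
      by (simp add: hom_lcoef[OF const_poly_hom, symmetric] poly_const_pow smult_monom mult.commute)
  qed
  then obtain e where e: "e \<in> localized_poly2 l" "gdet r N ?\<beta> m = same_diff N c m * e"
    using ex by auto
  \<comment> \<open>The differences across the families. Up to the sign of the leading coefficient
    they are monic linear polynomials in \<beta>, which is why they can be cancelled without losing
    integrality.\<close>
  define X where "X = (\<Prod>b<N. \<Prod>a<b. if c a = c b then 1 else zpt r ?\<beta> m b - zpt r ?\<beta> m a)"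
  have "vand N (zpt r ?\<beta> m) = (\<Prod>b<N. \<Prod>a<b. (if c a = c b then of_int (int (m b) - int (m a)) else 1) *
      (if c a = c b then 1 else zpt r ?\<beta> m b - zpt r ?\<beta> m a))"
    unfolding vand_def by (intro prod.cong refl) (auto simp: zpt_def c_eq)
  then have v: "vand N (zpt r ?\<beta> m) = same_diff N c m * X"
    unfolding X_def same_diff_def prod.distrib .
  have sd: "[:same_diff N c m:] = (same_diff N c m :: rat poly poly)"
  proof -
    interpret h: comm_ring_hom "\<lambda>c :: rat poly. [:c:]" by (rule const_poly_hom)
    show ?thesis unfolding same_diff_def h.hom_prod
      by (intro prod.cong refl) (auto simp: of_int_poly of_nat_poly one_pCons)
  qed
  have "int (m a) \<noteq> int (m b)" if "a < b" "b < N" "c a = c b" for a b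
    using dist[OF that(1,2)] that(3) c_eq by simp
  then have "(of_int (int (m b) - int (m a)) :: rat poly poly) \<noteq> 0" if "a < b" "b < N" "c a = c b" for a b
    using that unfolding of_int_eq_0_iff by fastforce
  then have sd0: "(same_diff N c m :: rat poly poly) \<noteq> 0"
    unfolding same_diff_def prod_zero_iff[OF finite_lessThan] by auto
  have "[:vand N (zpt r ?\<beta> m):] = same_diff N c m * [:X:]"
    unfolding v sd[symmetric] by simp
  then have "same_diff N c m * e = same_diff N c m * ([:X:] * q)" using e(2) q by (simp only: mult.assoc)
  then have "e = [:X:] * q" using sd0 by (simp only: mult_cancel_left simp_thms)
  then have "X * coeff q i \<in> localized_poly l"
    using e(1) by (auto simp: localized_poly2_def)
  then have "coeff q i \<in> localized_poly l"
    unfolding X_def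
  proof (rule localized_poly_prod_factor[rotated])
    fix b p
    assume "(\<Prod>a<b. if c a = c b then 1 else zpt r ?\<beta> m b - zpt r ?\<beta> m a) * p \<in> localized_poly l"
    then show "p \<in> localized_poly l"
    proof (rule localized_poly_prod_factor[rotated])
      fix a p assume a: "a \<in> {..<b}"
        and p: "(if c a = c b then 1 else zpt r ?\<beta> m b - zpt r ?\<beta> m a) * p \<in> localized_poly l"
      show "p \<in> localized_poly l"
      proof (cases "c a = c b")
        case True
        then show ?thesis using p by simp
      next
        case False
        then have "a < r" "\<not> b < r" using a c_eq by auto
        then have "zpt r ?\<beta> m b - zpt r ?\<beta> m a = [:of_int (int (m b) - int (m a)), - 1:]"
          by (simp add: zpt_def beta_poly_def of_nat_poly)
        then have "[:of_int (int (m b) - int (m a)), - 1:] * p \<in> localized_poly l" using p False by simp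
        then show ?thesis by (rule localized_poly_linear_factor[OF l])
      qed
    qed
  qed
  then show "coeff (coeff q i) j \<in> localized_int l" by (simp add: localized_poly_def)
qed

subsection \<open>Partial fractions\<close>

text \<open>Minus the residue at \<open>x = z b\<close> of the product of all
  \<open>1 - 1 / (x - z a)\<close>, and at the same time the ratio by which the Vandermonde product
  changes when \<open>z b\<close> is lowered by 1.\<close>

definition pfcoef :: "nat \<Rightarrow> (nat \<Rightarrow> 'a::field) \<Rightarrow> nat \<Rightarrow> 'a" where
  "pfcoef n z b = (\<Prod>a\<in>{..<n} - {b}. 1 - 1 / (z b - z a))"

lemma pfcoef_Suc:
  "b < n \<Longrightarrow> pfcoef (Suc n) z b = pfcoef n z b * (1 - 1 / (z b - z n))"
proof -
  assume b: "b < n"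
  then have "{..<Suc n} - {b} = insert n ({..<n} - {b})" by auto
  then show ?thesis unfolding pfcoef_def by (simp add: mult.commute)
qed

lemma pfcoef_last: "pfcoef (Suc n) z n = (\<Prod>a<n. 1 - 1 / (z n - z a))"
proof -
  have "{..<Suc n} - {n} = {..<n}" by auto
  then show ?thesis unfolding pfcoef_def by simp
qed

text \<open>The induction hypothesis enters twice: at \<open>x\<close>, and at the new point
  \<open>z n\<close>, where it evaluates the residue belonging to that point.\<close>

lemma partial_fractions:
  assumes "inj_on z {..<n}" "\<And>a. a < n \<Longrightarrow> x \<noteq> z a"
  shows "(\<Prod>a<n. 1 - 1 / (x - z a)) = 1 - (\<Sum>b<n. pfcoef n z b / (x - z b))"
  using assms
proof (induction n arbitrary: x)
  case (Suc n)
  let ?w = "z n"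
  have inj: "inj_on z {..<n}" using Suc.prems(1) by (rule inj_on_subset) auto
  have w: "?w \<noteq> z a" if "a < n" for a using Suc.prems(1) that by (auto dest!: inj_onD[of z _ n a])
  have IHx: "(\<Prod>a<n. 1 - 1 / (x - z a)) = 1 - (\<Sum>b<n. pfcoef n z b / (x - z b))"
    using Suc.prems(2) by (intro Suc.IH inj) auto
  have IHw: "(\<Prod>a<n. 1 - 1 / (?w - z a)) = 1 - (\<Sum>b<n. pfcoef n z b / (?w - z b))"
    using w by (intro Suc.IH inj)
  have xw: "x \<noteq> ?w" using Suc.prems(2) by auto
  have e: "pfcoef n z b * (1 - 1 / (z b - ?w)) / (x - z b) =
     pfcoef n z b / (x - z b) - pfcoef n z b / (x - z b) / (x - ?w) + pfcoef n z b / (?w - z b) / (x - ?w)" if b: "b < n" for b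
  proof -
    have nz: "x - z b \<noteq> 0" "z b - ?w \<noteq> 0" "x - ?w \<noteq> 0" using Suc.prems(2)[of b] w[OF b] xw b by auto
    have aux: "c * (1 - 1 / Q) / P = c / P - c / P / (P + Q) + c / (- Q) / (P + Q)"
      if "P \<noteq> 0" "Q \<noteq> 0" "P + Q \<noteq> 0" for c P Q :: 'a
      using that by (simp add: divide_simps) (simp add: algebra_simps)
    show ?thesis using aux[of "x - z b" "z b - ?w" "pfcoef n z b"] nz by simp
  qed
  have 1: "(\<Prod>a<Suc n. 1 - 1 / (x - z a)) = (1 - (\<Sum>b<n. pfcoef n z b / (x - z b))) * (1 - 1 / (x - ?w))"
    using IHx by simp
  have 2: "(\<Sum>b<Suc n. pfcoef (Suc n) z b / (x - z b)) =
      (\<Sum>b<n. pfcoef n z b * (1 - 1 / (z b - ?w)) / (x - z b)) + (1 - (\<Sum>b<n. pfcoef n z b / (?w - z b))) / (x - ?w)"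
    by (simp add: pfcoef_Suc pfcoef_last IHw)
  have 3: "(\<Sum>b<n. pfcoef n z b * (1 - 1 / (z b - ?w)) / (x - z b)) =
     (\<Sum>b<n. pfcoef n z b / (x - z b)) - (\<Sum>b<n. pfcoef n z b / (x - z b)) / (x - ?w) + (\<Sum>b<n. pfcoef n z b / (?w - z b)) / (x - ?w)"
    by (simp add: e sum.distrib sum_subtractf sum_divide_distrib)
  have "(1 - U) * (1 - 1 / c) = 1 - ((U - U / c + V / c) + (1 - V) / c)" for U V c :: 'a
    by (simp add: diff_divide_distrib left_diff_distrib right_diff_distrib)
  then show ?case unfolding 1 2 3 .
qed simp

definition pfsum :: "nat \<Rightarrow> (nat \<Rightarrow> 'a::field) \<Rightarrow> nat \<Rightarrow> 'a" where
  "pfsum n z k = (\<Sum>b<n. z b ^ k * pfcoef n z b)"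

text \<open>The old weights acquire the factor \<open>1 - 1 / (z b - z n)\<close>, and the new
  weight is known from the partial fractions at \<open>z n\<close>. The terms with denominator
  \<open>z n - z b\<close> combine to \<open>((z n)^k - (z b)^k) / (z n - z b)\<close>, a geometric
  sum.\<close>

lemma pfsum_Suc:
  assumes inj: "inj_on z {..<Suc n}"
  shows "pfsum (Suc n) z k = pfsum n z k + z n ^ k - (\<Sum>i<k. z n ^ i * pfsum n z (k - Suc i))"
proof -
  let ?w = "z n"
  have w: "?w \<noteq> z a" if "a < n" for a using inj that by (auto dest!: inj_onD[of z _ n a])
  have pf: "(\<Prod>a<n. 1 - 1 / (?w - z a)) = 1 - (\<Sum>b<n. pfcoef n z b / (?w - z b))"
    by (rule partial_fractions) (use inj w in \<open>auto intro: inj_on_subset\<close>)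
  have e: "z b ^ k * (pfcoef n z b * (1 - 1 / (z b - ?w))) - ?w ^ k * (pfcoef n z b / (?w - z b))
      = z b ^ k * pfcoef n z b - (\<Sum>i<k. ?w ^ i * (z b ^ (k - Suc i) * pfcoef n z b))" if b: "b < n" for b
  proof -
    have nz: "?w - z b \<noteq> 0" using w[OF b] by simp
    have aux: "A * (c * (1 - 1 / (- D))) - W * (c / D) = A * c - c * ((W - A) / D)"
      if "D \<noteq> 0" for A c D W :: 'a using that by (simp add: field_simps)
    have "z b ^ k * (pfcoef n z b * (1 - 1 / (z b - ?w))) - ?w ^ k * (pfcoef n z b / (?w - z b))
      = z b ^ k * pfcoef n z b - pfcoef n z b * ((?w ^ k - z b ^ k) / (?w - z b))"
      using aux[OF nz, of "z b ^ k" "pfcoef n z b" "?w ^ k"] by simp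
    also have "(?w ^ k - z b ^ k) / (?w - z b) = (\<Sum>i<k. z b ^ (k - Suc i) * ?w ^ i)"
      using nz by (subst power_diff_sumr2) simp
    finally show ?thesis by (simp add: sum_distrib_left mult_ac)
  qed
  have "pfsum (Suc n) z k = (\<Sum>b<n. z b ^ k * (pfcoef n z b * (1 - 1 / (z b - ?w)))) + ?w ^ k * (1 - (\<Sum>b<n. pfcoef n z b / (?w - z b)))"
    unfolding pfsum_def by (simp add: pfcoef_Suc pfcoef_last pf)
  also have "\<dots> = (\<Sum>b<n. z b ^ k * (pfcoef n z b * (1 - 1 / (z b - ?w))) - ?w ^ k * (pfcoef n z b / (?w - z b))) + ?w ^ k"
    unfolding right_diff_distrib[of "?w ^ k"] sum_subtractf sum_distrib_left by simp
  also have "\<dots> = (\<Sum>b<n. z b ^ k * pfcoef n z b - (\<Sum>i<k. ?w ^ i * (z b ^ (k - Suc i) * pfcoef n z b))) + ?w ^ k"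
    by (intro arg_cong2[of _ _ _ _ "(+)"] sum.cong refl e) simp
  also have "\<dots> = pfsum n z k - (\<Sum>i<k. ?w ^ i * pfsum n z (k - Suc i)) + ?w ^ k"
  proof -
    have "(\<Sum>b<n. \<Sum>i<k. ?w ^ i * (z b ^ (k - Suc i) * pfcoef n z b)) = (\<Sum>i<k. ?w ^ i * pfsum n z (k - Suc i))"
      unfolding pfsum_def sum_distrib_left by (rule sum.swap)
    then show ?thesis unfolding sum_subtractf by (simp add: pfsum_def)
  qed
  finally show ?thesis by simp
qed

definition psum :: "nat \<Rightarrow> (nat \<Rightarrow> 'a::comm_ring_1) \<Rightarrow> nat \<Rightarrow> 'a" where
  "psum n z k = (\<Sum>b<n. z b ^ k)"

text \<open>Closed forms for \<open>k \<le> 3\<close>; larger \<open>k\<close> give a junk value.\<close>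

definition pfclosed :: "nat \<Rightarrow> (nat \<Rightarrow> 'a::field_char_0) \<Rightarrow> nat \<Rightarrow> 'a" where
  "pfclosed n z k = (let N = of_nat n; p = psum n z in
     if k = 0 then N
     else if k = 1 then p 1 - N * (N - 1) / 2
     else if k = 2 then p 2 - (N - 1) * p 1 + N * (N - 1) * (N - 2) / 6
     else p 3 - (N - 1) * p 2 - ((p 1)^2 - p 2) / 2 + (N - 1) * (N - 2) / 2 * p 1
        - N * (N - 1) * (N - 2) * (N - 3) / 24)"

lemma pfsum_closed:
  assumes "inj_on z {..<n}"
  shows "pfsum n z 0 = pfclosed n z 0 \<and> pfsum n z 1 = pfclosed n z 1 \<and>
         pfsum n z 2 = pfclosed n z 2 \<and> pfsum n z 3 = pfclosed n z 3"
  using assms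
proof (induction n)
  case 0
  show ?case by (simp add: pfsum_def pfclosed_def psum_def)
next
  case (Suc n)
  have "inj_on z {..<n}" using Suc.prems by (rule inj_on_subset) auto
  note IH = Suc.IH[OF this]
  have ps: "psum (Suc n) z k = psum n z k + z n ^ k" for k by (simp add: psum_def)
  have l2: "{..<2::nat} = {0, 1}" "{..<3::nat} = {0, 1, 2}" by auto
  have r: "pfsum (Suc n) z 0 = pfsum n z 0 + 1"
    "pfsum (Suc n) z 1 = pfsum n z 1 + z n - pfsum n z 0"
    "pfsum (Suc n) z 2 = pfsum n z 2 + z n ^ 2 - (pfsum n z 1 + z n * pfsum n z 0)"
    "pfsum (Suc n) z 3 = pfsum n z 3 + z n ^ 3 - (pfsum n z 2 + (z n * pfsum n z 1 + z n ^ 2 * pfsum n z 0))"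
    using pfsum_Suc[OF Suc.prems, of 0] pfsum_Suc[OF Suc.prems, of 1]
      pfsum_Suc[OF Suc.prems, of 2] pfsum_Suc[OF Suc.prems, of 3]
    unfolding l2 by (simp_all add: numeral_2_eq_2)
  then have h: "pfsum n z 0 = pfclosed n z 0" "pfsum n z 1 = pfclosed n z 1"
    "pfsum n z 2 = pfclosed n z 2" "pfsum n z 3 = pfclosed n z 3" using IH by blast+
  show ?case unfolding r h unfolding pfclosed_def ps Let_def
    by (intro conjI) (simp_all add: field_simps power2_eq_square power3_eq_cube del: One_nat_def)
qed

subsection \<open>Shifting one variable of the Vandermonde product\<close>

lemma vand_Suc: "vand (Suc n) z = vand n z * (\<Prod>i<n. z n - z i)"
  by (simp add: vand_def)

lemma vand_cong: "(\<And>i. i < n \<Longrightarrow> y i = z i) \<Longrightarrow> vand n y = vand n z"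
  unfolding vand_def by (intro prod.cong refl) auto

lemma vand_fun_upd:
  "b < n \<Longrightarrow> vand n (z(b := y)) * (\<Prod>a\<in>{..<n} - {b}. z b - z a) = vand n z * (\<Prod>a\<in>{..<n} - {b}. y - z a)"
proof (induction n)
  case (Suc n)
  show ?case
  proof (cases "b = n")
    case True
    have s: "{..<Suc n} - {n} = {..<n}" by auto
    have "vand n (z(n := y)) = vand n z" by (rule vand_cong) simp
    then show ?thesis unfolding True s vand_Suc by (simp add: mult_ac)
  next
    case False
    then have b: "b < n" using Suc.prems by simp
    have s: "{..<Suc n} - {b} = insert n ({..<n} - {b})" using b by auto
    have p: "(\<Prod>i<n. z n - z i) = (z n - z b) * (\<Prod>i\<in>{..<n} - {b}. z n - z i)"
      using b by (subst prod.remove[of _ b]) auto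
    have q: "(\<Prod>i<n. (z(b := y)) n - (z(b := y)) i) = (z n - y) * (\<Prod>i\<in>{..<n} - {b}. z n - z i)"
      using b by (subst prod.remove[of _ b]) auto
    define A where "A = (\<Prod>a\<in>{..<n} - {b}. z b - z a)"
    define C where "C = (\<Prod>a\<in>{..<n} - {b}. y - z a)"
    define G where "G = (\<Prod>i\<in>{..<n} - {b}. z n - z i)"
    have ih: "vand n (z(b := y)) * A = vand n z * C" using Suc.IH[OF b] unfolding A_def C_def .
    have "vand (Suc n) (z(b := y)) * (\<Prod>a\<in>{..<Suc n} - {b}. z b - z a)
       = (vand n (z(b := y)) * A) * ((z n - y) * (z b - z n)) * G"
      unfolding vand_Suc q s by (simp add: A_def G_def mult_ac)
    also have "\<dots> = vand n z * ((z n - z b) * G) * ((y - z n) * C)"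
      unfolding ih by (simp add: algebra_simps)
    also have "\<dots> = vand (Suc n) z * (\<Prod>a\<in>{..<Suc n} - {b}. y - z a)"
      unfolding vand_Suc p s by (simp add: C_def G_def)
    finally show ?thesis .
  qed
qed simp

lemma vand_shift:
  fixes z :: "nat \<Rightarrow> 'a::field"
  assumes "inj_on z {..<n}" "b < n"
  shows "vand n (z(b := z b - 1)) = vand n z * pfcoef n z b"
proof -
  have nz: "z b - z a \<noteq> 0" if "a \<in> {..<n} - {b}" for a
    using assms that by (auto dest: inj_onD)
  then have P: "(\<Prod>a\<in>{..<n} - {b}. z b - z a) \<noteq> 0" by (simp add: prod_zero_iff)
  have "pfcoef n z b * (\<Prod>a\<in>{..<n} - {b}. z b - z a) = (\<Prod>a\<in>{..<n} - {b}. z b - 1 - z a)"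
    unfolding pfcoef_def prod.distrib[symmetric]
    by (intro prod.cong refl) (use nz in \<open>simp add: field_simps\<close>)
  then have "vand n (z(b := z b - 1)) * (\<Prod>a\<in>{..<n} - {b}. z b - z a)
     = vand n z * pfcoef n z b * (\<Prod>a\<in>{..<n} - {b}. z b - z a)"
    using vand_fun_upd[OF assms(2), of z "z b - 1"] by (simp add: mult.assoc)
  then show ?thesis using P by simp
qed

text \<open>The complement of a finite set is dense. This removes coincidences among the points
  \<open>z\<close> as well as the zeros of the Vandermonde product regarded as a function of
  \<beta>.\<close>

lemma agree_off_finite:
  fixes f g :: "complex \<Rightarrow> complex"
  assumes "continuous_on UNIV f" "continuous_on UNIV g" "finite F" "\<And>x. x \<notin> F \<Longrightarrow> f x = g x"
  shows "f x = g x"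
proof -
  have "closed {x. f x = g x}" by (rule closed_Collect_eq) (use assms in auto)
  moreover have "- F \<subseteq> {x. f x = g x}" using assms(4) by auto
  ultimately have "closure (- F) \<subseteq> {x. f x = g x}" by (rule closure_minimal[rotated])
  moreover have "closure (- F) = UNIV"
    using empty_interior_finite[OF assms(3)] by (simp add: closure_complement)
  ultimately show ?thesis by auto
qed

lemma sum_vand_shift_inj:
  fixes z :: "nat \<Rightarrow> complex"
  assumes "inj_on z {..<n}" "k \<le> 3"
  shows "(\<Sum>b<n. z b ^ k * vand n (z(b := z b - 1))) = vand n z * pfclosed n z k"
proof -
  have "k = 0 \<or> k = 1 \<or> k = 2 \<or> k = 3" using assms(2) by auto
  then have "pfsum n z k = pfclosed n z k" using pfsum_closed[OF assms(1)] by blast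
  moreover have "(\<Sum>b<n. z b ^ k * vand n (z(b := z b - 1))) = vand n z * pfsum n z k"
    unfolding pfsum_def sum_distrib_left
    by (intro sum.cong refl) (simp add: vand_shift[OF assms(1)] mult_ac)
  ultimately show ?thesis by simp
qed

text \<open>Both sides are continuous in \<open>z\<close>, and a generic perturbation separates the points.\<close>

lemma sum_vand_shift:
  fixes z :: "nat \<Rightarrow> complex"
  assumes "k \<le> 3"
  shows "(\<Sum>b<n. z b ^ k * vand n (z(b := z b - 1))) = vand n z * pfclosed n z k"
proof -
  define y where "y t b = z b + of_nat b * t" for t :: complex and b
  define f where "f t = (\<Sum>b<n. y t b ^ k * vand n ((y t)(b := y t b - 1)))" for t
  define g where "g t = vand n (y t) * pfclosed n (y t) k" for t
  \<comment> \<open>The parameters at which two perturbed points can meet. Pairs with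
    \<open>a = b\<close> only add the value 0, by the convention for division by zero.\<close>
  define F where "F = (\<lambda>(a, b). (z b - z a) / (of_nat a - of_nat b)) ` ({..<n} \<times> {..<n})"
  have fin: "finite F" by (simp add: F_def)
  have agree: "f t = g t" if "t \<notin> F" for t
  proof -
    have "inj_on (y t) {..<n}"
    proof (rule inj_onI, rule ccontr)
      fix a b assume ab: "a \<in> {..<n}" "b \<in> {..<n}" "y t a = y t b" "a \<noteq> b"
      have "of_nat a - of_nat b \<noteq> (0::complex)" using ab(4) by simp
      then have "t = (z b - z a) / (of_nat a - of_nat b)" using ab(3) by (simp add: y_def field_simps)
      then show False using that ab by (auto simp: F_def)
    qed
    then show ?thesis unfolding f_def g_def using assms by (rule sum_vand_shift_inj)
  qed
  have "f 0 = g 0"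
  proof (rule agree_off_finite[OF _ _ fin agree])
    have "continuous_on UNIV (\<lambda>t. ((y t)(b := y t b - 1)) i)" for b i
      by (cases "i = b") (auto simp: y_def intro!: continuous_intros)
    then show "continuous_on UNIV f" unfolding f_def vand_def
      by (auto intro!: continuous_intros simp: y_def)
    show "continuous_on UNIV g" unfolding g_def vand_def pfclosed_def Let_def psum_def y_def
      by (cases "k = 0"; cases "k = 1"; cases "k = 2") (auto intro!: continuous_intros)
  qed
  moreover have "y 0 = z" by (auto simp: y_def)
  ultimately show ?thesis by (simp add: f_def g_def)
qed

subsection \<open>Derivatives of the generating determinant\<close>

lemma pderiv_sum: "pderiv (sum f A) = (\<Sum>i\<in>A. pderiv (f i))"
  by (induction A rule: infinite_finite_induct) (auto simp: pderiv_add)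

lemma pderiv_dt_rows:
  fixes f :: "nat \<Rightarrow> nat \<Rightarrow> 'a::idom poly"
  shows "pderiv (dt n f) = (\<Sum>b<n. dt n (\<lambda>i j. if i = b then pderiv (f i j) else f i j))"
proof -
  have "pderiv (of_int (sign p) * (\<Prod>i=0..<n. f i (p i)))
     = (\<Sum>b<n. of_int (sign p) * (\<Prod>i=0..<n. if i = b then pderiv (f i (p i)) else f i (p i)))" for p
  proof -
    have "pderiv (of_int (sign p) * (\<Prod>i=0..<n. f i (p i))) = of_int (sign p) * pderiv (\<Prod>i=0..<n. f i (p i))"
      by (simp add: sign_def pderiv_minus)
    also have "pderiv (\<Prod>i=0..<n. f i (p i)) = (\<Sum>b\<in>{0..<n}. (\<Prod>i\<in>{0..<n} - {b}. f i (p i)) * pderiv (f b (p b)))"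
      by (rule pderiv_prod)
    also have "\<dots> = (\<Sum>b\<in>{0..<n}. \<Prod>i=0..<n. if i = b then pderiv (f i (p i)) else f i (p i))"
    proof (intro sum.cong refl)
      fix b assume "b \<in> {0..<n}"
      then have "(\<Prod>i=0..<n. if i = b then pderiv (f i (p i)) else f i (p i)) =
         pderiv (f b (p b)) * (\<Prod>i\<in>{0..<n} - {b}. if i = b then pderiv (f i (p i)) else f i (p i))"
        by (subst prod.remove[of _ b]) auto
      also have "(\<Prod>i\<in>{0..<n} - {b}. if i = b then pderiv (f i (p i)) else f i (p i)) = (\<Prod>i\<in>{0..<n} - {b}. f i (p i))"
        by (intro prod.cong) auto
      finally show "(\<Prod>i\<in>{0..<n} - {b}. f i (p i)) * pderiv (f b (p b)) = (\<Prod>i=0..<n. if i = b then pderiv (f i (p i)) else f i (p i))"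
        by (simp add: mult.commute)
    qed
    finally show ?thesis by (simp add: sum_distrib_left atLeast0LessThan)
  qed
  then show ?thesis unfolding dt_leibniz pderiv_sum by (subst sum.swap) simp
qed

lemma pderiv_dt_cols:
  fixes f :: "nat \<Rightarrow> nat \<Rightarrow> 'a::idom poly"
  shows "pderiv (dt n f) = (\<Sum>b<n. dt n (\<lambda>i j. if j = b then pderiv (f i j) else f i j))"
  using pderiv_dt_rows[of n "\<lambda>i j. f j i"] dt_transpose[of n f]
    dt_transpose[of n "\<lambda>i j. if j = _ then pderiv (f i j) else f i j"] by simp

lemma lcoef_Suc_Suc:
  "of_nat (Suc k) * lcoef \<alpha> (Suc m) (Suc k) = - (of_nat (Suc m) * (of_nat (Suc m) + \<alpha>)) * lcoef \<alpha> m k"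
proof -
  have b: "of_nat (Suc k) * of_nat (Suc m choose Suc k) = of_nat (Suc m) * (of_nat (m choose k) :: 'a)"
    by (metis Suc_times_binomial_eq of_nat_mult mult.commute)
  have p: "pochhammer (\<alpha> + of_nat (Suc m) - of_nat (Suc k) + 1) (Suc k)
     = pochhammer (\<alpha> + of_nat m - of_nat k + 1) k * (of_nat (Suc m) + \<alpha>)"
    unfolding pochhammer_Suc by (simp add: algebra_simps)
  have "of_nat (Suc k) * lcoef \<alpha> (Suc m) (Suc k) = - ((-1) ^ k * (of_nat (Suc k) * of_nat (Suc m choose Suc k)) *
      (pochhammer (\<alpha> + of_nat m - of_nat k + 1) k * (of_nat (Suc m) + \<alpha>)))"
    unfolding lcoef_def p by (simp add: mult_ac del: of_nat_Suc binomial_Suc_Suc)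
  then show ?thesis unfolding b lcoef_def by (simp add: mult_ac del: of_nat_Suc)
qed

text \<open>Differentiation in \<open>u\<close> lowers \<open>k\<close>, and
  \<open>z - (k + 1) = (z - 1) - k\<close> turns this into lowering the degree and the node
  together. At \<open>m = 0\<close> the truncated \<open>m - 1\<close> is harmless because the
  weight is 0.\<close>

lemma pderiv_lcoef_sum:
  fixes \<alpha> :: "'a::idom"
  shows "pderiv (\<Sum>k\<le>m. monom (lcoef \<alpha> m k * (z - of_nat k) ^ a) k)
     = smult (- (of_nat m * (of_nat m + \<alpha>))) (\<Sum>k\<le>m - 1. monom (lcoef \<alpha> (m - 1) k * (z - 1 - of_nat k) ^ a) k)"
proof (cases m)
  case (Suc n)
  have "pderiv (\<Sum>k\<le>Suc n. monom (lcoef \<alpha> (Suc n) k * (z - of_nat k) ^ a) k)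
    = (\<Sum>k\<le>n. monom (of_nat (Suc k) * lcoef \<alpha> (Suc n) (Suc k) * (z - of_nat (Suc k)) ^ a) k)"
    unfolding pderiv_sum
    by (subst sum.atMost_Suc_shift) (simp add: pderiv_monom monom_0 mult_ac del: of_nat_Suc)
  also have "\<dots> = smult (- (of_nat (Suc n) * (of_nat (Suc n) + \<alpha>))) (\<Sum>k\<le>n. monom (lcoef \<alpha> n k * (z - 1 - of_nat k) ^ a) k)"
    unfolding lcoef_Suc_Suc
    by (rule poly_eqI) (simp add: coeff_sum sum_distrib_left if_distrib diff_diff_eq mult.assoc cong: if_cong)
  finally show ?thesis using Suc by simp
qed (simp add: pderiv_monom monom_0)

lemma pderiv_gdet:
  fixes \<beta> :: "'a::idom"
  shows "pderiv (gdet r N \<beta> m) = (\<Sum>b<N. smult (- (of_nat (m b) * (of_nat (m b) + apar r \<beta> b))) (gdet r N \<beta> (m(b := m b - 1))))"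
  unfolding gdet_def pderiv_dt_cols
proof (intro sum.cong refl)
  fix b assume b: "b \<in> {..<N}"
  let ?e = "\<lambda>m a j. \<Sum>k\<le>m j. monom (lcoef (apar r \<beta> j) (m j) k * (zpt r \<beta> m j - of_nat k) ^ a) k"
  let ?m = "m(b := m b - 1)"
  let ?w = "- (of_nat (m b) * (of_nat (m b) + apar r \<beta> b))"
  have "(if j = b then pderiv (?e m a j) else ?e m a j) = (if j = b then [:?w:] else 1) * ?e ?m a j" for a j
  proof (cases "j = b")
    case True
    show ?thesis
    proof (cases "m b = 0")
      case True
      then show ?thesis using \<open>j = b\<close> by (simp add: pderiv_monom)
    next
      case False
      then have "zpt r \<beta> m b - 1 = zpt r \<beta> ?m b" by (simp add: zpt_def of_nat_diff)
      then show ?thesis using True by (simp add: pderiv_lcoef_sum)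
    qed
  next
    case False
    then show ?thesis by (simp add: zpt_def)
  qed
  then have "dt N (\<lambda>a j. if j = b then pderiv (?e m a j) else ?e m a j) = dt N (\<lambda>a j. (if j = b then [:?w:] else 1) * ?e ?m a j)"
    by simp
  also have "\<dots> = (\<Prod>j<N. if j = b then [:?w:] else 1) * dt N (?e ?m)"
    by (rule dt_mult_cols)
  also have "(\<Prod>j<N. if j = b then [:?w:] else 1) = [:?w:]"
    using b by (subst prod.delta) auto
  also have "[:?w:] * dt N (?e ?m) = smult ?w (dt N (?e ?m))"
    by (simp only: mult_pCons_left mult_zero_left pCons_0_0 add_0_right)
  finally show "dt N (\<lambda>a j. if j = b then pderiv (?e m a j) else ?e m a j) = smult ?w (dt N (?e ?m))" .
qed

lemma coeff_0_gdet: "coeff (gdet r N \<beta> m) 0 = vand N (zpt r \<beta> m)"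
proof -
  have h: "comm_ring_hom (\<lambda>p. coeff p 0 :: 'a::comm_ring_1)" by unfold_locales (auto simp: coeff_mult_0)
  have "coeff (\<Sum>k\<le>m b. monom (lcoef (apar r \<beta> b) (m b) k * (zpt r \<beta> m b - of_nat k) ^ a) k) 0 = zpt r \<beta> m b ^ a" for a b
    by (simp add: coeff_sum if_distrib sum.delta cong: if_cong)
  then show ?thesis unfolding gdet_def dt_hom[OF h] vandermonde[symmetric] by simp
qed

lemma weight_zpt: "of_nat (m b) * (of_nat (m b) + apar r \<beta> b) = zpt r \<beta> m b ^ 2 + \<beta> * zpt r \<beta> m b"
  by (simp add: zpt_def apar_def power2_eq_square algebra_simps)

text \<open>Up to sign, the ratio of the linear coefficient in \<open>u\<close> to the Vandermonde
  product; the two terms come from the weight \<open>z b ^ 2 + \<beta> * z b\<close>.\<close>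

definition vshift :: "nat \<Rightarrow> complex \<Rightarrow> (nat \<Rightarrow> complex) \<Rightarrow> complex" where
  "vshift N \<beta> z = pfclosed N z 2 + \<beta> * pfclosed N z 1"

lemma sum_weight_vand:
  "(\<Sum>b<N. (z b ^ 2 + \<beta> * z b) * vand N (z(b := z b - 1))) = vand N z * vshift N \<beta> z"
proof -
  have 1: "(\<Sum>b<N. z b ^ 1 * vand N (z(b := z b - 1))) = vand N z * pfclosed N z 1"
    by (rule sum_vand_shift) simp
  have 2: "(\<Sum>b<N. z b ^ 2 * vand N (z(b := z b - 1))) = vand N z * pfclosed N z 2"
    by (rule sum_vand_shift) simp
  have "(\<Sum>b<N. (z b ^ 2 + \<beta> * z b) * vand N (z(b := z b - 1)))
     = (\<Sum>b<N. z b ^ 2 * vand N (z(b := z b - 1))) + \<beta> * (\<Sum>b<N. z b ^ 1 * vand N (z(b := z b - 1)))"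
    by (simp add: distrib_right sum.distrib sum_distrib_left mult.assoc)
  then show ?thesis unfolding 1 2 vshift_def by (simp add: distrib_left mult.left_commute)
qed

lemma sum_weight_vand2:
  fixes z :: "nat \<Rightarrow> complex"
  shows "(\<Sum>b<N. z b * ((z b ^ 2 + \<beta> * z b) * vand N (z(b := z b - 1)))) = vand N z * (pfclosed N z 3 + \<beta> * pfclosed N z 2)"
proof -
  have 1: "(\<Sum>b<N. z b ^ 3 * vand N (z(b := z b - 1))) = vand N z * pfclosed N z 3"
    by (rule sum_vand_shift) simp
  have 2: "(\<Sum>b<N. z b ^ 2 * vand N (z(b := z b - 1))) = vand N z * pfclosed N z 2"
    by (rule sum_vand_shift) simp
  have "(\<Sum>b<N. z b * ((z b ^ 2 + \<beta> * z b) * vand N (z(b := z b - 1))))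
     = (\<Sum>b<N. z b ^ 3 * vand N (z(b := z b - 1))) + \<beta> * (\<Sum>b<N. z b ^ 2 * vand N (z(b := z b - 1)))"
    unfolding sum_distrib_left sum.distrib[symmetric]
    by (intro sum.cong refl) (simp add: power2_eq_square power3_eq_cube algebra_simps)
  then show ?thesis unfolding 1 2 by (simp add: distrib_left mult.left_commute)
qed

text \<open>The change is affine in \<open>z b\<close>. A second differentiation therefore needs
  just one more moment, the sum with the additional weight \<open>z b\<close>, and this is where
  power sums of order 3 enter.\<close>

lemma vshift_upd:
  assumes "b < N"
  shows "vshift N \<beta> (z(b := z b - 1)) = vshift N \<beta> z - 2 * z b + of_nat N - \<beta>"
proof -
  have p: "psum N (z(b := y)) k = psum N z k - z b ^ k + y ^ k" for y k
  proof -
    have "psum N (z(b := y)) k = y ^ k + (\<Sum>i\<in>{..<N} - {b}. z i ^ k)"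
      unfolding psum_def using assms by (subst sum.remove[of _ b]) auto
    moreover have "psum N z k = z b ^ k + (\<Sum>i\<in>{..<N} - {b}. z i ^ k)"
      unfolding psum_def using assms by (subst sum.remove[of _ b]) auto
    ultimately show ?thesis by simp
  qed
  show ?thesis unfolding vshift_def pfclosed_def Let_def p
    by (simp add: power2_eq_square algebra_simps)
qed

text \<open>At \<open>m b = 0\<close> the truncated exponent does not move while the node on the
  right does; the common weight vanishes there. Otherwise the two node functions agree.\<close>

lemma weight_vand_zpt:
  "of_nat (m b) * (of_nat (m b) + apar r \<beta> b) * f (zpt r \<beta> (m(b := m b - 1)))
     = (zpt r \<beta> m b ^ 2 + \<beta> * zpt r \<beta> m b) * (f ((zpt r \<beta> m)(b := zpt r \<beta> m b - 1)) :: complex)"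
proof (cases "m b = 0")
  case True
  then show ?thesis by (simp flip: weight_zpt)
next
  case False
  then have "zpt r \<beta> (m(b := m b - 1)) = (zpt r \<beta> m)(b := zpt r \<beta> m b - 1)"
    by (auto simp: zpt_def of_nat_diff)
  then show ?thesis by (simp flip: weight_zpt)
qed

lemma coeff_1_gdet:
  "coeff (gdet r N \<beta> m) 1 = - (vand N (zpt r \<beta> m) * vshift N \<beta> (zpt r \<beta> m))"
proof -
  have "coeff (gdet r N \<beta> m) 1 = coeff (pderiv (gdet r N \<beta> m)) 0" by (simp add: coeff_pderiv)
  also have "\<dots> = - (\<Sum>b<N. of_nat (m b) * (of_nat (m b) + apar r \<beta> b) * vand N (zpt r \<beta> (m(b := m b - 1))))"
    unfolding pderiv_gdet by (simp add: coeff_sum coeff_0_gdet sum_negf)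
  also have "\<dots> = - (vand N (zpt r \<beta> m) * vshift N \<beta> (zpt r \<beta> m))"
    unfolding weight_vand_zpt[of _ _ _ _ "vand N"] sum_weight_vand ..
  finally show ?thesis .
qed

lemma coeff_2_gdet:
  fixes r m \<beta>
  defines "z \<equiv> zpt r \<beta> m"
  shows "2 * coeff (gdet r N \<beta> m) 2 = vand N z * ((vshift N \<beta> z + of_nat N - \<beta>) * vshift N \<beta> z
      - 2 * (pfclosed N z 3 + \<beta> * pfclosed N z 2))"
proof -
  have "2 * coeff (gdet r N \<beta> m) 2 = coeff (pderiv (gdet r N \<beta> m)) 1" by (simp add: coeff_pderiv numeral_2_eq_2)
  also have "\<dots> = (\<Sum>b<N. of_nat (m b) * (of_nat (m b) + apar r \<beta> b) *
      (vand N (zpt r \<beta> (m(b := m b - 1))) * vshift N \<beta> (zpt r \<beta> (m(b := m b - 1)))))"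
    unfolding pderiv_gdet by (simp add: coeff_sum coeff_1_gdet del: One_nat_def)
  also have "\<dots> = (\<Sum>b<N. (z b ^ 2 + \<beta> * z b) * (vand N (z(b := z b - 1)) * vshift N \<beta> (z(b := z b - 1))))"
    unfolding weight_vand_zpt[of _ _ _ _ "\<lambda>z. vand N z * vshift N \<beta> z"] z_def ..
  also have "\<dots> = (\<Sum>b<N. (vshift N \<beta> z + of_nat N - \<beta>) * ((z b ^ 2 + \<beta> * z b) * vand N (z(b := z b - 1)))
       - 2 * (z b * ((z b ^ 2 + \<beta> * z b) * vand N (z(b := z b - 1)))))"
    by (intro sum.cong refl) (simp add: vshift_upd algebra_simps)
  also have "\<dots> = (vshift N \<beta> z + of_nat N - \<beta>) * (\<Sum>b<N. (z b ^ 2 + \<beta> * z b) * vand N (z(b := z b - 1)))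
       - 2 * (\<Sum>b<N. z b * ((z b ^ 2 + \<beta> * z b) * vand N (z(b := z b - 1))))"
    by (simp add: sum_subtractf sum_distrib_left)
  finally show ?thesis unfolding sum_weight_vand sum_weight_vand2 by (simp add: algebra_simps)
qed

subsection \<open>Degrees and the lowest coefficient\<close>

lemma dt_ffall:
  fixes z :: "nat \<Rightarrow> 'a::idom"
  shows "dt n (\<lambda>i j. ffall (z j) i) = vand n z"
proof -
  let ?F = "\<lambda>i. \<Prod>t<i. [:- of_nat t, 1 :: 'a:]"
  have "poly (?F i) x = ffall x i" for i x by (simp add: poly_prod ffall_def)
  moreover have "degree (?F i) = i" for i
    by (subst degree_prod_eq_sum_degree) auto
  moreover have "lead_coeff (?F i) = 1" for i by (simp only: lead_coeff_prod) simp
  ultimately show ?thesis using dt_monic_eq_vand[of ?F n z] by simp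
qed

lemma sum_lessThan_eq_choose_two: "(\<Sum>i<n. i) = (n choose 2)"
  by (induction n) (simp_all add: numeral_2_eq_2)

lemma prod_lessThan_add:
  fixes r s :: nat
  shows "(\<Prod>i<r + s. f i) = (\<Prod>i<r. f i) * (\<Prod>j<s. f (r + j))"
  by (induction s) (simp_all add: mult.assoc)

lemma sum_lessThan_add:
  fixes r s :: nat
  shows "(\<Sum>i<r + s. f i) = (\<Sum>i<r. f i) + (\<Sum>j<s. f (r + j))"
  by (induction s) (simp_all add: add.assoc)

lemma restrict_diff_diff:
  fixes k :: "'i \<Rightarrow> nat"
  assumes "k \<in> PiE A (\<lambda>b. {..m b})"
  shows "(\<lambda>b\<in>A. m b - (\<lambda>b\<in>A. m b - k b) b) = k"
proof
  fix x
  show "(\<lambda>b\<in>A. m b - (\<lambda>b\<in>A. m b - k b) b) x = k x"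
  proof (cases "x \<in> A")
    case True
    then have "k x \<le> m x" using PiE_mem[OF assms, of x] by simp
    then show ?thesis using True by simp
  next
    case False
    then show ?thesis using PiE_arb[OF assms False] by simp
  qed
qed

lemma vand_split:
  "vand (r + s) z = vand r z * vand s (\<lambda>j. z (r + j)) * (\<Prod>j<s. \<Prod>i<r. z (r + j) - z i)"
proof (induction s)
  case 0
  show ?case by (simp add: vand_def)
next
  case (Suc s)
  have "(\<Prod>i<r + s. z (r + s) - z i) = (\<Prod>i<r. z (r + s) - z i) * (\<Prod>j<s. z (r + s) - z (r + j))"
    by (rule prod_lessThan_add)
  then show ?case using Suc by (simp add: vand_Suc mult_ac)
qed

lemma vand_of_nat: "vand n (\<lambda>i. of_nat i :: 'a::comm_ring_1) = (\<Prod>b<n. of_nat (fact b))"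
proof -
  have "(\<Prod>i<b. of_nat b - of_nat i :: 'a) = of_nat (fact b)" for b
    using ffall_of_nat[of b b] by (simp add: ffall_def)
  then show ?thesis by (simp add: vand_def)
qed

lemma vand_eq_0:
  "a < N \<Longrightarrow> b < N \<Longrightarrow> a \<noteq> b \<Longrightarrow> z a = z b \<Longrightarrow> vand N z = 0"
proof (induction a b rule: linorder_wlog)
  case (le a b)
  then have "(\<Prod>i<b. z b - z i) = 0" by (subst prod.remove[of _ a]) auto
  then show ?case unfolding vand_def using le by (subst prod.remove[of _ b]) auto
qed metis

lemma card_same_pairs_blocks:
  assumes "r \<le> N"
  shows "card (same_pairs N (\<lambda>b. b < r)) = 2 * ((r choose 2) + (N - r choose 2))"
proof -
  let ?A = "{..<r}" and ?B = "{r..<N}"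
  let ?D = "\<lambda>S :: nat set. S \<times> S - (\<lambda>a. (a, a)) ` S"
  have u: "same_pairs N (\<lambda>b. b < r) = ?D ?A \<union> ?D ?B" using assms by (auto simp: same_pairs_def)
  have c: "card (?D S) = 2 * (card S choose 2)" if "finite S" for S :: "nat set"
  proof -
    have "card (?D S) = card S * card S - card S"
      using that by (subst card_Diff_subset) (auto simp: card_cartesian_product card_image inj_on_def)
    also have "\<dots> = card S * (card S - 1)" by (simp add: diff_mult_distrib2)
    also have "\<dots> = 2 * (card S choose 2)" 
      unfolding choose_two by (rule dvd_mult_div_cancel[symmetric]) (cases "card S", auto)
    finally show ?thesis .
  qed
  show ?thesis unfolding u
    by (subst card_Un_disjoint) (auto simp: c)
qed

lemma sum_inj_nat_ge:
  "finite A \<Longrightarrow> inj_on f A \<Longrightarrow> card A choose 2 \<le> (\<Sum>a\<in>A. f a :: nat)"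
proof (induction "card A" arbitrary: A)
  case (Suc n)
  have ne: "A \<noteq> {}" using Suc.hyps(2) by auto
  have "Max (f ` A) \<in> f ` A" by (rule Max_in) (use Suc.prems ne in auto)
  then obtain a where a: "Max (f ` A) = f a" "a \<in> A" by (rule imageE)
  have "f x \<le> f a" if "x \<in> A" for x unfolding a(1)[symmetric] using that Suc.prems by (intro Max_ge) auto
  then have "f ` A \<subseteq> {..f a}" by auto
  then have "card (f ` A) \<le> card {..f a}" by (intro card_mono) auto
  then have fa: "n \<le> f a" using Suc.prems Suc.hyps(2) by (simp add: card_image)
  have "card (A - {a}) choose 2 \<le> (\<Sum>a\<in>A - {a}. f a)"
    by (rule Suc.hyps(1)) (use Suc a in \<open>auto intro: inj_on_subset\<close>)
  moreover have "card (A - {a}) = n" using Suc a by simp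
  moreover have "Suc n choose 2 = n + (n choose 2)" by (simp add: numeral_2_eq_2)
  moreover have "sum f A = f a + sum f (A - {a})" using a Suc.prems by (simp add: sum.remove)
  ultimately show ?case using fa Suc.hyps(2) by simp
qed simp

text \<open>Deleting \<open>a\<close> leaves a sum of at least \<open>card A - 1 choose 2\<close>,
  so \<open>f a\<close> has at most \<open>card A - 1\<close> to itself. Distinct exponents of
  minimal total thus fill an initial segment.\<close>

lemma sum_inj_nat_minimal:
  assumes "finite A" "inj_on f A" "(\<Sum>a\<in>A. f a :: nat) \<le> card A choose 2" "a \<in> A"
  shows "f a < card A"
proof (rule ccontr)
  assume c: "\<not> f a < card A"
  obtain n where n: "card A = Suc n" using assms by (cases "card A") auto
  have "card (A - {a}) choose 2 \<le> (\<Sum>a\<in>A - {a}. f a)"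
    by (rule sum_inj_nat_ge) (use assms in \<open>auto intro: inj_on_subset\<close>)
  moreover have "card (A - {a}) = n" using assms n by simp
  moreover have "Suc n choose 2 = n + (n choose 2)" by (simp add: numeral_2_eq_2)
  moreover have "sum f A = f a + sum f (A - {a})" using assms by (simp add: sum.remove)
  ultimately show False using assms(3) c n by simp
qed

lemma gdet_vand_nonzero_inj:
  assumes k: "\<And>b. b < N \<Longrightarrow> k b \<le> m b" and v: "vand N (\<lambda>b. zpt r \<beta> m b - of_nat (k b)) \<noteq> 0"
    and "a < N" "b < N" "a \<noteq> b" "a < r \<longleftrightarrow> b < r"
  shows "m a - k a \<noteq> m b - k b"
proof
  assume e: "m a - k a = m b - k b"
  have z: "zpt r \<beta> m c - of_nat (k c) = of_nat (m c - k c) - (if c < r then 0 else \<beta>)" if "c < N" for c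
    using k[OF that] by (simp add: zpt_def of_nat_diff)
  have "vand N (\<lambda>b. zpt r \<beta> m b - of_nat (k b)) = 0"
    by (rule vand_eq_0[OF assms(3-5)])
      (use assms(6) in \<open>simp only: z[OF assms(3)] z[OF assms(4)] e\<close>)
  then show False using v by simp
qed

text \<open>A nonzero Vandermonde product forces the exponents \<open>m b - k b\<close> to be
  distinct within each family. Their total is then at least the sum of the two binomials, which
  bounds the total of \<open>k\<close>.\<close>

lemma coeff_gdet_eq_0:
  assumes r: "r \<le> N" and K: "(\<Sum>b<N. m b) < K + ((r choose 2) + (N - r choose 2))"
  shows "coeff (gdet r N \<beta> m) K = 0"
  unfolding coeff_gdet
proof (intro sum.neutral ballI)
  fix k assume k: "k \<in> PiE {..<N} (\<lambda>b. {..m b})"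
  then have km: "k b \<le> m b" if "b < N" for b using that by auto
  show "(if (\<Sum>b<N. k b) = K then (\<Prod>b<N. lcoef (apar r \<beta> b) (m b) (k b)) * vand N (\<lambda>b. zpt r \<beta> m b - of_nat (k b)) else 0) = 0"
  proof (rule ccontr)
    assume "\<not> ?thesis"
    then have v: "vand N (\<lambda>b. zpt r \<beta> m b - of_nat (k b)) \<noteq> 0" and S: "(\<Sum>b<N. k b) = K"
      by (auto split: if_splits)
    have "card (same_pairs N (\<lambda>b. b < r)) \<le> 2 * (\<Sum>b<N. m b - k b)"
      by (rule card_same_pairs_le) (use gdet_vand_nonzero_inj[OF km v] in blast)
    moreover have "(\<Sum>b<N. m b - k b) + (\<Sum>b<N. k b) = (\<Sum>b<N. m b)"
      unfolding sum.distrib[symmetric] by (intro sum.cong refl) (use km in auto)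
    ultimately show False using K S unfolding card_same_pairs_blocks[OF r] by simp
  qed
qed

lemma degree_pochhammer_le:
  fixes p :: "'a::comm_ring_1 poly"
  assumes "degree p \<le> 1" shows "degree (pochhammer p k) \<le> k"
proof (induction k)
  case (Suc k)
  have "degree (p + of_nat k) \<le> 1" by (rule degree_add_le) (use assms in auto)
  then show ?case using Suc unfolding pochhammer_Suc
    by (metis degree_mult_le le_trans add_mono Suc_eq_plus1)
qed simp

lemma degree_lcoef_le:
  fixes p :: "'a::comm_ring_1 poly"
  assumes "degree p \<le> 1" shows "degree (lcoef p m k) \<le> k"
proof -
  have "degree (p + of_nat m - of_nat k + 1) \<le> 1"
    using assms by (intro degree_add_le degree_diff_le) auto
  then have "degree (pochhammer (p + of_nat m - of_nat k + 1) k) \<le> k" by (rule degree_pochhammer_le)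
  moreover have "lcoef p m k = smult ((-1) ^ k * of_nat (m choose k)) (pochhammer (p + of_nat m - of_nat k + 1) k)"
  proof -
    have "(-1) ^ k * of_nat (m choose k) = [:(-1) ^ k * of_nat (m choose k) :: 'a:]"
      by (cases "even k") (simp_all add: of_nat_poly)
    then show ?thesis by (simp add: lcoef_def)
  qed
  ultimately show ?thesis by (metis degree_smult_le le_trans)
qed

lemma degree_vand_shift_le:
  "degree (vand N (\<lambda>b. zpt r beta_poly m b - of_nat (k b))) \<le> (\<Sum>b<N. \<Sum>a<b. if a < r \<longleftrightarrow> b < r then 0 else 1)"
proof -
  let ?z = "\<lambda>b. zpt r beta_poly m b - of_nat (k b)"
  have "degree (?z b - ?z a) \<le> (if a < r \<longleftrightarrow> b < r then 0 else 1)" for a b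
    by (auto simp: zpt_def beta_poly_def of_nat_poly)
  then have "degree (\<Prod>a<b. ?z b - ?z a) \<le> (\<Sum>a<b. if a < r \<longleftrightarrow> b < r then 0 else 1)" for b
    by (intro order_trans[OF degree_prod_sum_le] sum_mono) auto
  then show ?thesis unfolding vand_def
    by (intro order_trans[OF degree_prod_sum_le] sum_mono) auto
qed

lemma vand_zpt_nonzero:
  assumes dist: "\<And>a b. a < b \<Longrightarrow> b < N \<Longrightarrow> (a < r \<longleftrightarrow> b < r) \<Longrightarrow> m a \<noteq> m b"
  shows "degree (vand N (zpt r beta_poly m)) = (\<Sum>b<N. \<Sum>a<b. if a < r \<longleftrightarrow> b < r then 0 else 1)"
    and "vand N (zpt r beta_poly m) \<noteq> 0"
proof -
  let ?z = "zpt r beta_poly m"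
  have nz: "?z b - ?z a \<noteq> 0" if "a < b" "b < N" for a b
  proof (cases "a < r \<longleftrightarrow> b < r")
    case True
    then have "of_nat (m b) - of_nat (m a) = ?z b - ?z a" by (auto simp: zpt_def)
    moreover have "(of_nat (m b) :: rat poly) \<noteq> of_nat (m a)" using dist[OF that True] by simp
    ultimately show ?thesis by (metis right_minus_eq)
  next
    case False
    then have "coeff (?z b - ?z a) 1 \<noteq> 0" using that by (auto simp: zpt_def beta_poly_def of_nat_poly)
    then show ?thesis by auto
  qed
  have d: "degree (?z b - ?z a) = (if a < r \<longleftrightarrow> b < r then 0 else 1)" if "a < b" for a b
    using that by (auto simp: zpt_def beta_poly_def of_nat_poly)
  have nz2: "(\<Prod>a<b. ?z b - ?z a) \<noteq> 0" if "b < N" for b using nz that by auto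
  then show "vand N ?z \<noteq> 0" unfolding vand_def by auto
  have "degree (\<Prod>a<b. ?z b - ?z a) = (\<Sum>a<b. if a < r \<longleftrightarrow> b < r then 0 else 1)" if "b < N" for b
    using nz that by (subst degree_prod_eq_sum_degree) (auto simp: d)
  then show "degree (vand N ?z) = (\<Sum>b<N. \<Sum>a<b. if a < r \<longleftrightarrow> b < r then 0 else 1)"
    unfolding vand_def using nz2 by (subst degree_prod_eq_sum_degree) auto
qed

text \<open>Each \<open>lcoef\<close> of index \<open>k\<close> has degree at most \<open>k\<close>
  in \<beta>, and a shifted Vandermonde product has degree at most the number of mixed pairs. The
  divisor has exactly that degree, so at most \<open>K\<close> remains for the quotient.\<close>

lemma degree_quotient_le:
  assumes dist: "\<And>a b. a < b \<Longrightarrow> b < N \<Longrightarrow> (a < r \<longleftrightarrow> b < r) \<Longrightarrow> m a \<noteq> m b"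
    and q: "gdet r N beta_poly m = [:vand N (zpt r beta_poly m):] * q"
  shows "degree (coeff q K) \<le> K"
proof (cases "coeff q K = 0")
  case False
  let ?\<beta> = beta_poly
  let ?D = "\<Sum>b<N. \<Sum>a<b. if a < r \<longleftrightarrow> b < r then 0 else 1 :: nat"
  have "degree (coeff (gdet r N ?\<beta> m) K) \<le> K + ?D"
    unfolding coeff_gdet
  proof (rule degree_sum_le)
    show "finite (PiE {..<N} (\<lambda>b. {..m b}))" by (intro finite_PiE) auto
    fix k
    have ap: "degree (apar r ?\<beta> b) \<le> 1" for b by (simp add: apar_def beta_poly_def)
    have "degree (\<Prod>b<N. lcoef (apar r ?\<beta> b) (m b) (k b)) \<le> (\<Sum>b<N. k b)"
      by (intro order_trans[OF degree_prod_sum_le] sum_mono) (use degree_lcoef_le[OF ap] in auto)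
    then have "degree ((\<Prod>b<N. lcoef (apar r ?\<beta> b) (m b) (k b)) * vand N (\<lambda>b. zpt r ?\<beta> m b - of_nat (k b))) \<le> (\<Sum>b<N. k b) + ?D"
      using degree_vand_shift_le[of N r m k] by (intro order_trans[OF degree_mult_le] add_mono)
    then show "degree (if (\<Sum>b<N. k b) = K then (\<Prod>b<N. lcoef (apar r ?\<beta> b) (m b) (k b)) * vand N (\<lambda>b. zpt r ?\<beta> m b - of_nat (k b)) else 0) \<le> K + ?D"
      by auto
  qed
  moreover have "coeff (gdet r N ?\<beta> m) K = vand N (zpt r ?\<beta> m) * coeff q K" unfolding q by simp
  moreover have "degree (vand N (zpt r ?\<beta> m) * coeff q K) = ?D + degree (coeff q K)"
    using vand_zpt_nonzero[OF dist] False by (simp add: degree_mult_eq)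
  ultimately show ?thesis by simp
qed simp

section \<open>The lowest coefficient as a product over the two families\<close>

lemma dt_block_diag:
  fixes f :: "nat \<Rightarrow> nat \<Rightarrow> 'a::idom"
  assumes "\<And>i j. (i < r \<longleftrightarrow> j < r) \<or> f i j = 0"
  shows "dt (r + s) f = dt r f * dt s (\<lambda>i j. f (r + i) (r + j))"
proof -
  let ?A = "mat r r (\<lambda>(i, j). f i j)" and ?B = "mat s s (\<lambda>(i, j). f (r + i) (r + j))"
  have "mat (r + s) (r + s) (\<lambda>(i, j). f i j) = four_block_mat ?A (0\<^sub>m r s) (0\<^sub>m s r) ?B"
  proof (rule eq_matI)
    fix i j assume "i < dim_row (four_block_mat ?A (0\<^sub>m r s) (0\<^sub>m s r) ?B)"
      "j < dim_col (four_block_mat ?A (0\<^sub>m r s) (0\<^sub>m s r) ?B)"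
    then have "i < r + s" "j < r + s" by auto
    then show "mat (r + s) (r + s) (\<lambda>(i, j). f i j) $$ (i, j) = four_block_mat ?A (0\<^sub>m r s) (0\<^sub>m s r) ?B $$ (i, j)"
      using assms[of i j] by (auto simp: index_mat_four_block)
  qed auto
  then show ?thesis unfolding dt_def
    by (simp only:) (rule det_four_block_mat_lower_left_zero[where n = r and m = s], auto)
qed

definition low_idx :: "nat \<Rightarrow> nat \<Rightarrow> nat" where
  "low_idx r i = (if i < r then i else i - r)"

text \<open>In the lowest coefficient only the exponents \<open>0, \<dots>, r - 1\<close> and \<open>0, \<dots>, s - 1\<close> survive, so the
  determinant factors as a Vandermonde matrix times a block diagonal matrix of coefficients.\<close>

lemma coeff_gdet_lowest:
  fixes \<beta> :: complex
  assumes K: "(\<Sum>b<r + s. m b) = K + ((r choose 2) + (s choose 2))"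
  shows "coeff (gdet r (r + s) \<beta> m) K = vand (r + s) (zpt r \<beta> (low_idx r)) *
     dt (r + s) (\<lambda>i b. if (i < r \<longleftrightarrow> b < r) \<and> low_idx r i \<le> m b
        then lcoef (apar r \<beta> b) (m b) (m b - low_idx r i) else 0)"
proof -
  let ?N = "r + s"
  define sz where "sz b = (if b < r then r else s)" for b
  define cf where "cf b \<mu> = (if \<mu> \<le> m b then lcoef (apar r \<beta> b) (m b) (m b - \<mu>) else 0)" for b \<mu>
  define pt where "pt b \<mu> = of_nat \<mu> - (if b < r then 0 else \<beta>)" for b \<mu>
  define T where "T \<mu> = (\<Prod>b<?N. cf b (\<mu> b)) * vand ?N (\<lambda>b. pt b (\<mu> b))" for \<mu>
  have inj: "inj_on \<mu> {..<r} \<and> inj_on \<mu> {r..<?N}" if "T \<mu> \<noteq> 0" for \<mu>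
  proof -
    have "\<mu> a \<noteq> \<mu> b" if "a < ?N" "b < ?N" "a \<noteq> b" "a < r \<longleftrightarrow> b < r" for a b
    proof
      assume "\<mu> a = \<mu> b"
      then have "vand ?N (\<lambda>b. pt b (\<mu> b)) = 0"
        using that by (intro vand_eq_0[of a _ b]) (auto simp: pt_def)
      then show False using \<open>T \<mu> \<noteq> 0\<close> by (simp add: T_def)
    qed
    then show ?thesis by (auto simp: inj_on_def) (metis trans_less_add1 | metis not_less)+
  qed
  have split: "(\<Sum>b<?N. \<mu> b) = (\<Sum>b<r. \<mu> b) + (\<Sum>b=r..<?N. \<mu> b)" for \<mu> :: "nat \<Rightarrow> nat"
    by (metis atLeast0LessThan le_add1 sum.atLeastLessThan_concat zero_le)
  let ?M = "PiE {..<?N} (\<lambda>b. {..m b})" and ?L = "PiE {..<?N} (\<lambda>b. {..<sz b})"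
  have "coeff (gdet r ?N \<beta> m) K = (\<Sum>k\<in>?M. if (\<Sum>b<?N. k b) = K then
     (\<Prod>b<?N. lcoef (apar r \<beta> b) (m b) (k b)) * vand ?N (\<lambda>b. zpt r \<beta> m b - of_nat (k b)) else 0)"
    by (rule coeff_gdet)
  \<comment> \<open>Reindexing by the surviving exponents \<open>\<mu> = m - k\<close> turns the
    condition on the degree into minimality of the total of \<open>\<mu>\<close>.\<close>
  also have "\<dots> = (\<Sum>\<mu>\<in>?M. if (\<Sum>b<?N. \<mu> b) = (r choose 2) + (s choose 2) then T \<mu> else 0)"
  proof (rule sum.reindex_bij_witness[where i = "\<lambda>\<mu>. \<lambda>b\<in>{..<?N}. m b - \<mu> b" and j = "\<lambda>k. \<lambda>b\<in>{..<?N}. m b - k b"])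
    fix k assume k: "k \<in> ?M"
    show "(\<lambda>b\<in>{..<?N}. m b - (\<lambda>b\<in>{..<?N}. m b - k b) b) = k"
      by (rule restrict_diff_diff[OF k])
    show "(\<lambda>b\<in>{..<?N}. m b - k b) \<in> ?M" by auto
    have km: "k b \<le> m b" if "b < ?N" for b using k that by auto
    have s: "(\<Sum>b<?N. (\<lambda>b\<in>{..<?N}. m b - k b) b) + (\<Sum>b<?N. k b) = (\<Sum>b<?N. m b)"
      unfolding sum.distrib[symmetric] by (intro sum.cong refl) (use km in auto)
    have iff: "(\<Sum>b<?N. (\<lambda>b\<in>{..<?N}. m b - k b) b) = (r choose 2) + (s choose 2) \<longleftrightarrow> (\<Sum>b<?N. k b) = K"
      using s K by linarith
    have "(\<Prod>b<?N. lcoef (apar r \<beta> b) (m b) (k b)) = (\<Prod>b<?N. cf b ((\<lambda>b\<in>{..<?N}. m b - k b) b))"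
      by (intro prod.cong refl) (use km in \<open>auto simp: cf_def\<close>)
    moreover have "vand ?N (\<lambda>b. zpt r \<beta> m b - of_nat (k b)) = vand ?N (\<lambda>b. pt b ((\<lambda>b\<in>{..<?N}. m b - k b) b))"
      by (rule vand_cong) (use km in \<open>auto simp: zpt_def pt_def of_nat_diff\<close>)
    ultimately show "(if (\<Sum>b<?N. (\<lambda>b\<in>{..<?N}. m b - k b) b) = (r choose 2) + (s choose 2) then T (\<lambda>b\<in>{..<?N}. m b - k b) else 0)
      = (if (\<Sum>b<?N. k b) = K then (\<Prod>b<?N. lcoef (apar r \<beta> b) (m b) (k b)) * vand ?N (\<lambda>b. zpt r \<beta> m b - of_nat (k b)) else 0)"
      unfolding iff T_def by (simp only:)
  next
    fix k assume k: "k \<in> ?M"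
    show "(\<lambda>b\<in>{..<?N}. m b - (\<lambda>b\<in>{..<?N}. m b - k b) b) = k"
      by (rule restrict_diff_diff[OF k])
    show "(\<lambda>b\<in>{..<?N}. m b - k b) \<in> ?M" by auto
  qed
  also have "\<dots> = (\<Sum>\<mu>\<in>?M \<inter> ?L. T \<mu>)"
  proof (rule sum.mono_neutral_cong_right)
    show "finite ?M" by (intro finite_PiE) auto
    show "?M \<inter> ?L \<subseteq> ?M" by auto
    show "\<forall>\<mu>\<in>?M - ?M \<inter> ?L. (if (\<Sum>b<?N. \<mu> b) = (r choose 2) + (s choose 2) then T \<mu> else 0) = 0"
    proof (intro ballI, rule ccontr)
      fix \<mu> assume \<mu>: "\<mu> \<in> ?M - ?M \<inter> ?L" and "(if (\<Sum>b<?N. \<mu> b) = (r choose 2) + (s choose 2) then T \<mu> else 0) \<noteq> 0"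
      then have S: "(\<Sum>b<?N. \<mu> b) = (r choose 2) + (s choose 2)" and T: "T \<mu> \<noteq> 0" by (auto split: if_splits)
      note i = inj[OF T]
      have 1: "r choose 2 \<le> (\<Sum>b<r. \<mu> b)" using sum_inj_nat_ge[of "{..<r}" \<mu>] i by simp
      have 2: "s choose 2 \<le> (\<Sum>b=r..<?N. \<mu> b)" using sum_inj_nat_ge[of "{r..<?N}" \<mu>] i by simp
      have "\<mu> b < r" if "b < r" for b
        using sum_inj_nat_minimal[of "{..<r}" \<mu> b] i 2 S split[of \<mu>] that by simp
      moreover have "\<mu> b < s" if "r \<le> b" "b < ?N" for b
        using sum_inj_nat_minimal[of "{r..<?N}" \<mu> b] i 1 S split[of \<mu>] that by simp
      ultimately have "\<mu> \<in> ?L" using \<mu> by (auto simp: PiE_def Pi_def sz_def)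
      then show False using \<mu> by blast
    qed
    fix \<mu> assume \<mu>: "\<mu> \<in> ?M \<inter> ?L"
    show "(if (\<Sum>b<?N. \<mu> b) = (r choose 2) + (s choose 2) then T \<mu> else 0) = T \<mu>"
    proof (cases "T \<mu> = 0")
      case False
      note i = inj[OF False]
      have img: "f ` A = {..<card A}" if "finite A" "inj_on f A" "\<And>a. a \<in> A \<Longrightarrow> f a < card A" for f :: "nat \<Rightarrow> nat" and A
        by (rule card_subset_eq) (use that in \<open>auto simp: card_image\<close>)
      have s: "(\<Sum>a\<in>A. f a) = (card A choose 2)" if "finite A" "inj_on f A" "\<And>a. a \<in> A \<Longrightarrow> f a < card A" for f :: "nat \<Rightarrow> nat" and A
        using sum.reindex[OF that(2), of "\<lambda>x. x"] img[OF that] sum_lessThan_eq_choose_two by simp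
      have lt: "\<mu> b < sz b" if "b < ?N" for b using \<mu> that by (auto dest: PiE_mem)
      have lt1: "\<mu> b < r" if "b < r" for b using lt[of b] that by (simp add: sz_def)
      have lt2: "\<mu> b < s" if "r \<le> b" "b < ?N" for b using lt[of b] that by (simp add: sz_def)
      have "(\<Sum>b\<in>{..<r}. \<mu> b) = (card {..<r} choose 2)"
        by (rule s) (use i lt1 lt2 in auto)
      moreover have "(\<Sum>b\<in>{r..<?N}. \<mu> b) = (card {r..<?N} choose 2)"
        by (rule s) (use i lt1 lt2 in auto)
      ultimately show ?thesis by (simp add: split)
    qed simp
  qed
  \<comment> \<open>The range may be enlarged because \<open>cf\<close> vanishes above
    \<open>m b\<close>. It then depends only on the block, and the sum folds back into one
    determinant.\<close>
  also have "\<dots> = (\<Sum>\<mu>\<in>?L. T \<mu>)"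
  proof (rule sum.mono_neutral_left)
    show "finite ?L" by (intro finite_PiE) auto
    show "\<forall>\<mu>\<in>?L - ?M \<inter> ?L. T \<mu> = 0"
    proof
      fix \<mu> assume \<mu>: "\<mu> \<in> ?L - ?M \<inter> ?L"
      then obtain b where b: "b < ?N" "\<not> \<mu> b \<le> m b" by (auto simp: PiE_def Pi_def)
      then have "(\<Prod>b<?N. cf b (\<mu> b)) = 0" by (subst prod.remove[of _ b]) (auto simp: cf_def)
      then show "T \<mu> = 0" by (simp add: T_def)
    qed
  qed auto
  also have "\<dots> = dt ?N (\<lambda>a b. \<Sum>\<mu><sz b. cf b \<mu> * pt b \<mu> ^ a)"
    unfolding T_def by (rule dt_sum_powers[symmetric]) simp
  also have "\<dots> = dt ?N (\<lambda>a b. \<Sum>i<?N. zpt r \<beta> (low_idx r) i ^ a *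
      (if (i < r \<longleftrightarrow> b < r) then cf b (low_idx r i) else 0))"
  proof (rule dt_cong)
    fix a b assume b: "b < ?N"
    let ?f = "\<lambda>i. zpt r \<beta> (low_idx r) i ^ a * (if (i < r \<longleftrightarrow> b < r) then cf b (low_idx r i) else 0)"
    have sp: "(\<Sum>i<?N. ?f i) = (\<Sum>i<r. ?f i) + (\<Sum>j<s. ?f (r + j))"
      by (rule sum_lessThan_add)
    show "(\<Sum>\<mu><sz b. cf b \<mu> * pt b \<mu> ^ a) = (\<Sum>i<?N. ?f i)"
      unfolding sp by (cases "b < r") (auto simp: sz_def pt_def zpt_def low_idx_def mult.commute)
  qed
  also have "\<dots> = dt ?N (\<lambda>a i. zpt r \<beta> (low_idx r) i ^ a) *
     dt ?N (\<lambda>i b. if (i < r \<longleftrightarrow> b < r) then cf b (low_idx r i) else 0)"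
    by (rule dt_mat_mult)
  finally show ?thesis unfolding vandermonde cf_def
    by (simp only:) (intro arg_cong2[of _ _ _ _ "(*)"] refl dt_cong, auto)
qed

lemma vand_translate: "vand n (\<lambda>i. z i - c) = vand n z"
  by (simp add: vand_def)

text \<open>Separation of variables: a factor depending on \<open>m\<close>, a factor depending on
  \<open>\<mu>\<close>, and \<open>ffall m \<mu>\<close>, monic of degree \<open>\<mu>\<close> in
  \<open>m\<close>. Once the first two are pulled out of columns and rows, each block is a
  Vandermonde determinant.\<close>

lemma lcoef_complement:
  fixes \<alpha> :: complex
  assumes "pochhammer (\<alpha> + 1) \<mu> \<noteq> 0"
  shows "(if \<mu> \<le> m then lcoef \<alpha> m (m - \<mu>) else 0) =
    ((-1) ^ m * pochhammer (\<alpha> + 1) m) * ((-1) ^ \<mu> / (fact \<mu> * pochhammer (\<alpha> + 1) \<mu>) * ffall (of_nat m) \<mu>)"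
proof (cases "\<mu> \<le> m")
  case True
  have "pochhammer (\<alpha> + of_nat m - of_nat (m - \<mu>) + 1) (m - \<mu>) = pochhammer (\<alpha> + 1) m / pochhammer (\<alpha> + 1) \<mu>"
    using assms pochhammer_product[OF True, of "\<alpha> + 1"] True by (simp add: of_nat_diff add_ac)
  moreover have "(-1) ^ (m - \<mu>) = ((-1) ^ m * (-1) ^ \<mu> :: complex)"
    using True by (simp add: minus_one_power_iff)
  moreover have "of_nat (m choose (m - \<mu>)) = ffall (of_nat m) \<mu> / (fact \<mu> :: complex)"
    unfolding ffall_of_nat using binomial_symmetric[OF True] by simp
  ultimately show ?thesis using True unfolding lcoef_def by simp
next
  case False
  then have "ffall (of_nat m) \<mu> = (0 :: complex)" unfolding ffall_of_nat by (simp add: binomial_eq_0)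
  then show ?thesis using False by simp
qed

lemma gdet_lowest_quotient:
  fixes \<beta> :: complex
  assumes K: "(\<Sum>b<r + s. m b) = K + ((r choose 2) + (s choose 2))"
    and p: "\<And>i. i < r \<Longrightarrow> pochhammer (\<beta> + 1) i \<noteq> 0" "\<And>j. j < s \<Longrightarrow> pochhammer (- \<beta> + 1) j \<noteq> 0"
    and nz: "\<And>i j. i < r \<Longrightarrow> j < s \<Longrightarrow> of_nat (m (r + j)) - of_nat (m i) - \<beta> \<noteq> 0"
  shows "coeff (gdet r (r + s) \<beta> m) K = vand (r + s) (zpt r \<beta> m) * ((-1) ^ K *
     (\<Prod>i<r. pochhammer (\<beta> + 1) (m i) / pochhammer (\<beta> + 1) i) *
     (\<Prod>j<s. pochhammer (- \<beta> + 1) (m (r + j)) / pochhammer (- \<beta> + 1) j) *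
     (\<Prod>j<s. \<Prod>i<r. (of_nat j - of_nat i - \<beta>) / (of_nat (m (r + j)) - of_nat (m i) - \<beta>)))"
proof -
  let ?N = "r + s"
  define colf where "colf b = (-1) ^ m b * pochhammer (apar r \<beta> b + 1) (m b)" for b
  define rowf where "rowf i = (-1) ^ low_idx r i / (fact (low_idx r i) * pochhammer (apar r \<beta> i + 1) (low_idx r i))" for i
  have "dt ?N (\<lambda>i b. if (i < r \<longleftrightarrow> b < r) \<and> low_idx r i \<le> m b then lcoef (apar r \<beta> b) (m b) (m b - low_idx r i) else 0)
     = dt ?N (\<lambda>i b. colf b * (rowf i * (if i < r \<longleftrightarrow> b < r then ffall (of_nat (m b)) (low_idx r i) else 0)))"
  proof (rule dt_cong)
    fix i b assume i: "i < ?N"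
    have nz: "pochhammer (apar r \<beta> i + 1) (low_idx r i) \<noteq> 0" using p i by (auto simp: apar_def low_idx_def)
    show "(if (i < r \<longleftrightarrow> b < r) \<and> low_idx r i \<le> m b then lcoef (apar r \<beta> b) (m b) (m b - low_idx r i) else 0)
      = colf b * (rowf i * (if i < r \<longleftrightarrow> b < r then ffall (of_nat (m b)) (low_idx r i) else 0))"
    proof (cases "i < r \<longleftrightarrow> b < r")
      case True
      then have "apar r \<beta> i = apar r \<beta> b" by (simp add: apar_def)
      then show ?thesis using lcoef_complement[OF nz, of "m b"] True
        by (simp only: colf_def rowf_def simp_thms if_True)
    next
      case False
      then show ?thesis by (simp only: simp_thms if_False mult_zero_right)
    qed
  qed
  also have "\<dots> = (\<Prod>b<?N. colf b) * ((\<Prod>i<?N. rowf i) * dt ?N (\<lambda>i b. if i < r \<longleftrightarrow> b < r then ffall (of_nat (m b)) (low_idx r i) else 0))"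
    unfolding dt_mult_cols dt_mult_rows ..
  also have "dt ?N (\<lambda>i b. if i < r \<longleftrightarrow> b < r then ffall (of_nat (m b)) (low_idx r i) else 0 :: complex)
     = vand r (\<lambda>b. of_nat (m b)) * vand s (\<lambda>b. of_nat (m (r + b)))"
  proof -
    have "dt ?N (\<lambda>i b. if i < r \<longleftrightarrow> b < r then ffall (of_nat (m b)) (low_idx r i) else 0 :: complex)
      = dt r (\<lambda>i b. if i < r \<longleftrightarrow> b < r then ffall (of_nat (m b)) (low_idx r i) else 0) *
        dt s (\<lambda>i b. if r + i < r \<longleftrightarrow> r + b < r then ffall (of_nat (m (r + b))) (low_idx r (r + i)) else 0)"
      by (rule dt_block_diag) auto
    also have "dt r (\<lambda>i b. if i < r \<longleftrightarrow> b < r then ffall (of_nat (m b)) (low_idx r i) else 0 :: complex)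
       = dt r (\<lambda>i b. ffall (of_nat (m b)) i)" by (rule dt_cong) (simp add: low_idx_def)
    also have "dt s (\<lambda>i b. if r + i < r \<longleftrightarrow> r + b < r then ffall (of_nat (m (r + b))) (low_idx r (r + i)) else 0 :: complex)
       = dt s (\<lambda>i b. ffall (of_nat (m (r + b))) i)" by (rule dt_cong) (simp add: low_idx_def)
    finally show ?thesis unfolding dt_ffall .
  qed
  finally have B: "dt ?N (\<lambda>i b. if (i < r \<longleftrightarrow> b < r) \<and> low_idx r i \<le> m b then lcoef (apar r \<beta> b) (m b) (m b - low_idx r i) else 0)
     = (\<Prod>b<?N. colf b) * ((\<Prod>i<?N. rowf i) * (vand r (\<lambda>b. of_nat (m b)) * vand s (\<lambda>b. of_nat (m (r + b)))))" .
  \<comment> \<open>The cross-block part of the Vandermonde product. The in-block part at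
    \<open>m\<close> is reproduced by the block determinants, and the one at
    \<open>low_idx r\<close>, a product of factorials, cancels against the row factors; only the
    ratio of two values of \<open>X\<close> remains.\<close>
  define X where "X f = (\<Prod>j<s. \<Prod>i<r. of_nat (f (r + j)) - of_nat (f i) - \<beta>)" for f :: "nat \<Rightarrow> nat"
  have V: "vand ?N (zpt r \<beta> f) = vand r (\<lambda>b. of_nat (f b)) * vand s (\<lambda>b. of_nat (f (r + b))) * X f" for f
  proof -
    have "vand r (zpt r \<beta> f) = vand r (\<lambda>b. of_nat (f b))" by (rule vand_cong) (simp add: zpt_def)
    moreover have "vand s (\<lambda>j. zpt r \<beta> f (r + j)) = vand s (\<lambda>b. of_nat (f (r + b)))"
      using vand_translate[of s "\<lambda>b. of_nat (f (r + b))" \<beta>] by (simp add: zpt_def)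
    moreover have "(\<Prod>j<s. \<Prod>i<r. zpt r \<beta> f (r + j) - zpt r \<beta> f i) = X f"
      unfolding X_def by (intro prod.cong refl) (simp add: zpt_def)
    ultimately show ?thesis unfolding vand_split by simp
  qed
  have Vl: "vand ?N (zpt r \<beta> (low_idx r)) = (\<Prod>i<r. fact i) * (\<Prod>j<s. fact j) * X (low_idx r)"
  proof -
    have "vand r (\<lambda>b. of_nat (low_idx r b)) = (vand r of_nat :: complex)" by (rule vand_cong) (simp add: low_idx_def)
    moreover have "vand s (\<lambda>b. of_nat (low_idx r (r + b))) = (vand s of_nat :: complex)" by (rule vand_cong) (simp add: low_idx_def)
    ultimately show ?thesis unfolding V using vand_of_nat[of r, where ?'a = complex] vand_of_nat[of s, where ?'a = complex] by simp
  qed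
  have X0: "X m \<noteq> 0" unfolding X_def using nz by auto
  have Xq: "X (low_idx r) / X m = (\<Prod>j<s. \<Prod>i<r. (of_nat j - of_nat i - \<beta>) / (of_nat (m (r + j)) - of_nat (m i) - \<beta>))"
    unfolding X_def prod_dividef[symmetric] by (intro prod.cong refl) (simp add: low_idx_def)
  have cs: "(\<Prod>b<?N. colf b) = (-1) ^ (\<Sum>b<?N. m b) * ((\<Prod>i<r. pochhammer (\<beta> + 1) (m i)) * (\<Prod>j<s. pochhammer (- \<beta> + 1) (m (r + j))))"
  proof -
    have "(\<Prod>b<?N. colf b) = (-1) ^ (\<Sum>b<?N. m b) * (\<Prod>b<?N. pochhammer (apar r \<beta> b + 1) (m b))"
      unfolding colf_def prod.distrib power_sum ..
    also have "(\<Prod>b<?N. pochhammer (apar r \<beta> b + 1) (m b)) = (\<Prod>i<r. pochhammer (\<beta> + 1) (m i)) * (\<Prod>j<s. pochhammer (- \<beta> + 1) (m (r + j)))"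
      unfolding prod_lessThan_add by (simp add: apar_def)
    finally show ?thesis .
  qed
  have rs: "(\<Prod>i<?N. rowf i) * ((\<Prod>i<r. fact i) * (\<Prod>j<s. fact j)) = (-1) ^ ((r choose 2) + (s choose 2)) /
     ((\<Prod>i<r. pochhammer (\<beta> + 1) i) * (\<Prod>j<s. pochhammer (- \<beta> + 1) j))"
  proof -
    have "(\<Prod>i<?N. rowf i) = (\<Prod>i<r. (-1) ^ i / (fact i * pochhammer (\<beta> + 1) i)) * (\<Prod>j<s. (-1) ^ j / (fact j * pochhammer (- \<beta> + 1) j))"
      unfolding prod_lessThan_add by (simp add: rowf_def apar_def low_idx_def)
    also have "\<dots> = (-1) ^ (r choose 2) / ((\<Prod>i<r. fact i) * (\<Prod>i<r. pochhammer (\<beta> + 1) i)) *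
       ((-1) ^ (s choose 2) / ((\<Prod>j<s. fact j) * (\<Prod>j<s. pochhammer (- \<beta> + 1) j)))"
      unfolding prod_dividef prod.distrib power_sum[symmetric] sum_lessThan_eq_choose_two ..
    finally show ?thesis by (simp add: power_add prod_zero_iff)
  qed
  have sg: "(-1) ^ (\<Sum>b<?N. m b) * (-1) ^ ((r choose 2) + (s choose 2)) = ((-1) ^ K :: complex)"
    unfolding K power_add by (simp add: power_mult_distrib[symmetric] mult.assoc minus_one_power_iff)
  let ?A = "\<Prod>i<r. pochhammer (\<beta> + 1) (m i)" and ?B = "\<Prod>j<s. pochhammer (- \<beta> + 1) (m (r + j))"
  let ?C = "\<Prod>i<r. pochhammer (\<beta> + 1) i" and ?D = "\<Prod>j<s. pochhammer (- \<beta> + 1) j"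
  let ?W = "vand r (\<lambda>b. of_nat (m b)) * vand s (\<lambda>b. of_nat (m (r + b))) :: complex"
  have "coeff (gdet r ?N \<beta> m) K = ((\<Prod>i<r. fact i) * (\<Prod>j<s. fact j) * X (low_idx r)) * ((\<Prod>b<?N. colf b) * ((\<Prod>i<?N. rowf i) * ?W))"
    unfolding coeff_gdet_lowest[OF K] Vl B ..
  also have "\<dots> = (?W * X (low_idx r)) * (\<Prod>b<?N. colf b) * ((\<Prod>i<?N. rowf i) * ((\<Prod>i<r. fact i) * (\<Prod>j<s. fact j)))"
    by (simp only: mult_ac)
  also have "\<dots> = (?W * X m) * (X (low_idx r) / X m) * ((-1) ^ (\<Sum>b<?N. m b) * (-1) ^ ((r choose 2) + (s choose 2))) * ((?A / ?C) * (?B / ?D))"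
    unfolding cs rs using X0 by simp
  also have "\<dots> = vand ?N (zpt r \<beta> m) * ((-1) ^ K * (?A / ?C) * (?B / ?D) * (X (low_idx r) / X m))"
    unfolding sg V by (simp only: mult_ac)
  finally show ?thesis unfolding Xq prod_dividef .
qed

lemma prod_descending_pochhammer:
  "(\<Prod>j=1..n. z + of_nat n - of_nat j) = pochhammer (z::complex) n"
proof (induction n arbitrary: z)
  case (Suc n)
  have "(\<Prod>j=1..Suc n. z + of_nat (Suc n) - of_nat j) = (\<Prod>j=1..n. (z + 1) + of_nat n - of_nat j) * z"
    by (simp add: algebra_simps)
  then show ?case unfolding Suc by (simp add: pochhammer_rec mult.commute)
qed simp

text \<open>Rewrites Pochhammer symbols of possibly negative index as quotients of ordinary ones.
  Nonvanishing at the larger of \<open>m\<close> and \<open>i\<close> implies it at the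
  smaller.\<close>

lemma gpoch_quotient:
  assumes "pochhammer z (max m i) \<noteq> 0"
  shows "gpoch (z + of_nat i) (int m - int i) = pochhammer z m / pochhammer z i"
proof (cases "i \<le> m")
  case True
  then have "pochhammer z m = pochhammer z i * pochhammer (z + of_nat i) (m - i)" by (rule pochhammer_product)
  moreover from this have "pochhammer z i \<noteq> 0" using assms True by (auto simp: max_def)
  moreover have "nat (int m - int i) = m - i" by simp
  ultimately show ?thesis using True by (simp add: gpoch_def)
next
  case False
  then have mi: "m \<le> i" by simp
  have p: "pochhammer z i = pochhammer z m * pochhammer (z + of_nat m) (i - m)" by (rule pochhammer_product[OF mi])
  then have nz: "pochhammer z m \<noteq> 0" "pochhammer (z + of_nat m) (i - m) \<noteq> 0" using assms mi by (auto simp: max_def)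
  have n: "nat (- (int m - int i)) = i - m" by simp
  have "(\<Prod>j=1..i - m. z + of_nat i - of_nat j) = pochhammer (z + of_nat m) (i - m)"
    using prod_descending_pochhammer[of "z + of_nat m" "i - m"] mi by (simp add: of_nat_diff add_ac)
  then show ?thesis using False nz unfolding gpoch_def n p by simp
qed

subsection \<open>The Wronskian\<close>

text \<open>A shape preserved by differentiation on the positive axis: the exponent of
  \<open>x\<close> drops by one and \<open>P\<close> is replaced by \<open>gstep\<close>.\<close>

definition gpow :: "complex \<Rightarrow> complex poly \<Rightarrow> real \<Rightarrow> complex" where
  "gpow \<gamma> P x = exp (- complex_of_real (x^2) / 2) * complex_of_real x powr \<gamma> * poly P (complex_of_real (x^2))"

definition gstep :: "complex \<Rightarrow> complex poly \<Rightarrow> complex poly" where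
  "gstep \<gamma> P = smult \<gamma> P + [:0, 2:] * pderiv P - [:0, 1:] * P"

lemma gpow_has_vector_derivative:
  assumes x: "x > 0"
  shows "(gpow \<gamma> P has_vector_derivative gpow (\<gamma> - 1) (gstep \<gamma> P) x) (at x)"
proof -
  let ?w = "complex_of_real x"
  let ?f = "\<lambda>w. exp (- (w^2) / 2) * w powr \<gamma> * poly P (w^2)"
  have w: "?w \<notin> \<real>\<^sub>\<le>\<^sub>0" using x by simp
  have w0: "?w \<noteq> 0" using x by simp
  have pw: "?w powr \<gamma> = ?w * ?w powr (\<gamma> - 1)"
    using w0 by (simp add: powr_diff)
  have dp: "((\<lambda>w. poly P (w^2)) has_field_derivative poly (pderiv P) (?w^2) * (2 * ?w)) (at ?w)"
    by (rule DERIV_chain2[OF poly_DERIV]) (auto intro!: derivative_eq_intros)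
  have de: "((\<lambda>w. exp (- (w^2) / 2)) has_field_derivative exp (- (?w^2) / 2) * (- ?w)) (at ?w)"
    by (auto intro!: derivative_eq_intros)
  have "(?f has_field_derivative
      (exp (- (?w^2) / 2) * (- ?w) * ?w powr \<gamma> + \<gamma> * ?w powr (\<gamma> - 1) * exp (- (?w^2) / 2)) * poly P (?w^2)
       + poly (pderiv P) (?w^2) * (2 * ?w) * (exp (- (?w^2) / 2) * ?w powr \<gamma>)) (at ?w)"
    by (rule DERIV_mult[OF DERIV_mult[OF de has_field_derivative_powr[OF w]] dp])
  also have "(exp (- (?w^2) / 2) * (- ?w) * ?w powr \<gamma> + \<gamma> * ?w powr (\<gamma> - 1) * exp (- (?w^2) / 2)) * poly P (?w^2)
       + poly (pderiv P) (?w^2) * (2 * ?w) * (exp (- (?w^2) / 2) * ?w powr \<gamma>) = gpow (\<gamma> - 1) (gstep \<gamma> P) x"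
    unfolding pw by (simp add: gpow_def gstep_def algebra_simps power2_eq_square)
  finally have "((\<lambda>x. ?f (complex_of_real x)) has_vector_derivative gpow (\<gamma> - 1) (gstep \<gamma> P) x) (at x)"
    by (rule has_vector_derivative_real_field)
  moreover have "(\<lambda>x. ?f (complex_of_real x)) = gpow \<gamma> P" by (rule ext) (simp add: gpow_def)
  ultimately show ?thesis by simp
qed

fun giter :: "complex \<Rightarrow> complex poly \<Rightarrow> nat \<Rightarrow> complex poly" where
  "giter \<gamma> P 0 = P"
| "giter \<gamma> P (Suc k) = gstep (\<gamma> - of_nat k) (giter \<gamma> P k)"

lemma nderiv_gpow:
  "x > 0 \<Longrightarrow> nderiv k (gpow \<gamma> P) x = gpow (\<gamma> - of_nat k) (giter \<gamma> P k) x"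
proof (induction k arbitrary: x)
  case (Suc k)
  have "(gpow (\<gamma> - of_nat k) (giter \<gamma> P k) has_vector_derivative
      gpow (\<gamma> - of_nat k - 1) (gstep (\<gamma> - of_nat k) (giter \<gamma> P k)) x) (at x)"
    by (rule gpow_has_vector_derivative[OF Suc.prems])
  then have "(nderiv k (gpow \<gamma> P) has_vector_derivative
      gpow (\<gamma> - of_nat k - 1) (gstep (\<gamma> - of_nat k) (giter \<gamma> P k)) x) (at x)"
    by (rule has_vector_derivative_transform_within_open[where S = "{0<..}"]) (use Suc in auto)
  then have "vector_derivative (nderiv k (gpow \<gamma> P)) (at x) = gpow (\<gamma> - of_nat k - 1) (gstep (\<gamma> - of_nat k) (giter \<gamma> P k)) x"
    by (rule vector_derivative_at)
  then show ?case by (simp add: nderiv_def algebra_simps)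
qed (simp add: nderiv_def)

text \<open>The operator \<open>\<gamma> + 2 y d/dy\<close> applied \<open>t\<close> times to
  \<open>P\<close>. It is \<open>x d/dx\<close> acting on \<open>x^\<gamma> P(x^2)\<close>, and it
  is diagonal on monomials.\<close>

definition euler_pow :: "complex \<Rightarrow> complex poly \<Rightarrow> nat \<Rightarrow> complex poly" where
  "euler_pow \<gamma> P t = (\<Sum>i\<le>degree P. monom (coeff P i * (\<gamma> + 2 * of_nat i) ^ t) i)"

lemma coeff_euler_pow: "coeff (euler_pow \<gamma> P t) i = coeff P i * (\<gamma> + 2 * of_nat i) ^ t"
  by (auto simp: euler_pow_def coeff_sum coeff_eq_0)

lemma euler_pow_Suc: "smult \<gamma> (euler_pow \<gamma> P t) + [:0, 2:] * pderiv (euler_pow \<gamma> P t) = euler_pow \<gamma> P (Suc t)"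
proof (rule poly_eqI)
  fix i
  show "coeff (smult \<gamma> (euler_pow \<gamma> P t) + [:0, 2:] * pderiv (euler_pow \<gamma> P t)) i = coeff (euler_pow \<gamma> P (Suc t)) i"
    by (cases i) (simp_all add: coeff_euler_pow coeff_pderiv algebra_simps)
qed

lemma euler_pow_0: "euler_pow \<gamma> P 0 = P"
  by (rule poly_eqI) (simp add: coeff_euler_pow)

text \<open>One differentiation acts as \<open>\<theta> - a - y\<close> with
  \<open>\<theta> = \<gamma> + 2 y d/dy\<close>. On a product of a coefficient and an Euler power,
  \<theta> raises the Euler power and adds \<open>2 y d/dy\<close> of the coefficient. Neither
  \<gamma> nor \<open>P\<close> occurs in the result, so one unitriangular matrix serves all columns
  of the Wronskian.\<close>

fun wtri :: "nat \<Rightarrow> nat \<Rightarrow> complex poly" where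
  "wtri 0 t = (if t = 0 then 1 else 0)"
| "wtri (Suc a) t = (if t = 0 then 0 else wtri a (t - 1)) +
     ([:0, 2:] * pderiv (wtri a t) - smult (of_nat a) (wtri a t) - [:0, 1:] * wtri a t)"

lemma wtri_eq_0: "a < t \<Longrightarrow> wtri a t = 0"
  by (induction a arbitrary: t) auto

lemma wtri_diag: "wtri a a = 1"
  by (induction a) (auto simp: wtri_eq_0)

lemma giter_wtri: "giter \<gamma> P a = (\<Sum>t\<le>a. wtri a t * euler_pow \<gamma> P t)"
proof (induction a)
  case 0
  show ?case by (simp add: euler_pow_0)
next
  case (Suc a)
  let ?S = "euler_pow \<gamma> P"
  let ?c = "\<lambda>t. [:0, 2:] * pderiv (wtri a t) - smult (of_nat a) (wtri a t) - [:0, 1:] * wtri a t"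
  define X1 X2 where "X1 = [:0, 1::complex:]" and "X2 = [:0, 2::complex:]"
  have gs: "gstep g p = smult g p + X2 * pderiv p - X1 * p" for g p
    by (simp only: gstep_def X1_def X2_def)
  have step_sum: "gstep g (\<Sum>t\<in>A. f t) = (\<Sum>t\<in>A. gstep g (f t))" for g f and A :: "nat set"
    by (induction A rule: infinite_finite_induct)
      (auto simp: gs pderiv_add smult_add_right algebra_simps)
  have st: "gstep (\<gamma> - of_nat a) (wtri a t * ?S t) = wtri a t * ?S (Suc t) + ?c t * ?S t" for t
    unfolding euler_pow_Suc[symmetric] gs pderiv_mult X1_def[symmetric] X2_def[symmetric]
    by (simp add: algebra_simps smult_diff_left)
  have "giter \<gamma> P (Suc a) = (\<Sum>t\<le>a. wtri a t * ?S (Suc t)) + (\<Sum>t\<le>a. ?c t * ?S t)"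
    unfolding giter.simps Suc step_sum st sum.distrib ..
  also have "(\<Sum>t\<le>a. wtri a t * ?S (Suc t)) = (\<Sum>t\<le>Suc a. (if t = 0 then 0 else wtri a (t - 1)) * ?S t)"
    by (subst sum.atMost_Suc_shift) simp
  also have "(\<Sum>t\<le>a. ?c t * ?S t) = (\<Sum>t\<le>Suc a. ?c t * ?S t)"
    by (simp add: wtri_eq_0)
  finally show ?case by (simp only: wtri.simps distrib_right sum.distrib)
qed

lemma wronskian_gpow:
  assumes x: "x > 0"
  shows "dt N (\<lambda>a b. nderiv a (gpow (\<gamma> b) (P b)) x) =
     (\<Prod>b<N. exp (- complex_of_real (x^2) / 2) * complex_of_real x powr \<gamma> b) * (\<Prod>a<N. 1 / complex_of_real x ^ a) *
     dt N (\<lambda>t b. poly (euler_pow (\<gamma> b) (P b) t) (complex_of_real (x^2)))"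
proof -
  let ?y = "complex_of_real (x^2)"
  have "nderiv a (gpow (\<gamma> b) (P b)) x = (exp (- ?y / 2) * complex_of_real x powr \<gamma> b) *
     (1 / complex_of_real x ^ a * (\<Sum>t<N. poly (wtri a t) ?y * poly (euler_pow (\<gamma> b) (P b) t) ?y))" if "a < N" for a b
  proof -
    have "(\<Sum>t\<le>a. poly (wtri a t) ?y * poly (euler_pow (\<gamma> b) (P b) t) ?y) = (\<Sum>t<N. poly (wtri a t) ?y * poly (euler_pow (\<gamma> b) (P b) t) ?y)"
      by (rule sum.mono_neutral_left) (use that in \<open>auto simp: wtri_eq_0\<close>)
    then have "poly (giter (\<gamma> b) (P b) a) ?y = (\<Sum>t<N. poly (wtri a t) ?y * poly (euler_pow (\<gamma> b) (P b) t) ?y)"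
      by (simp add: giter_wtri poly_sum)
    moreover have "complex_of_real x powr (\<gamma> b - of_nat a) = complex_of_real x powr \<gamma> b * (1 / complex_of_real x ^ a)"
      using x by (simp add: powr_diff powr_nat')
    ultimately show ?thesis unfolding nderiv_gpow[OF x] gpow_def by (simp only: mult.assoc)
  qed
  then have "dt N (\<lambda>a b. nderiv a (gpow (\<gamma> b) (P b)) x) = dt N (\<lambda>a b. (exp (- ?y / 2) * complex_of_real x powr \<gamma> b) *
     (1 / complex_of_real x ^ a * (\<Sum>t<N. poly (wtri a t) ?y * poly (euler_pow (\<gamma> b) (P b) t) ?y)))"
    by (intro dt_cong)
  also have "\<dots> = (\<Prod>b<N. exp (- ?y / 2) * complex_of_real x powr \<gamma> b) * ((\<Prod>a<N. 1 / complex_of_real x ^ a) *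
      (dt N (\<lambda>a t. poly (wtri a t) ?y) * dt N (\<lambda>t b. poly (euler_pow (\<gamma> b) (P b) t) ?y)))"
    unfolding dt_mult_cols dt_mult_rows dt_mat_mult ..
  also have "dt N (\<lambda>a t. poly (wtri a t) ?y) = 1"
    by (subst dt_lower_triangular) (auto simp: wtri_eq_0 wtri_diag)
  finally show ?thesis by (simp add: mult.assoc)
qed

subsection \<open>The Wronskian as a generating determinant\<close>

lemma choose2_of_nat: "of_nat (n choose 2) = of_nat n * (of_nat n - 1) / (2::complex)"
  using ffall_of_nat[of n 2, where ?'a = complex] by (simp add: ffall_def numeral_2_eq_2)

lemma choose3_of_nat: "of_nat (n choose 3) = of_nat n * (of_nat n - 1) * (of_nat n - 2) / (6::complex)"
  using ffall_of_nat[of n 3, where ?'a = complex] by (simp add: ffall_def numeral_3_eq_3 fact_numeral)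

lemma sum_list_powers: "of_nat (sum_list (map (\<lambda>m. m ^ k) ms)) = (\<Sum>i<length ms. of_nat (ms ! i) ^ k :: complex)"
  by (simp add: sum_list_sum_nth atLeast0LessThan)

lemma psum_zpt:
  fixes \<beta> :: complex and ms ns :: "nat list"
  defines "A \<equiv> \<lambda>k. of_nat (sum_list (map (\<lambda>m. m ^ k) ms))"
    and "B \<equiv> \<lambda>k. of_nat (sum_list (map (\<lambda>m. m ^ k) ns))"
    and "z \<equiv> zpt (length ms) \<beta> (\<lambda>b. (ms @ ns) ! b)" and "N \<equiv> length ms + length ns"
    and "s \<equiv> of_nat (length ns)"
  shows "psum N z 1 = A 1 + B 1 - s * \<beta>" "psum N z 2 = A 2 + B 2 - 2 * \<beta> * B 1 + s * \<beta>^2"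
    "psum N z 3 = A 3 + B 3 - 3 * \<beta> * B 2 + 3 * \<beta>^2 * B 1 - s * \<beta>^3"
proof -
  have p: "psum N z k = A k + (\<Sum>j<length ns. (of_nat (ns ! j) - \<beta>) ^ k)" for k
    unfolding psum_def N_def sum_lessThan_add A_def z_def sum_list_powers
    by (auto simp: zpt_def nth_append intro!: arg_cong2[of _ _ _ _ "(+)"] sum.cong)
  have e1: "(\<Sum>j<length ns. (of_nat (ns ! j) - \<beta>) ^ 1) = B 1 - s * \<beta>"
    unfolding B_def sum_list_powers s_def by (simp add: sum_subtractf)
  have e2: "(\<Sum>j<length ns. (of_nat (ns ! j) - \<beta>) ^ 2) = B 2 - 2 * \<beta> * B 1 + s * \<beta>^2"
    unfolding B_def sum_list_powers s_def
    by (simp add: power2_diff sum_subtractf sum.distrib sum_distrib_left algebra_simps)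
  have "(x - \<beta>) ^ 3 = x ^ 3 - 3 * \<beta> * x ^ 2 + 3 * \<beta>^2 * x - \<beta>^3" for x :: complex
    by (simp add: power3_eq_cube power2_eq_square algebra_simps)
  then have e3: "(\<Sum>j<length ns. (of_nat (ns ! j) - \<beta>) ^ 3) = B 3 - 3 * \<beta> * B 2 + 3 * \<beta>^2 * B 1 - s * \<beta>^3"
    unfolding B_def sum_list_powers s_def
    by (simp add: sum_subtractf sum.distrib sum_distrib_left)
  show "psum N z 1 = A 1 + B 1 - s * \<beta>" "psum N z 2 = A 2 + B 2 - 2 * \<beta> * B 1 + s * \<beta>^2"
    "psum N z 3 = A 3 + B 3 - 3 * \<beta> * B 2 + 3 * \<beta>^2 * B 1 - s * \<beta>^3"
    unfolding p e1 e2 e3 by simp_all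
qed

lemma phi_dm1_vshift:
  "phi_dm1_formula ms ns \<beta> = - vshift (length ms + length ns) \<beta> (zpt (length ms) \<beta> (\<lambda>b. (ms @ ns) ! b))"
  unfolding phi_dm1_formula_def Let_def rho_plus_def rho_minus_def vshift_def pfclosed_def psum_zpt
    choose2_of_nat choose3_of_nat of_nat_add
  by (simp add: field_simps power2_eq_square)

text \<open>Comparison of powers of \<beta>: the cubic terms of \<open>S3\<close> and
  \<open>\<beta> * S2\<close> cancel, and the remaining three coefficients are the identities
  \<open>0\<close>, \<open>1\<close> and \<open>2\<close>. The sums and differences
  \<open>a\<close>, \<open>b\<close>, \<open>c\<close>, \<open>e\<close>, \<open>D\<close> keep each
  of them small.\<close>

lemma phi_dm2_algebra:
  fixes N s \<beta> A1 A2 A3 B1 B2 B3 :: complex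
  defines "r \<equiv> N - s"
  defines "p1 \<equiv> A1 + B1 - s * \<beta>" and "p2 \<equiv> A2 + B2 - 2 * \<beta> * B1 + s * \<beta>^2"
    and "p3 \<equiv> A3 + B3 - 3 * \<beta> * B2 + 3 * \<beta>^2 * B1 - s * \<beta>^3"
    and "R \<equiv> r * (r - 1) / 2" and "S \<equiv> s * (s - 1) / 2"
  defines "S1 \<equiv> p1 - N * (N - 1) / 2" and "S2 \<equiv> p2 - (N - 1) * p1 + N * (N - 1) * (N - 2) / 6"
    and "S3 \<equiv> p3 - (N - 1) * p2 - (p1^2 - p2) / 2 + (N - 1) * (N - 2) / 2 * p1
        - N * (N - 1) * (N - 2) * (N - 3) / 24"
  defines "E \<equiv> S2 + \<beta> * S1"
  shows "2 * ((A2 + B2)^2 / 2 - (A3 + B3) - (N - 1) * (A2 + B2) * (A1 + B1) + (N - 1) * (N^2 - 2*N + 9) / 6 * (A2 + B2)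
       + (N^2 - 2*N + 2) / 2 * (A1 + B1)^2
       - (N - 1)^2 * (N^2 - 2*N + 6) / 6 * (A1 + B1)
       + N * (N - 1)^2 * (N - 2) * (N^2 - 2*N + 9) / 72
     + \<beta> * ((A2 + B2) * (A1 - B1) - 3/2 * (A2 - B2) - (N - 1) * ((A1 + B1) * (A1 - B1) + (r - s) / 2 * (A2 + B2))
            + (N^2 - 2*N + 2) * (r - s) / 2 * (A1 + B1)
            + (N - 1) * (N^2 - 2*N + 9) / 6 * (A1 - B1)
            - (N^2 - 2*N + 6) * (N - 1)^2 * (r - s) / 12)
     + \<beta>^2 * ((A1 - B1)^2 / 2 - (A1 + B1) / 2 - (R - S) * (A1 - B1) + (R * (R + 1) + S * (S + 1)) / 2 - R * S))
    = (E + N - \<beta>) * E - 2 * (S3 + \<beta> * S2)"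
proof -
  define a where "a = A1 + B1"
  define b where "b = A2 + B2"
  define c where "c = A1 - B1"
  define D where "D = r - s"
  have RS: "R - S = (N - 1) * D / 2" "R + S = (N^2 + D^2 - 2 * N) / 4"
    unfolding R_def S_def D_def r_def by (simp_all add: field_simps power2_eq_square)
  have RR: "(R * (R + 1) + S * (S + 1)) / 2 - R * S = ((R - S)^2 + (R + S)) / 2"
    by (simp add: field_simps power2_eq_square)
  have E: "E = b + \<beta> * c - (N - 1) * a + N * (N - 1) * (N - 2) / 6 - \<beta> * (N - 1) * D / 2"
    unfolding E_def S2_def S1_def p1_def p2_def a_def b_def c_def D_def r_def
    by (simp add: field_simps power2_eq_square)
  have s: "s = (N - D) / 2" unfolding D_def r_def by simp
  have T: "S3 + \<beta> * S2 = (A3 + B3) - (N - 1) * b + (b - a^2) / 2 + (N - 1) * (N - 2) / 2 * a - N * (N - 1) * (N - 2) * (N - 3) / 24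
     + \<beta> * (b - 3 * B2 + 2 * (N - 1) * B1 - B1 + a * s - (N - 1) * (N - 2) / 2 * s - (N - 1) * a + N * (N - 1) * (N - 2) / 6)
     + \<beta>^2 * (3 * B1 - (N - 1) * s + s / 2 - s^2 / 2 - 2 * B1 + (N - 1) * s)"
    unfolding S3_def S2_def p1_def p2_def p3_def a_def b_def
    by (simp add: field_simps power2_eq_square power3_eq_cube)
  define e where "e = A2 - B2"
  have B1: "B1 = (a - c) / 2" and B2: "B2 = (b - e) / 2"
    unfolding a_def b_def c_def e_def by simp_all
  define E0 E1 T0 T1 T2 where "E0 = b - (N - 1) * a + N * (N - 1) * (N - 2) / 6"
    and "E1 = c - (N - 1) * D / 2"
    and "T0 = (A3 + B3) - (N - 1) * b + (b - a^2) / 2 + (N - 1) * (N - 2) / 2 * a - N * (N - 1) * (N - 2) * (N - 3) / 24"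
    and "T1 = b - 3 * B2 + 2 * (N - 1) * B1 - B1 + a * s - (N - 1) * (N - 2) / 2 * s - (N - 1) * a + N * (N - 1) * (N - 2) / 6"
    and "T2 = B1 + s / 2 - s^2 / 2"
  have E': "E = E0 + \<beta> * E1" unfolding E E0_def E1_def by (simp add: algebra_simps)
  have T': "S3 + \<beta> * S2 = T0 + \<beta> * T1 + \<beta>^2 * T2" unfolding T T0_def T1_def T2_def by (simp add: algebra_simps)
  have 0: "2 * (b^2 / 2 - (A3 + B3) - (N - 1) * b * a + (N - 1) * (N^2 - 2*N + 9) / 6 * b
       + (N^2 - 2*N + 2) / 2 * a^2 - (N - 1)^2 * (N^2 - 2*N + 6) / 6 * a
       + N * (N - 1)^2 * (N - 2) * (N^2 - 2*N + 9) / 72) = (E0 + N) * E0 - 2 * T0"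
    unfolding E0_def T0_def by (simp add: field_simps power2_eq_square)
  have 1: "2 * (b * c - 3/2 * e - (N - 1) * (a * c + D / 2 * b) + (N^2 - 2*N + 2) * D / 2 * a
       + (N - 1) * (N^2 - 2*N + 9) / 6 * c - (N^2 - 2*N + 6) * (N - 1)^2 * D / 12)
     = E1 * (E0 + N) + (E1 - 1) * E0 - 2 * T1"
    unfolding E0_def E1_def T1_def B1 B2 s by (simp add: field_simps power2_eq_square)
  have 2: "2 * (c^2 / 2 - a / 2 - (N - 1) * D / 2 * c + (((N - 1) * D / 2)^2 + (N^2 + D^2 - 2 * N) / 4) / 2)
     = (E1 - 1) * E1 - 2 * T2"
    unfolding E1_def T2_def B1 s by (simp add: field_simps power2_eq_square)
  have "c^2 / 2 - a / 2 - (R - S) * c + (R * (R + 1) + S * (S + 1)) / 2 - R * S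
     = c^2 / 2 - a / 2 - (R - S) * c + ((R * (R + 1) + S * (S + 1)) / 2 - R * S)" by simp
  then have 3: "c^2 / 2 - a / 2 - (R - S) * c + (R * (R + 1) + S * (S + 1)) / 2 - R * S
     = c^2 / 2 - a / 2 - (N - 1) * D / 2 * c + (((N - 1) * D / 2)^2 + (N^2 + D^2 - 2 * N) / 4) / 2"
    unfolding RR RS .
  have 4: "2 * (x + \<beta> * y + \<beta>^2 * w) = 2 * x + \<beta> * (2 * y) + \<beta>^2 * (2 * w)" for x y w
    by (simp add: distrib_left)
  have "(E + N - \<beta>) * E - 2 * (S3 + \<beta> * S2) = ((E0 + N) * E0 - 2 * T0)
      + \<beta> * (E1 * (E0 + N) + (E1 - 1) * E0 - 2 * T1) + \<beta>^2 * ((E1 - 1) * E1 - 2 * T2)"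
    unfolding E' T' by (simp add: algebra_simps power2_eq_square)
  then show ?thesis
    unfolding a_def[symmetric] b_def[symmetric] c_def[symmetric] D_def[symmetric] e_def[symmetric] 3 4 0 1 2
    by (rule sym)
qed

lemma phi_dm2_vshift:
  fixes \<beta> :: complex and ms ns :: "nat list"
  defines "z \<equiv> zpt (length ms) \<beta> (\<lambda>b. (ms @ ns) ! b)" and "N \<equiv> length ms + length ns"
  shows "2 * phi_dm2_formula ms ns \<beta> = (vshift N \<beta> z + of_nat N - \<beta>) * vshift N \<beta> z
      - 2 * (pfclosed N z 3 + \<beta> * pfclosed N z 2)"
proof -
  let ?A = "\<lambda>k. of_nat (sum_list (map (\<lambda>m. m ^ k) ms)) :: complex"
  let ?B = "\<lambda>k. of_nat (sum_list (map (\<lambda>m. m ^ k) ns)) :: complex"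
  have r: "of_nat (length ms) = of_nat N - (of_nat (length ns) :: complex)" by (simp add: N_def)
  have rs: "of_int (int (length ms) - int (length ns)) = of_nat N - of_nat (length ns) - (of_nat (length ns) :: complex)"
    by (simp add: N_def)
  note ps = psum_zpt[of ms ns \<beta>, folded z_def N_def]
  have k: "pfclosed N z 1 = psum N z 1 - of_nat N * (of_nat N - 1) / 2"
    "pfclosed N z 2 = psum N z 2 - (of_nat N - 1) * psum N z 1 + of_nat N * (of_nat N - 1) * (of_nat N - 2) / 6"
    "pfclosed N z 3 = psum N z 3 - (of_nat N - 1) * psum N z 2 - ((psum N z 1)^2 - psum N z 2) / 2
      + (of_nat N - 1) * (of_nat N - 2) / 2 * psum N z 1 - of_nat N * (of_nat N - 1) * (of_nat N - 2) * (of_nat N - 3) / 24"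
    by (simp_all add: pfclosed_def Let_def)
  show ?thesis
    unfolding phi_dm2_formula_def Let_def rho_plus_def rho_minus_def vshift_def k ps N_def[symmetric]
      choose2_of_nat r rs of_nat_add[of "sum_list _" "sum_list _"]
    by (rule phi_dm2_algebra)
qed

section \<open>Assembling the Wronskian\<close>

definition lagp :: "complex \<Rightarrow> nat \<Rightarrow> complex poly" where
  "lagp \<alpha> n = (\<Sum>i\<le>n. monom (lcoef \<alpha> n (n - i)) i)"

lemma coeff_lagp: "coeff (lagp \<alpha> n) i = (if i \<le> n then lcoef \<alpha> n (n - i) else 0)"
  by (simp add: lagp_def coeff_sum)

lemma laguerre_hat_lagp: "laguerre_hat n \<alpha> y = poly (lagp \<alpha> n) y"
proof -
  have "(-1) ^ (n + i) * of_nat (n choose i) * pochhammer (\<alpha> + of_nat i + 1) (n - i) = lcoef \<alpha> n (n - i)" if "i \<le> n" for i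
    using that binomial_symmetric[OF that] by (simp add: lcoef_def of_nat_diff minus_one_power_iff)
  then show ?thesis unfolding laguerre_hat_def lagp_def poly_sum poly_monom
    by (simp add: atLeast0AtMost)
qed

lemma wr_fun_gpow:
  assumes "b < length ms + length ns"
  shows "wr_fun \<beta> ms ns b = gpow (1/2 + apar (length ms) \<beta> b) (lagp (apar (length ms) \<beta> b) ((ms @ ns) ! b))"
  by (rule ext) (simp add: wr_fun_def psi_plus_def psi_minus_def gpow_def apar_def nth_append laguerre_hat_lagp)

lemma poly_euler_pow_lagp:
  "poly (euler_pow \<gamma> (lagp \<alpha> n) t) y = (\<Sum>k\<le>n. lcoef \<alpha> n k * y ^ (n - k) * (\<gamma> + 2 * of_nat (n - k)) ^ t)"
proof -
  have "euler_pow \<gamma> (lagp \<alpha> n) t = (\<Sum>i\<le>n. monom (lcoef \<alpha> n (n - i) * (\<gamma> + 2 * of_nat i) ^ t) i)"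
    by (rule poly_eqI) (simp add: coeff_euler_pow coeff_lagp coeff_sum)
  then have "poly (euler_pow \<gamma> (lagp \<alpha> n) t) y = (\<Sum>i\<le>n. lcoef \<alpha> n (n - i) * (\<gamma> + 2 * of_nat i) ^ t * y ^ i)"
    by (simp add: poly_sum poly_monom)
  also have "\<dots> = (\<Sum>k\<le>n. lcoef \<alpha> n k * y ^ (n - k) * (\<gamma> + 2 * of_nat (n - k)) ^ t)"
    by (rule sum.reindex_bij_witness[of _ "\<lambda>k. n - k" "\<lambda>k. n - k"]) auto
  finally show ?thesis .
qed

lemma vand_affine: "vand N (\<lambda>b. a * f b + c) = (\<Prod>j<N. \<Prod>i<j. a) * vand N f"
  unfolding vand_def prod.distrib[symmetric] by (simp add: algebra_simps)

lemma kappa_vand: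
  "kappa \<beta> ms ns = (\<Prod>j<length ms + length ns. \<Prod>i<j. 2) *
     vand (length ms + length ns) (zpt (length ms) \<beta> (\<lambda>b. (ms @ ns) ! b))"
proof -
  let ?N = "length ms + length ns" and ?z = "zpt (length ms) \<beta> (\<lambda>b. (ms @ ns) ! b)"
  let ?v = "map (\<lambda>m. 2 * of_nat m + \<beta>) ms @ map (\<lambda>n. 2 * of_nat n - \<beta>) ns"
  have "?v ! b = 2 * ?z b + \<beta>" if "b < ?N" for b
    using that by (simp add: nth_append zpt_def algebra_simps)
  then have "vand ?N (\<lambda>b. ?v ! b) = vand ?N (\<lambda>b. 2 * ?z b + \<beta>)" by (rule vand_cong)
  then show ?thesis unfolding kappa_def Delta_def vand_affine by (simp add: vand_def)
qed

text \<open>The nodes are \<open>2 (z - k) + c\<close>. The translation drops out of all differences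
  and the scaling gives a factor 2 per pair; the same powers of 2 occur in
  \<open>kappa\<close>.\<close>

lemma dt_euler_gdet:
  fixes y \<beta> c :: complex
  assumes y: "y \<noteq> 0"
  shows "dt N (\<lambda>t b. \<Sum>k\<le>m b. lcoef (apar r \<beta> b) (m b) k * y ^ (m b - k) * (2 * (zpt r \<beta> m b - of_nat k) + c) ^ t)
     = (\<Prod>j<N. \<Prod>i<j. 2) * y ^ (\<Sum>b<N. m b) * poly (gdet r N \<beta> m) (1 / y)"
proof -
  let ?P = "PiE {..<N} (\<lambda>b. {..m b})"
  have "dt N (\<lambda>t b. \<Sum>k\<le>m b. lcoef (apar r \<beta> b) (m b) k * y ^ (m b - k) * (2 * (zpt r \<beta> m b - of_nat k) + c) ^ t)
    = (\<Sum>k\<in>?P. (\<Prod>b<N. lcoef (apar r \<beta> b) (m b) (k b) * y ^ (m b - k b)) * vand N (\<lambda>b. 2 * (zpt r \<beta> m b - of_nat (k b)) + c))"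
    by (rule dt_sum_powers) simp
  also have "\<dots> = (\<Sum>k\<in>?P. (\<Prod>j<N. \<Prod>i<j. 2) * y ^ (\<Sum>b<N. m b) * ((\<Prod>b<N. lcoef (apar r \<beta> b) (m b) (k b)) *
      vand N (\<lambda>b. zpt r \<beta> m b - of_nat (k b)) * (1 / y) ^ (\<Sum>b<N. k b)))"
  proof (rule sum.cong[OF refl])
    fix k assume k: "k \<in> ?P"
    have km: "k b \<le> m b" if "b < N" for b using k that by auto
    have "(\<Prod>b<N. y ^ (m b - k b)) = (\<Prod>b<N. y ^ m b * (1 / y) ^ k b)"
      by (intro prod.cong refl) (use km y in \<open>auto simp: power_diff power_one_over field_simps\<close>)
    also have "\<dots> = y ^ (\<Sum>b<N. m b) * (1 / y) ^ (\<Sum>b<N. k b)" unfolding prod.distrib power_sum ..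
    finally have e: "(\<Prod>b<N. y ^ (m b - k b)) = y ^ (\<Sum>b<N. m b) * (1 / y) ^ (\<Sum>b<N. k b)" .
    show "(\<Prod>b<N. lcoef (apar r \<beta> b) (m b) (k b) * y ^ (m b - k b)) * vand N (\<lambda>b. 2 * (zpt r \<beta> m b - of_nat (k b)) + c)
      = (\<Prod>j<N. \<Prod>i<j. 2) * y ^ (\<Sum>b<N. m b) * ((\<Prod>b<N. lcoef (apar r \<beta> b) (m b) (k b)) *
      vand N (\<lambda>b. zpt r \<beta> m b - of_nat (k b)) * (1 / y) ^ (\<Sum>b<N. k b))"
      unfolding prod.distrib e vand_affine by (simp only: mult_ac)
  qed
  also have "\<dots> = (\<Prod>j<N. \<Prod>i<j. 2) * y ^ (\<Sum>b<N. m b) * poly (gdet r N \<beta> m) (1 / y)"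
    unfolding gdet_expand poly_sum poly_monom by (simp only: sum_distrib_left)
  finally show ?thesis .
qed

lemma Psi_gdet:
  fixes ms ns :: "nat list"
  defines "r \<equiv> length ms" and "N \<equiv> length ms + length ns" and "m \<equiv> \<lambda>b. (ms @ ns) ! b"
  assumes x: "x > 0"
  shows "Psi \<beta> ms ns x = (\<Prod>b<N. exp (- complex_of_real (x^2) / 2) * complex_of_real x powr (1/2 + apar r \<beta> b)) *
     (\<Prod>a<N. 1 / complex_of_real x ^ a) *
     ((\<Prod>j<N. \<Prod>i<j. 2) * complex_of_real (x^2) ^ (\<Sum>b<N. m b) * poly (gdet r N \<beta> m) (1 / complex_of_real (x^2)))"
proof -
  let ?y = "complex_of_real (x^2)"
  have y: "?y \<noteq> 0" using x by simp
  have "Psi \<beta> ms ns x = dt N (\<lambda>a b. nderiv a (wr_fun \<beta> ms ns b) x)"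
    unfolding Psi_def Let_def dt_def N_def ..
  also have "\<dots> = dt N (\<lambda>a b. nderiv a (gpow (1/2 + apar r \<beta> b) (lagp (apar r \<beta> b) (m b))) x)"
    by (rule dt_cong) (simp only: wr_fun_gpow N_def r_def m_def)
  also have "\<dots> = (\<Prod>b<N. exp (- ?y / 2) * complex_of_real x powr (1/2 + apar r \<beta> b)) * (\<Prod>a<N. 1 / complex_of_real x ^ a) *
     dt N (\<lambda>t b. poly (euler_pow (1/2 + apar r \<beta> b) (lagp (apar r \<beta> b) (m b)) t) ?y)"
    by (rule wronskian_gpow[OF x])
  also have "dt N (\<lambda>t b. poly (euler_pow (1/2 + apar r \<beta> b) (lagp (apar r \<beta> b) (m b)) t) ?y)
     = dt N (\<lambda>t b. \<Sum>k\<le>m b. lcoef (apar r \<beta> b) (m b) k * ?y ^ (m b - k) * (2 * (zpt r \<beta> m b - of_nat k) + (1/2 + \<beta>)) ^ t)"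
    unfolding poly_euler_pow_lagp
  proof (intro dt_cong sum.cong refl)
    fix t b k assume "k \<in> {..m b}"
    \<comment> \<open>For the second family, \<open>1/2 - \<beta> + 2 (n - k)\<close> equals
      \<open>2 (n - \<beta> - k) + 1/2 + \<beta>\<close>, so both families share the translation
      \<open>1/2 + \<beta>\<close>.\<close>
    then have "1/2 + apar r \<beta> b + 2 * of_nat (m b - k) = 2 * (zpt r \<beta> m b - of_nat k) + (1/2 + \<beta>)"
      by (simp add: apar_def zpt_def of_nat_diff algebra_simps)
    then show "lcoef (apar r \<beta> b) (m b) k * ?y ^ (m b - k) * (1/2 + apar r \<beta> b + 2 * of_nat (m b - k)) ^ t
       = lcoef (apar r \<beta> b) (m b) k * ?y ^ (m b - k) * (2 * (zpt r \<beta> m b - of_nat k) + (1/2 + \<beta>)) ^ t"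
      by (simp only:)
  qed
  finally show ?thesis unfolding dt_euler_gdet[OF y] .
qed

text \<open>The exponents of \<open>x\<close> add up to \<open>N/2 + \<beta> (r - s) - N (N - 1) / 2
  + r (r - 1) + s (s - 1)\<close>, whose part free of \<beta> collapses to
  \<open>(r - s)^2 / 2\<close>. The last two terms are the power of \<open>x^2\<close> left after
  \<open>d\<close> factors have gone into the polynomial.\<close>

lemma prefactor:
  fixes r s :: nat
  assumes x: "x > (0::real)"
  defines "N \<equiv> r + s"
  shows "(\<Prod>b<N. exp (- complex_of_real (x^2) / 2) * complex_of_real x powr (1/2 + apar r \<beta> b)) *
     (\<Prod>a<N. 1 / complex_of_real x ^ a) * complex_of_real (x^2) ^ ((r choose 2) + (s choose 2))
    = exp (- of_nat N * complex_of_real (x^2) / 2) * complex_of_real x powr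
        (of_int ((int r - int s)^2) / 2 + \<beta> * of_int (int r - int s))"
proof -
  let ?x = "complex_of_real x"
  have x0: "?x \<noteq> 0" using x by simp
  have "(\<Prod>b<N. exp (- complex_of_real (x^2) / 2)) = exp (- of_nat N * complex_of_real (x^2) / 2)"
    by (simp flip: exp_of_nat_mult)
  moreover have "(\<Prod>b<N. ?x powr (1/2 + apar r \<beta> b)) = ?x powr (\<Sum>b<N. 1/2 + apar r \<beta> b)"
    using x0 by (simp add: powr_sum)
  moreover have "(\<Sum>b<N. 1/2 + apar r \<beta> b) = of_nat N / 2 + \<beta> * (of_nat r - of_nat s)"
    unfolding N_def sum_lessThan_add by (simp add: apar_def algebra_simps sum.distrib)
  moreover have "(\<Prod>a<N. 1 / ?x ^ a) = ?x powr (- of_nat (N choose 2))"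
  proof -
    have "(\<Prod>a<N. 1 / ?x ^ a) = 1 / ?x ^ (N choose 2)"
      unfolding prod_dividef power_sum[symmetric] sum_lessThan_eq_choose_two by simp
    then show ?thesis using x0 by (simp add: powr_minus powr_nat' inverse_eq_divide)
  qed
  moreover have "complex_of_real (x^2) ^ k = ?x powr (of_nat (2 * k))" for k
  proof -
    have "complex_of_real (x^2) ^ k = ?x ^ (2 * k)" by (simp add: power_mult)
    also have "\<dots> = ?x powr (of_nat (2 * k))" by (rule powr_nat'[symmetric]) (use x0 in simp)
    finally show ?thesis .
  qed
  ultimately have "(\<Prod>b<N. exp (- complex_of_real (x^2) / 2) * ?x powr (1/2 + apar r \<beta> b)) *
     (\<Prod>a<N. 1 / ?x ^ a) * complex_of_real (x^2) ^ ((r choose 2) + (s choose 2))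
    = exp (- of_nat N * complex_of_real (x^2) / 2) * (?x powr (of_nat N / 2 + \<beta> * (of_nat r - of_nat s)) *
       ?x powr (- of_nat (N choose 2)) * ?x powr (of_nat (2 * ((r choose 2) + (s choose 2)))))"
    unfolding prod.distrib by (simp only: mult.assoc)
  also have "\<dots> = exp (- of_nat N * complex_of_real (x^2) / 2) * ?x powr (of_nat N / 2 + \<beta> * (of_nat r - of_nat s)
      + (- of_nat (N choose 2)) + of_nat (2 * ((r choose 2) + (s choose 2))))"
    by (simp only: powr_add)
  also have "of_nat N / 2 + \<beta> * (of_nat r - of_nat s) + (- of_nat (N choose 2)) + of_nat (2 * ((r choose 2) + (s choose 2)))
     = of_int ((int r - int s)^2) / 2 + \<beta> * (of_int (int r - int s))"
    unfolding of_nat_mult of_nat_add choose2_of_nat N_def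
    by (simp add: field_simps power2_eq_square)
  finally show ?thesis .
qed

section \<open>Specialising beta and passing to integer coefficients\<close>

definition evc :: "complex \<Rightarrow> rat poly \<Rightarrow> complex" where
  "evc \<beta> p = poly (map_poly of_rat p) \<beta>"

lemma evc_hom: "comm_ring_hom (evc \<beta>)"
proof
  have "map_poly of_rat (p + q) = map_poly of_rat p + map_poly (of_rat :: rat \<Rightarrow> complex) q" for p q
    by (rule poly_eqI) (simp add: coeff_map_poly of_rat_add)
  then show "evc \<beta> (p + q) = evc \<beta> p + evc \<beta> q" for p q by (simp add: evc_def)
  have "map_poly of_rat (p * q) = map_poly of_rat p * map_poly (of_rat :: rat \<Rightarrow> complex) q" for p q
    by (rule poly_eqI) (simp add: coeff_map_poly coeff_mult of_rat_sum of_rat_mult)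
  then show "evc \<beta> (p * q) = evc \<beta> p * evc \<beta> q" for p q by (simp add: evc_def)
qed (simp_all add: evc_def)

lemma evc_beta: "evc \<beta> beta_poly = \<beta>"
  by (simp add: evc_def beta_poly_def map_poly_pCons)

text \<open>Applied to polynomials with integral coefficients, where rounding is exact and only
  changes the type.\<close>

definition to_int_poly :: "rat poly \<Rightarrow> int poly" where
  "to_int_poly p = map_poly floor p"

lemma coeff_to_int_poly: "coeff (to_int_poly p) i = \<lfloor>coeff p i\<rfloor>"
  by (simp add: to_int_poly_def coeff_map_poly)

lemma poly_to_int_poly:
  assumes "\<And>i. coeff p i \<in> \<int>"
  shows "poly (map_poly of_int (to_int_poly p)) \<beta> = evc \<beta> p"
proof -
  have "map_poly of_int (to_int_poly p) = map_poly (of_rat :: rat \<Rightarrow> complex) p"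
  proof (rule poly_eqI)
    fix i
    obtain n where "coeff p i = of_int n" using assms[of i] by (auto elim: Ints_cases)
    then show "coeff (map_poly of_int (to_int_poly p)) i = coeff (map_poly (of_rat :: rat \<Rightarrow> complex) p) i"
      by (simp add: coeff_map_poly coeff_to_int_poly)
  qed
  then show ?thesis by (simp add: evc_def)
qed

lemma degree_to_int_poly: "degree (to_int_poly p) \<le> degree p"
  by (rule degree_le) (simp add: coeff_to_int_poly coeff_eq_0)

lemma phi0_formula_eq:
  fixes ms ns :: "nat list"
  defines "r \<equiv> length ms" and "s \<equiv> length ns" and "m \<equiv> \<lambda>b. (ms @ ns) ! b"
  assumes p: "\<And>k. k \<le> B \<Longrightarrow> pochhammer (\<beta> + 1) k \<noteq> 0" "\<And>k. k \<le> B \<Longrightarrow> pochhammer (- \<beta> + 1) k \<noteq> 0"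
    and B: "\<And>b. b < r + s \<Longrightarrow> m b \<le> B" "r + s \<le> B"
  shows "phi0_formula ms ns \<beta> = (-1) ^ deg_d ms ns *
     (\<Prod>i<r. pochhammer (\<beta> + 1) (m i) / pochhammer (\<beta> + 1) i) *
     (\<Prod>j<s. pochhammer (- \<beta> + 1) (m (r + j)) / pochhammer (- \<beta> + 1) j) *
     (\<Prod>j<s. \<Prod>i<r. (of_nat j - of_nat i - \<beta>) / (of_nat (m (r + j)) - of_nat (m i) - \<beta>))"
proof -
  have mi: "m i = ms ! i" if "i < r" for i using that by (simp add: m_def r_def nth_append)
  have mj: "m (r + j) = ns ! j" for j by (simp add: m_def r_def nth_append)
  have 1: "(\<Prod>i=1..r. gpoch (\<beta> + of_nat i) (int (ms ! (i - 1)) + 1 - int i)) =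
     (\<Prod>i<r. pochhammer (\<beta> + 1) (m i) / pochhammer (\<beta> + 1) i)"
    unfolding One_nat_def prod.atLeast1_atMost_eq
  proof (intro prod.cong refl)
    fix i assume i: "i \<in> {..<r}"
    have "gpoch (\<beta> + 1 + of_nat i) (int (m i) - int i) = pochhammer (\<beta> + 1) (m i) / pochhammer (\<beta> + 1) i"
      by (rule gpoch_quotient, rule p(1)) (use B(1)[of i] B(2) i in auto)
    then show "gpoch (\<beta> + of_nat (Suc i)) (int (ms ! (Suc i - Suc 0)) + 1 - int (Suc i)) = pochhammer (\<beta> + 1) (m i) / pochhammer (\<beta> + 1) i"
      using mi[of i] i by (simp add: add_ac)
  qed
  have 2: "(\<Prod>j=1..s. gpoch (- \<beta> + of_nat j) (int (ns ! (j - 1)) + 1 - int j)) =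
     (\<Prod>j<s. pochhammer (- \<beta> + 1) (m (r + j)) / pochhammer (- \<beta> + 1) j)"
    unfolding One_nat_def prod.atLeast1_atMost_eq
  proof (intro prod.cong refl)
    fix j assume j: "j \<in> {..<s}"
    have "gpoch (- \<beta> + 1 + of_nat j) (int (m (r + j)) - int j) = pochhammer (- \<beta> + 1) (m (r + j)) / pochhammer (- \<beta> + 1) j"
      by (rule gpoch_quotient, rule p(2)) (use B(1)[of "r + j"] B(2) j in auto)
    moreover have "- \<beta> + of_nat (Suc j) = - \<beta> + 1 + of_nat j"
      "int (ns ! (Suc j - Suc 0)) + 1 - int (Suc j) = int (m (r + j)) - int j" by (simp_all add: mj)
    ultimately show "gpoch (- \<beta> + of_nat (Suc j)) (int (ns ! (Suc j - Suc 0)) + 1 - int (Suc j)) = pochhammer (- \<beta> + 1) (m (r + j)) / pochhammer (- \<beta> + 1) j"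
      by (simp only:)
  qed
  have 3: "(\<Prod>i=1..r. \<Prod>j=1..s. (of_nat j - of_nat i - \<beta>) / (of_nat (ns ! (j - 1)) - of_nat (ms ! (i - 1)) - \<beta>)) =
     (\<Prod>j<s. \<Prod>i<r. (of_nat j - of_nat i - \<beta>) / (of_nat (m (r + j)) - of_nat (m i) - \<beta>))"
    unfolding One_nat_def prod.atLeast1_atMost_eq
    by (subst prod.swap) (intro prod.cong refl, simp add: mi mj)
  show ?thesis unfolding phi0_formula_def Let_def r_def[symmetric] s_def[symmetric] 1 2 3 ..
qed

lemma pochhammer_nonzero:
  fixes z :: complex
  assumes "z \<notin> of_int ` {- int B..int B}" "k \<le> B"
  shows "pochhammer (z + 1) k \<noteq> 0"
proof
  assume "pochhammer (z + 1) k = 0"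
  then obtain i where i: "i < k" "z + 1 = - of_nat i" by (auto simp: pochhammer_eq_0_iff)
  then have "z = of_int (- int (Suc i))" by (simp add: algebra_simps eq_neg_iff_add_eq_0)
  moreover have "- int (Suc i) \<in> {- int B..int B}" using i assms(2) by auto
  ultimately show False using assms(1) by blast
qed

text \<open>Strictly decreasing naturals are distinct, so their sum is at least that of an initial
  segment. This makes the truncated subtractions in \<open>deg_d\<close> exact.\<close>

lemma choose_two_le_sum_list:
  assumes "sorted_wrt (>) (xs :: nat list)" shows "length xs choose 2 \<le> sum_list xs"
proof -
  have "distinct xs" using assms by (simp add: sorted_wrt_iff_nth_less distinct_conv_nth) (metis less_irrefl nat_neq_iff)
  then have "inj_on (\<lambda>i. xs ! i) {..<length xs}" by (auto simp: inj_on_def nth_eq_iff_index_eq)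
  then show ?thesis using sum_inj_nat_ge[of "{..<length xs}" "\<lambda>i. xs ! i"]
    by (simp add: sum_list_sum_nth atLeast0LessThan)
qed

theorem theorem2p2:
  fixes ms ns :: "nat list"
  assumes "sorted_wrt (>) ms" and "sorted_wrt (>) ns"
  shows "\<exists>\<Phi> :: int poly poly.
     degree \<Phi> = deg_d ms ns \<and> lead_coeff \<Phi> = 1 \<and>
     (\<forall>(\<beta>::complex) (x::real). x > 0 \<longrightarrow>
        Psi \<beta> ms ns x = kappa \<beta> ms ns
          * exp (- of_nat (length ms + length ns) * complex_of_real (x^2) / 2)
          * complex_of_real x powr
              (of_int ((int (length ms) - int (length ns))^2) / 2
               + \<beta> * of_int (int (length ms) - int (length ns)))
          * eval2 \<Phi> \<beta> (complex_of_real (x^2))) \<and>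
     (\<forall>k \<le> deg_d ms ns. degree (coeff \<Phi> k) \<le> deg_d ms ns - k) \<and>
     (\<exists>F :: complex set. finite F \<and>
        (\<forall>\<beta>. \<beta> \<notin> F \<longrightarrow> poly (map_poly of_int (coeff \<Phi> 0)) \<beta> = phi0_formula ms ns \<beta>)) \<and>
     coeff \<Phi> (deg_d ms ns) = 1 \<and>
     (deg_d ms ns \<ge> 1 \<longrightarrow> (\<forall>\<beta>.
        poly (map_poly of_int (coeff \<Phi> (deg_d ms ns - 1))) \<beta> = phi_dm1_formula ms ns \<beta>)) \<and>
     (deg_d ms ns \<ge> 2 \<longrightarrow> (\<forall>\<beta>.
        poly (map_poly of_int (coeff \<Phi> (deg_d ms ns - 2))) \<beta> = phi_dm2_formula ms ns \<beta>))"
proof -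
  define r where "r = length ms"
  define s where "s = length ns"
  define N where "N = r + s"
  define m where "m = (\<lambda>b. (ms @ ns) ! b)"
  define d where "d = deg_d ms ns"
  define V where "V = vand N (zpt r beta_poly m)"
  have dist: "m a \<noteq> m b" if "a < b" "b < N" "a < r \<longleftrightarrow> b < r" for a b
  proof (cases "b < r")
    case True
    then have "ms ! b < ms ! a" using assms(1) that by (simp add: sorted_wrt_iff_nth_less r_def)
    then show ?thesis using True that by (simp add: m_def nth_append r_def)
  next
    case False
    then have "ns ! (b - r) < ns ! (a - r)" using assms(2) that by (simp add: sorted_wrt_iff_nth_less N_def s_def)
    then show ?thesis using False that by (simp add: m_def nth_append r_def)
  qed
  have M: "(\<Sum>b<N. m b) = d + ((r choose 2) + (s choose 2))"
  proof -
    have "(\<Sum>b<N. m b) = sum_list ms + sum_list ns"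
      unfolding N_def sum_lessThan_add by (simp add: m_def r_def s_def nth_append sum_list_sum_nth atLeast0LessThan)
    then show ?thesis using choose_two_le_sum_list[OF assms(1)] choose_two_le_sum_list[OF assms(2)]
      by (simp add: d_def deg_d_def r_def s_def)
  qed
  obtain q where q: "gdet r N beta_poly m = [:V:] * q" unfolding V_def using vand_dvd_gdet by blast
  have qint: "coeff (coeff q i) j \<in> \<int>" for i j
    by (rule gdet_quotient_integral[OF dist q[unfolded V_def]])
  have qdeg: "degree (coeff q K) \<le> K" for K
    by (rule degree_quotient_le[OF dist q[unfolded V_def]])
  have V0: "V \<noteq> 0" unfolding V_def by (rule vand_zpt_nonzero(2)[OF dist])
  have qc: "coeff (gdet r N beta_poly m) K = V * coeff q K" for K unfolding q by simp
  have q_high: "coeff q K = 0" if "K > d" for K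
  proof -
    have "coeff (gdet r N beta_poly m) K = 0"
      by (rule coeff_gdet_eq_0) (use that M in \<open>auto simp: N_def\<close>)
    then show ?thesis using qc[of K] V0 by simp
  qed
  have q_0: "coeff q 0 = 1" using qc[of 0] V0 by (simp add: coeff_0_gdet V_def)
  define \<Phi> where "\<Phi> = (\<Sum>K\<le>d. monom (to_int_poly (coeff q K)) (d - K))"
  have c\<Phi>: "coeff \<Phi> k = (if k \<le> d then to_int_poly (coeff q (d - k)) else 0)" for k
  proof -
    have "coeff \<Phi> k = (\<Sum>K\<le>d. if d - K = k then to_int_poly (coeff q K) else 0)"
      by (simp add: \<Phi>_def coeff_sum)
    also have "\<dots> = (\<Sum>K\<le>d. if K = d - k \<and> k \<le> d then to_int_poly (coeff q K) else 0)"
      by (intro sum.cong refl) auto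
    finally show ?thesis by (simp cong: if_cong)
  qed
  have ev\<Phi>: "poly (map_poly of_int (coeff \<Phi> (d - K))) \<beta> = evc \<beta> (coeff q K)" if "K \<le> d" for K \<beta>
    using that poly_to_int_poly[OF qint, of K \<beta>] by (simp add: c\<Phi>)
  have top: "coeff \<Phi> d = 1"
    unfolding c\<Phi> using q_0 by (auto simp: poly_eq_iff coeff_to_int_poly coeff_1)
  have deg: "degree \<Phi> = d"
  proof (rule order_antisym)
    show "degree \<Phi> \<le> d" by (rule degree_le) (simp add: c\<Phi>)
    show "d \<le> degree \<Phi>" by (rule le_degree) (simp add: top)
  qed
  have cV: "evc \<beta> V = vand N (zpt r \<beta> m)" for \<beta>
  proof -
    interpret comm_ring_hom "evc \<beta>" by (rule evc_hom)
    have "evc \<beta> (zpt r beta_poly m b) = zpt r \<beta> m b" for b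
      by (simp add: zpt_def hom_distribs evc_beta)
    then show ?thesis unfolding V_def hom_vand[OF evc_hom] by simp
  qed
  have cg: "coeff (gdet r N \<beta> m) K = vand N (zpt r \<beta> m) * evc \<beta> (coeff q K)" for \<beta> K
  proof -
    interpret comm_ring_hom "evc \<beta>" by (rule evc_hom)
    have "coeff (gdet r N \<beta> m) K = coeff (map_poly (evc \<beta>) (gdet r N beta_poly m)) K"
      by (simp only: hom_gdet[OF evc_hom] evc_beta)
    also have "\<dots> = evc \<beta> (V * coeff q K)" by (simp add: coeff_map_poly qc)
    finally show ?thesis by (simp add: hom_distribs cV)
  qed
  have evc_continuous: "continuous_on UNIV (\<lambda>\<beta>. evc \<beta> p)" for p
    unfolding evc_def by (intro continuous_intros)
  have evc0: "evc \<beta> 0 = 0" for \<beta> by (simp add: evc_def)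
  have finV: "finite {\<beta>::complex. vand N (zpt r \<beta> m) = 0}"
  proof -
    have "map_poly (of_rat :: rat \<Rightarrow> complex) V \<noteq> 0"
    proof
      assume "map_poly (of_rat :: rat \<Rightarrow> complex) V = 0"
      then have "coeff (map_poly (of_rat :: rat \<Rightarrow> complex) V) i = 0" for i by simp
      then have "coeff V i = 0" for i by (simp add: coeff_map_poly)
      then show False using V0 by (simp add: poly_eq_iff)
    qed
    then have "finite {\<beta>. poly (map_poly of_rat V) \<beta> = (0::complex)}" by (rule poly_roots_finite)
    then show ?thesis unfolding cV[symmetric] evc_def .
  qed
  have Psi: "Psi \<beta> ms ns x = kappa \<beta> ms ns * exp (- of_nat N * complex_of_real (x^2) / 2)
      * complex_of_real x powr (of_int ((int r - int s)^2) / 2 + \<beta> * of_int (int r - int s))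
      * eval2 \<Phi> \<beta> (complex_of_real (x^2))" if x: "x > 0" for \<beta> x
  proof -
    let ?y = "complex_of_real (x^2)"
    have y: "?y \<noteq> 0" using x by simp
    let ?c = "\<lambda>K. evc \<beta> (coeff q K)"
    have "map_poly (\<lambda>c. poly (map_poly of_int c) \<beta>) \<Phi> = (\<Sum>K\<le>d. monom (?c K) (d - K))"
    proof (rule poly_eqI)
      fix k
      have "coeff (\<Sum>K\<le>d. monom (?c K) (d - K)) k = (\<Sum>K\<le>d. if K = d - k \<and> k \<le> d then ?c K else 0)"
        unfolding coeff_sum coeff_monom by (intro sum.cong refl) auto
      also have "\<dots> = (if k \<le> d then ?c (d - k) else 0)" by (simp cong: if_cong)
      finally show "coeff (map_poly (\<lambda>c. poly (map_poly of_int c) \<beta>) \<Phi>) k = coeff (\<Sum>K\<le>d. monom (?c K) (d - K)) k"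
        using ev\<Phi>[of "d - k" \<beta>] by (simp add: coeff_map_poly c\<Phi>)
    qed
    then have E: "eval2 \<Phi> \<beta> ?y = (\<Sum>K\<le>d. ?c K * ?y ^ (d - K))"
      by (simp add: eval2_def poly_sum poly_monom)
    have "gdet r N \<beta> m = (\<Sum>K\<le>d. monom (vand N (zpt r \<beta> m) * ?c K) K)"
    proof (rule poly_eqI)
      fix K
      show "coeff (gdet r N \<beta> m) K = coeff (\<Sum>K\<le>d. monom (vand N (zpt r \<beta> m) * ?c K) K) K"
        by (cases "K \<le> d") (simp_all add: cg coeff_sum q_high evc0)
    qed
    then have "?y ^ (\<Sum>b<N. m b) * poly (gdet r N \<beta> m) (1 / ?y) =
       ?y ^ (\<Sum>b<N. m b) * (\<Sum>K\<le>d. vand N (zpt r \<beta> m) * ?c K * (1 / ?y) ^ K)"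
      by (simp only: poly_sum poly_monom)
    also have "\<dots> = (\<Sum>K\<le>d. ?y ^ ((r choose 2) + (s choose 2)) * vand N (zpt r \<beta> m) * (?c K * ?y ^ (d - K)))"
      unfolding sum_distrib_left
    proof (intro sum.cong refl)
      fix K assume "K \<in> {..d}"
      then have e: "?y ^ (\<Sum>b<N. m b) * (1 / ?y) ^ K = ?y ^ ((r choose 2) + (s choose 2)) * ?y ^ (d - K)"
        unfolding M using y by (simp add: power_add power_diff power_one_over field_simps)
      have "?y ^ (\<Sum>b<N. m b) * (vand N (zpt r \<beta> m) * ?c K * (1 / ?y) ^ K)
         = (?y ^ (\<Sum>b<N. m b) * (1 / ?y) ^ K) * (vand N (zpt r \<beta> m) * ?c K)" by (simp only: mult_ac)
      also have "\<dots> = ?y ^ ((r choose 2) + (s choose 2)) * vand N (zpt r \<beta> m) * (?c K * ?y ^ (d - K))"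
        unfolding e by (simp only: mult_ac)
      finally show "?y ^ (\<Sum>b<N. m b) * (vand N (zpt r \<beta> m) * ?c K * (1 / ?y) ^ K) =
         ?y ^ ((r choose 2) + (s choose 2)) * vand N (zpt r \<beta> m) * (?c K * ?y ^ (d - K))" .
    qed
    also have "\<dots> = ?y ^ ((r choose 2) + (s choose 2)) * vand N (zpt r \<beta> m) * eval2 \<Phi> \<beta> ?y"
      unfolding E sum_distrib_left ..
    finally have G: "?y ^ (\<Sum>b<N. m b) * poly (gdet r N \<beta> m) (1 / ?y)
       = ?y ^ ((r choose 2) + (s choose 2)) * vand N (zpt r \<beta> m) * eval2 \<Phi> \<beta> ?y" .
    let ?X = "\<Prod>b<N. exp (- ?y / 2) * complex_of_real x powr (1/2 + apar r \<beta> b)"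
    let ?Y = "\<Prod>a<N. 1 / complex_of_real x ^ a"
    let ?T = "\<Prod>j<N. \<Prod>i<j. 2 :: complex"
    have "Psi \<beta> ms ns x = ?X * ?Y * (?T * ?y ^ (\<Sum>b<N. m b) * poly (gdet r N \<beta> m) (1 / ?y))"
      using Psi_gdet[OF x, of \<beta> ms ns] unfolding N_def r_def s_def m_def .
    also have "\<dots> = ?X * ?Y * (?T * (?y ^ (\<Sum>b<N. m b) * poly (gdet r N \<beta> m) (1 / ?y)))"
      by (simp only: mult.assoc)
    also have "\<dots> = (?T * vand N (zpt r \<beta> m)) * (?X * ?Y * ?y ^ ((r choose 2) + (s choose 2))) * eval2 \<Phi> \<beta> ?y"
      unfolding G by (simp only: mult_ac)
    also have "?T * vand N (zpt r \<beta> m) = kappa \<beta> ms ns"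
      unfolding kappa_vand N_def r_def s_def m_def ..
    also have "?X * ?Y * ?y ^ ((r choose 2) + (s choose 2)) = exp (- of_nat N * ?y / 2) * complex_of_real x powr
        (of_int ((int r - int s)^2) / 2 + \<beta> * of_int (int r - int s))"
      unfolding N_def by (rule prefactor[OF x])
    finally show ?thesis by (simp only: mult.assoc)
  qed
  have phi0: "\<exists>F. finite F \<and> (\<forall>\<beta>. \<beta> \<notin> F \<longrightarrow> poly (map_poly of_int (coeff \<Phi> 0)) \<beta> = phi0_formula ms ns \<beta>)"
  proof (intro exI conjI allI impI)
    define B where "B = (\<Sum>b<N. m b) + N"
    have mB: "m b \<le> B" if "b < N" for b
      using member_le_sum[of b "{..<N}" m] that by (simp add: B_def)
    \<comment> \<open>Outside this set no Pochhammer symbol or cross difference in the formula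
      vanishes, all their roots being integers bounded by \<open>B\<close>, and the Vandermonde
      product can be cancelled.\<close>
    let ?F = "of_int ` {- int B..int B} \<union> {\<beta>. vand N (zpt r \<beta> m) = 0} :: complex set"
    show "finite ?F" using finV by simp
    fix \<beta> assume \<beta>: "\<beta> \<notin> ?F"
    have "- \<beta> \<notin> of_int ` {- int B..int B}"
    proof
      assume "- \<beta> \<in> of_int ` {- int B..int B}"
      then obtain n where n: "- \<beta> = of_int n" "n \<in> {- int B..int B}" by blast
      have "\<beta> = of_int (- n)" unfolding of_int_minus n(1)[symmetric] by simp
      moreover have "- n \<in> {- int B..int B}" using n(2) by auto
      ultimately show False using \<beta> by blast
    qed
    then have p: "pochhammer (\<beta> + 1) k \<noteq> 0" "pochhammer (- \<beta> + 1) k \<noteq> 0" if "k \<le> B" for k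
      using pochhammer_nonzero that \<beta> by blast+
    have nz: "of_nat (m (r + j)) - of_nat (m i) - \<beta> \<noteq> 0" if "i < r" "j < s" for i j
    proof
      assume "of_nat (m (r + j)) - of_nat (m i) - \<beta> = 0"
      then have "\<beta> = of_int (int (m (r + j)) - int (m i))" by simp
      moreover have "int (m (r + j)) - int (m i) \<in> {- int B..int B}"
        using mB[of "r + j"] mB[of i] that by (auto simp: N_def)
      ultimately show False using \<beta> by blast
    qed
    let ?f = "phi0_formula ms ns \<beta>"
    have "coeff (gdet r N \<beta> m) d = vand N (zpt r \<beta> m) * ?f"
    proof -
      have "?f = (-1) ^ deg_d ms ns *
         (\<Prod>i<r. pochhammer (\<beta> + 1) (m i) / pochhammer (\<beta> + 1) i) *
         (\<Prod>j<s. pochhammer (- \<beta> + 1) (m (r + j)) / pochhammer (- \<beta> + 1) j) *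
         (\<Prod>j<s. \<Prod>i<r. (of_nat j - of_nat i - \<beta>) / (of_nat (m (r + j)) - of_nat (m i) - \<beta>))"
        unfolding r_def s_def m_def
        by (rule phi0_formula_eq[of B]) (use p mB in \<open>auto simp: N_def r_def s_def m_def B_def\<close>)
      then show ?thesis unfolding N_def
        by (simp only: d_def[symmetric])
          (rule gdet_lowest_quotient, use M p nz in \<open>auto simp: N_def B_def\<close>)
    qed
    then have "evc \<beta> (coeff q d) = ?f" using \<beta> by (simp add: cg)
    then show "poly (map_poly of_int (coeff \<Phi> 0)) \<beta> = ?f" using ev\<Phi>[of d \<beta>] by simp
  qed
  \<comment> \<open>The equation is obtained multiplied by the Vandermonde product; continuity in
    \<beta> carries it across the finitely many zeros of that product.\<close>
  have phi1: "evc \<beta> (coeff q 1) = phi_dm1_formula ms ns \<beta>" for \<beta>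
  proof (rule agree_off_finite[OF evc_continuous _ finV])
    show "continuous_on UNIV (phi_dm1_formula ms ns)"
      unfolding phi_dm1_formula_def Let_def by (intro continuous_intros)
    fix \<beta> :: complex assume "\<beta> \<notin> {\<beta>. vand N (zpt r \<beta> m) = 0}"
    then have nz: "vand N (zpt r \<beta> m) \<noteq> 0" by simp
    have "vand N (zpt r \<beta> m) * evc \<beta> (coeff q 1) = vand N (zpt r \<beta> m) * phi_dm1_formula ms ns \<beta>"
    proof -
      have "phi_dm1_formula ms ns \<beta> = - vshift N \<beta> (zpt r \<beta> m)"
        unfolding N_def r_def s_def m_def by (rule phi_dm1_vshift)
      then show ?thesis unfolding cg[symmetric] coeff_1_gdet by simp
    qed
    then show "evc \<beta> (coeff q 1) = phi_dm1_formula ms ns \<beta>" using nz by simp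
  qed
  have phi2: "evc \<beta> (coeff q 2) = phi_dm2_formula ms ns \<beta>" for \<beta>
  proof (rule agree_off_finite[OF evc_continuous _ finV])
    show "continuous_on UNIV (phi_dm2_formula ms ns)"
      unfolding phi_dm2_formula_def Let_def by (intro continuous_intros) auto
    fix \<beta> :: complex assume "\<beta> \<notin> {\<beta>. vand N (zpt r \<beta> m) = 0}"
    then have nz: "vand N (zpt r \<beta> m) \<noteq> 0" by simp
    have "2 * (vand N (zpt r \<beta> m) * evc \<beta> (coeff q 2)) = vand N (zpt r \<beta> m) * (2 * phi_dm2_formula ms ns \<beta>)"
    proof -
      have "2 * phi_dm2_formula ms ns \<beta> = (vshift N \<beta> (zpt r \<beta> m) + of_nat N - \<beta>) * vshift N \<beta> (zpt r \<beta> m)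
         - 2 * (pfclosed N (zpt r \<beta> m) 3 + \<beta> * pfclosed N (zpt r \<beta> m) 2)"
        unfolding N_def r_def s_def m_def by (rule phi_dm2_vshift)
      then show ?thesis unfolding cg[symmetric] coeff_2_gdet by (simp only:)
    qed
    then show "evc \<beta> (coeff q 2) = phi_dm2_formula ms ns \<beta>" using nz by simp
  qed
  have "degree (coeff \<Phi> k) \<le> d - k" if "k \<le> d" for k
    using that degree_to_int_poly[of "coeff q (d - k)"] qdeg[of "d - k"] by (simp add: c\<Phi>)
  moreover have "poly (map_poly of_int (coeff \<Phi> (d - 1))) \<beta> = phi_dm1_formula ms ns \<beta>" if "d \<ge> 1" for \<beta>
    using ev\<Phi>[OF that] phi1 by simp
  moreover have "poly (map_poly of_int (coeff \<Phi> (d - 2))) \<beta> = phi_dm2_formula ms ns \<beta>" if "d \<ge> 2" for \<beta>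
    using ev\<Phi>[OF that] phi2 by simp
  ultimately show ?thesis
    unfolding d_def[symmetric] r_def[symmetric] s_def[symmetric] N_def[symmetric]
    using deg top Psi phi0 by (intro exI[of _ \<Phi>]) simp
qed

end
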